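(* For $n\ge 2$ let $\tilde{b}_n$ denote the number of basic ideals in the Borel subalgebra $\tilde{\mathfrak b}_n$ of the untwisted affine Kac–Moody algebra $\tilde{\mathfrak g}_n$ of type $\tilde B_n$. Then for all $n\ge 4$, $$\tilde{b}_{n}-8\tilde{b}_{n-1}+16\tilde{b}_{n-2} = \frac{24}{n-1} \binom{2n-6}{n-2}.$$
   Context: Let $\mathfrak g_n$ be the simple complex Lie algebra of type $B_n$ with triangular decomposition $\mathfrak g_n=\mathfrak n_-\oplus\mathfrak h\oplus\mathfrak n_+$. The untwisted affine Kac–Moody algebra is $\tilde{\mathfrak g}_n=(\mathfrak g_n\otimes\mathbb C[t,t^{-1}])\oplus\mathbb Cc\oplus\mathbb Cd$, where $c$ is central, $[x\otimes t^k,y\otimes t^l]=[x,y]\otimes t^{k+l}+k\,(x|y)\,\delta_{k+l,0}\,c$ with $(\cdot|\cdot)$ the Killing form of $\mathfrak g_n$, $[d,x\otimes t^k]=k\,x\otimes t^k$ and $[d,c]=0$. Put $\tilde{\mathfrak h}=\mathrm{Span}(\{c,d\}\cup\{h\otimes 1: h\in\mathfrak h\})$, $\tilde{\mathfrak n}_+=\mathrm{Span}(\{x\otimes 1:x\in\mathfrak n_+\}\cup\{x\otimes t^k:x\in\mathfrak g_n,\ k>0\})$, and $\tilde{\mathfrak b}_n=\tilde{\mathfrak h}\oplus\tilde{\mathfrak n}_+$ (the Borel subalgebra). Root spaces $\tilde{\mathfrak g}_\alpha$ are taken with respect to $\tilde{\mathfrak h}$; the positive roots are those whose root spaces lie in $\tilde{\mathfrak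 n}_+$. Roots of $B_n$ are regarded as roots of $\tilde B_n$, and $\delta$ is the indivisible positive imaginary root (the root with $\tilde{\mathfrak g}_\delta=\mathfrak h\otimes t$). A combinatorial ideal is an ideal $\mathfrak i$ of $\tilde{\mathfrak b}_n$ that is contained in $\tilde{\mathfrak n}_+$, has finite codimension, and satisfies $\mathfrak i\cap\tilde{\mathfrak g}_\alpha\in\{\{0\},\tilde{\mathfrak g}_\alpha\}$ for each positive root $\alpha$. Its support $\mathrm{supp}(\mathfrak i)$ is the set of positive roots $\alpha$ with $\tilde{\mathfrak g}_\alpha\subset\mathfrak i$. Let $\Phi^+$ be the set of positive roots of $B_n$ and $D=\{\delta\}\cup\Phi^+\cup\{\delta-\gamma:\gamma\in\Phi^+\}$. A basic ideal is a combinatorial ideal $\mathfrak i$ with $\mathrm{supp}(\mathfrak i)\cap D\neq\emptyset$. *)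

theory Defs
  imports Complex_Main "HOL-Library.Function_Algebras" "HOL-Library.Product_Plus"
begin

(* Functionals on a subspace H are made unique by the convention that they vanish outside H,
   so that sums and differences of functionals are pointwise. *)
definition dual_of ::
  "(complex \<Rightarrow> 'b \<Rightarrow> 'b) \<Rightarrow> 'b::ab_group_add set \<Rightarrow> ('b \<Rightarrow> complex) set" where
  "dual_of scale H = {\<alpha>. (\<forall>x\<in>H. \<forall>y\<in>H. \<alpha> (x + y) = \<alpha> x + \<alpha> y)
                       \<and> (\<forall>c. \<forall>x\<in>H. \<alpha> (scale c x) = c * \<alpha> x)
                       \<and> (\<forall>x. x \<notin> H \<longrightarrow> \<alpha> x = 0)}"

definition root_space_of ::
  "(complex \<Rightarrow> 'b \<Rightarrow> 'b) \<Rightarrow> ('b \<Rightarrow> 'b \<Rightarrow> 'b) \<Rightarrow> 'b::ab_group_add set \<Rightarrow> 'b set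
     \<Rightarrow> ('b \<Rightarrow> complex) \<Rightarrow> 'b set" where
  "root_space_of scale br L H \<alpha> = {x \<in> L. \<forall>h\<in>H. br h x = scale (\<alpha> h) x}"

definition roots_of ::
  "(complex \<Rightarrow> 'b \<Rightarrow> 'b) \<Rightarrow> ('b \<Rightarrow> 'b \<Rightarrow> 'b) \<Rightarrow> 'b::ab_group_add set \<Rightarrow> 'b set
     \<Rightarrow> ('b \<Rightarrow> complex) set" where
  "roots_of scale br L H =
     {\<alpha> \<in> dual_of scale H. \<alpha> \<noteq> 0 \<and> root_space_of scale br L H \<alpha> \<noteq> {0}}"

definition pos_roots_of ::
  "(complex \<Rightarrow> 'b \<Rightarrow> 'b) \<Rightarrow> ('b \<Rightarrow> 'b \<Rightarrow> 'b) \<Rightarrow> 'b::ab_group_add set \<Rightarrow> 'b set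
     \<Rightarrow> 'b set \<Rightarrow> ('b \<Rightarrow> complex) set" where
  "pos_roots_of scale br L H N =
     {\<alpha> \<in> roots_of scale br L H. root_space_of scale br L H \<alpha> \<subseteq> N}"

definition lie_ideal_of ::
  "(complex \<Rightarrow> 'b \<Rightarrow> 'b) \<Rightarrow> ('b \<Rightarrow> 'b \<Rightarrow> 'b) \<Rightarrow> 'b::ab_group_add set \<Rightarrow> 'b set \<Rightarrow> bool" where
  "lie_ideal_of scale br L I \<longleftrightarrow>
     module.subspace scale I \<and> I \<subseteq> L \<and> (\<forall>x\<in>L. \<forall>y\<in>I. br x y \<in> I)"

(* The quotient V/W is spanned by the classes of finitely many elements of V. *)
definition finite_codim_in ::
  "(complex \<Rightarrow> 'b \<Rightarrow> 'b) \<Rightarrow> 'b::ab_group_add set \<Rightarrow> 'b set \<Rightarrow> bool" where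
  "finite_codim_in scale V W \<longleftrightarrow>
     (\<exists>F. finite F \<and> F \<subseteq> V \<and> V \<subseteq> module.span scale (W \<union> F))"

(* Trace of an endomorphism f of a finite-dimensional subspace V; the value does not depend
   on the chosen basis B. *)
definition trace_on ::
  "(complex \<Rightarrow> 'b \<Rightarrow> 'b) \<Rightarrow> 'b::ab_group_add set \<Rightarrow> ('b \<Rightarrow> 'b) \<Rightarrow> complex" where
  "trace_on scale V f =
     (let B = (SOME B. \<not> module.dependent scale B \<and> module.span scale B = V)
      in \<Sum>b\<in>B. module.representation scale B (f b) b)"


type_synonym cmat = "nat \<Rightarrow> nat \<Rightarrow> complex"

definition mat_scale :: "complex \<Rightarrow> cmat \<Rightarrow> cmat" where
  "mat_scale c A = (\<lambda>i j. c * A i j)"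

interpretation mat: vector_space mat_scale
  by unfold_locales (auto simp: mat_scale_def fun_eq_iff algebra_simps)

(* g_n is realised as the split orthogonal Lie algebra so(2n+1): square matrices A with rows
   and columns indexed by 0, ..., 2n (extended by zero) and A^T J + J A = 0, where J is the
   antidiagonal matrix of ones.  With h the diagonal and n_+ the strictly upper triangular
   matrices in g_n, and e_i in h* the i-th diagonal entry (0 <= i < n), the simple roots are
   e_0 - e_1, ..., e_(n-2) - e_(n-1), e_(n-1), which is type B_n. *)
definition fin_alg :: "nat \<Rightarrow> cmat set" where
  "fin_alg n = {A. (\<forall>i j. 2 * n < i \<or> 2 * n < j \<longrightarrow> A i j = 0)
                 \<and> (\<forall>i\<le>2 * n. \<forall>j\<le>2 * n. A i j + A (2 * n - j) (2 * n - i) = 0)}"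

definition fin_cartan :: "nat \<Rightarrow> cmat set" where
  "fin_cartan n = {A \<in> fin_alg n. \<forall>i j. i \<noteq> j \<longrightarrow> A i j = 0}"

definition fin_npos :: "nat \<Rightarrow> cmat set" where
  "fin_npos n = {A \<in> fin_alg n. \<forall>i j. j \<le> i \<longrightarrow> A i j = 0}"

definition mat_mult :: "nat \<Rightarrow> cmat \<Rightarrow> cmat \<Rightarrow> cmat" where
  "mat_mult n A B = (\<lambda>i j. \<Sum>k\<le>2 * n. A i k * B k j)"

definition fin_bracket :: "nat \<Rightarrow> cmat \<Rightarrow> cmat \<Rightarrow> cmat" where
  "fin_bracket n A B = mat_mult n A B - mat_mult n B A"

definition killing :: "nat \<Rightarrow> cmat \<Rightarrow> cmat \<Rightarrow> complex" where
  "killing n A B = trace_on mat_scale (fin_alg n) (\<lambda>X. fin_bracket n A (fin_bracket n B X))"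

definition fin_pos_roots :: "nat \<Rightarrow> (cmat \<Rightarrow> complex) set" where
  "fin_pos_roots n = pos_roots_of mat_scale (fin_bracket n) (fin_alg n) (fin_cartan n) (fin_npos n)"


(* The triple (f, a, b) stands for the sum of the f k \<otimes> t^k over all integers k, plus
   a c + b d. *)
type_synonym affine = "(int \<Rightarrow> cmat) \<times> complex \<times> complex"

definition aff_scale :: "complex \<Rightarrow> affine \<Rightarrow> affine" where
  "aff_scale r = (\<lambda>(f, a, b). (\<lambda>k. mat_scale r (f k), r * a, r * b))"

interpretation aff: vector_space aff_scale
  by unfold_locales
     (auto simp: aff_scale_def mat_scale_def fun_eq_iff algebra_simps plus_prod_def case_prod_beta)

definition aff_alg :: "nat \<Rightarrow> affine set" where
  "aff_alg n = {(f, a, b). finite {k. f k \<noteq> 0} \<and> (\<forall>k. f k \<in> fin_alg n)}"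

definition loop :: "cmat \<Rightarrow> int \<Rightarrow> affine" where
  "loop x k = (\<lambda>l. if l = k then x else 0, 0, 0)"

definition aff_c :: affine where "aff_c = (0, 1, 0)"

definition aff_d :: affine where "aff_d = (0, 0, 1)"

definition aff_bracket :: "nat \<Rightarrow> affine \<Rightarrow> affine \<Rightarrow> affine" where
  "aff_bracket n = (\<lambda>(f, a, b) (g, a', b').
     (\<lambda>m. (\<Sum>k | f k \<noteq> 0. fin_bracket n (f k) (g (m - k)))
           + mat_scale (b * of_int m) (g m) - mat_scale (b' * of_int m) (f m),
      \<Sum>k | f k \<noteq> 0. of_int k * killing n (f k) (g (- k)),
      0))"

lemma fin_bracket_zero [simp]: "fin_bracket n 0 y = 0" "fin_bracket n x 0 = 0"
  by (simp_all add: fin_bracket_def mat_mult_def fun_eq_iff)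

lemma killing_zero [simp]: "killing n 0 y = 0" "killing n x 0 = 0"
proof -
  have "module.representation mat_scale B 0 b = 0" for B b
  proof (cases "mat.independent B")
    case True
    then show ?thesis using mat.representation_zero[of B] by (metis (no_types))
  qed (simp add: mat.representation_def)
  then show "killing n 0 y = 0" "killing n x 0 = 0"
    by (simp_all add: killing_def trace_on_def Let_def)
qed

lemma aff_bracket_loop:
  "aff_bracket n (loop x k) (loop y l) =
     loop (fin_bracket n x y) (k + l)
       + aff_scale (if k + l = 0 then of_int k * killing n x y else 0) aff_c"
proof (cases "x = 0")
  case True
  have "loop 0 k = 0" for k by (simp add: loop_def zero_prod_def fun_eq_iff)
  moreover have "aff_bracket n 0 Y = 0" if "snd (snd Y) = 0" for Y
    using that by (auto simp: aff_bracket_def zero_prod_def mat_scale_def fun_eq_iff split: prod.splits)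
  moreover have "snd (snd (loop y l)) = 0" by (simp add: loop_def)
  ultimately show ?thesis using True by simp
next
  case False
  then have "{m. (if m = k then x else 0) \<noteq> 0} = {k}" by auto
  moreover have "m - k = l \<longleftrightarrow> m = k + l" "- k = l \<longleftrightarrow> k + l = 0" for m by auto
  ultimately show ?thesis
    by (auto simp: aff_bracket_def loop_def aff_c_def aff_scale_def mat_scale_def
        plus_prod_def fun_eq_iff[where 'a=int] fun_eq_iff[where 'a=nat])
qed

lemma aff_bracket_d:
  "aff_bracket n aff_d (loop x k) = aff_scale (of_int k) (loop x k)"
  "aff_bracket n (loop x k) aff_d = aff_scale (- of_int k) (loop x k)"
  by (auto simp: aff_bracket_def loop_def aff_d_def aff_scale_def mat_scale_def
      fun_eq_iff[where 'a=int] fun_eq_iff[where 'a=nat])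

lemma aff_bracket_c:
  "aff_bracket n aff_d aff_d = 0" "aff_bracket n aff_c X = 0" "aff_bracket n X aff_c = 0"
  by (auto simp: aff_bracket_def aff_c_def aff_d_def mat_scale_def zero_prod_def
      fun_eq_iff[where 'a=int] fun_eq_iff[where 'a=nat] split: prod.splits)

definition aff_cartan :: "nat \<Rightarrow> affine set" where
  "aff_cartan n = aff.span ({aff_c, aff_d} \<union> {loop h 0 | h. h \<in> fin_cartan n})"

definition aff_npos :: "nat \<Rightarrow> affine set" where
  "aff_npos n = aff.span ({loop x 0 | x. x \<in> fin_npos n}
                          \<union> {loop x k | x k. x \<in> fin_alg n \<and> 0 < k})"

definition borel :: "nat \<Rightarrow> affine set" where
  "borel n = {x + y | x y. x \<in> aff_cartan n \<and> y \<in> aff_npos n}"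

definition aff_root_space :: "nat \<Rightarrow> (affine \<Rightarrow> complex) \<Rightarrow> affine set" where
  "aff_root_space n = root_space_of aff_scale (aff_bracket n) (aff_alg n) (aff_cartan n)"

definition aff_roots :: "nat \<Rightarrow> (affine \<Rightarrow> complex) set" where
  "aff_roots n = roots_of aff_scale (aff_bracket n) (aff_alg n) (aff_cartan n)"

definition aff_pos_roots :: "nat \<Rightarrow> (affine \<Rightarrow> complex) set" where
  "aff_pos_roots n = pos_roots_of aff_scale (aff_bracket n) (aff_alg n) (aff_cartan n) (aff_npos n)"

(* A root of g_n as a root of the affine algebra: extended by zero on c and d. *)
definition extend_root :: "nat \<Rightarrow> (cmat \<Rightarrow> complex) \<Rightarrow> affine \<Rightarrow> complex" where
  "extend_root n \<alpha> = (\<lambda>(f, a, b). if (f, a, b) \<in> aff_cartan n then \<alpha> (f 0) else 0)"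

definition delta :: "nat \<Rightarrow> affine \<Rightarrow> complex" where
  "delta n = (THE \<alpha>. \<alpha> \<in> aff_roots n \<and> aff_root_space n \<alpha> = {loop h 1 | h. h \<in> fin_cartan n})"

definition combinatorial_ideal :: "nat \<Rightarrow> affine set \<Rightarrow> bool" where
  "combinatorial_ideal n I \<longleftrightarrow>
     lie_ideal_of aff_scale (aff_bracket n) (borel n) I \<and> I \<subseteq> aff_npos n
     \<and> finite_codim_in aff_scale (borel n) I
     \<and> (\<forall>\<alpha>\<in>aff_pos_roots n. I \<inter> aff_root_space n \<alpha> \<in> {{0}, aff_root_space n \<alpha>})"

definition ideal_support :: "nat \<Rightarrow> affine set \<Rightarrow> (affine \<Rightarrow> complex) set" where
  "ideal_support n I = {\<alpha> \<in> aff_pos_roots n. aff_root_space n \<alpha> \<subseteq> I}"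

definition basic_roots :: "nat \<Rightarrow> (affine \<Rightarrow> complex) set" where
  "basic_roots n = {delta n} \<union> extend_root n ` fin_pos_roots n
                   \<union> {delta n - extend_root n \<gamma> | \<gamma>. \<gamma> \<in> fin_pos_roots n}"

definition basic_ideal :: "nat \<Rightarrow> affine set \<Rightarrow> bool" where
  "basic_ideal n I \<longleftrightarrow> combinatorial_ideal n I \<and> ideal_support n I \<inter> basic_roots n \<noteq> {}"

definition num_basic_ideals :: "nat \<Rightarrow> nat" where
  "num_basic_ideals n = card {I. basic_ideal n I}"

end

(*
  An ideal containing a root space for a root in D contains g_delta, and with it all root spaces
  outside D.  It is therefore determined by A = {alpha in Phi+ : g_alpha in I} and
  C = {gamma in Phi+ : g_(delta - gamma) not in I}, and (A, C) arises from a basic ideal iff A and C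
  are upper sets of Phi+ such that no sum of a root in A and a root in C is a root.

  Phi+ is a trapezoid of matrix positions whose first row is the highest one, and the commutation
  condition only involves the first two rows of A and C.  Peeling off the first rows leaves two
  unconstrained upper sets A', C' of rank m = n - 1, and the number of ways to put first rows back is
  the square of (2n - a - c)^+, where a and c depend only on the widths of the first rows of A', C'.
  The number of upper sets with first row of a given width is 2^e minus twice a tail of a row of
  Pascal's triangle.  The double sum then is
  4^m (3m + 8) - (6m + 4) binomial(2m, m), and the recurrence follows.
*)
theory Submission
  imports Defs
begin

section \<open>Tails of the rows of Pascal's triangle\<close>

text \<open>What couples A and C is closure under the affine simple root delta - theta, where theta
  = e_0 + e_1 is the highest root: for alpha in A it yields alpha + delta - theta = delta - (theta -
  alpha), so theta - alpha cannot lie in C. Every decomposition of theta into two positive roots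
  pairs a root of the first row with one of the second; hence the deeper rows are unconstrained.
  Each remainder bounds one new first row from below and the other from above by the same amount,
  hence the square. The positive part in (2n - a - c)^+ obstructs a direct evaluation of the double
  sum. Each count is therefore split into a power of 2 and a tail: a product of two tails falls
  where the positive part is zero, and what is left are geometric sums and two sums of tails. On the
  Lie side, indexing by matrix positions makes all commutators uniform, at a price: antidiagonal
  positions carry no root, and the middle index n has weight zero. Several arguments have to bypass
  these two degeneracies.\<close>

definition tail_sum :: "nat \<Rightarrow> nat \<Rightarrow> real" where
  "tail_sum m e = (\<Sum>i = m..e. real (e choose i))"

lemma tail_sum_eq_0: "e < m \<Longrightarrow> tail_sum m e = 0"
  by (simp add: tail_sum_def)

lemma tail_sum_extend: "e \<le> N \<Longrightarrow> tail_sum m e = (\<Sum>i = m..N. real (e choose i))"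
  unfolding tail_sum_def by (rule sum.mono_neutral_left) auto

lemma tail_sum_Suc_Suc: "tail_sum (Suc m) (Suc e) = tail_sum m e + tail_sum (Suc m) e"
proof -
  have "tail_sum (Suc m) (Suc e) = (\<Sum>i = m..e. real (Suc e choose Suc i))"
    unfolding tail_sum_def by (rule sum.shift_bounds_cl_Suc_ivl)
  also have "\<dots> = tail_sum m e + (\<Sum>i = m..e. real (e choose Suc i))"
    by (simp add: tail_sum_def sum.distrib)
  also have "(\<Sum>i = m..e. real (e choose Suc i)) = (\<Sum>i = Suc m..Suc e. real (e choose i))"
    by (rule sum.shift_bounds_cl_Suc_ivl [symmetric])
  also have "\<dots> = tail_sum (Suc m) e"
    by (rule tail_sum_extend [symmetric]) simp
  finally show ?thesis .
qed

lemma tail_sum_step: "tail_sum m e = real (e choose m) + tail_sum (Suc m) e"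
proof (cases "m \<le> e")
  case True
  then show ?thesis by (simp add: tail_sum_def sum.atLeast_Suc_atMost)
qed (simp add: tail_sum_def)

lemma tail_sum_reflect:
  assumes "m + m' = Suc e"
  shows "tail_sum m e + tail_sum m' e = 2 ^ e"
proof -
  have "tail_sum m e = (\<Sum>i\<in>{..<m'}. real (e choose i))"
    unfolding tail_sum_def
    by (rule sum.reindex_bij_witness [of _ "\<lambda>i. e - i" "\<lambda>i. e - i"])
       (use assms in \<open>auto simp: binomial_symmetric [symmetric]\<close>)
  moreover have "(\<Sum>i\<in>{..<m'}. real (e choose i)) + tail_sum m' e = (\<Sum>i\<in>{..<m'} \<union> {m'..e}. real (e choose i))"
    unfolding tail_sum_def by (rule sum.union_disjoint [symmetric]) auto
  moreover have "{..<m'} \<union> {m'..e} = {..e}"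
    using assms by auto
  moreover have "(\<Sum>i\<le>e. real (e choose i)) = 2 ^ e"
    using choose_row_sum [of e] by (metis of_nat_sum of_nat_power of_nat_numeral)
  ultimately show ?thesis by simp
qed

text \<open>A hockey-stick sum: Pascal's rule for tails telescopes it into
  \<open>tail_sum (Suc m) (2 * m)\<close>, which by symmetry is half of row 2m without its central
  entry.\<close>

lemma sum_tail_sum: "(\<Sum>e<2 * m. tail_sum m e) = (4 ^ m - real (2 * m choose m)) / 2"
proof -
  have *: "(\<Sum>e<N. tail_sum m e) = tail_sum (Suc m) N" for N
  proof (induction N)
    case 0 then show ?case by (simp add: tail_sum_def)
  next
    case (Suc N) then show ?case by (simp add: tail_sum_Suc_Suc)
  qed
  have "tail_sum m (2 * m) + tail_sum (Suc m) (2 * m) = 4 ^ m"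
    by (subst tail_sum_reflect) (auto simp: power_mult)
  then show ?thesis using tail_sum_step [of m "2 * m"] unfolding * by (simp add: field_simps)
qed

text \<open>Both sides count the subsets of {0, ..., 2m - 1} with more than m elements, sorted on
  the left by the (m+1)-st element e. The proof is algebraic and rests on the sum of binomial(m+k,
  k) / 2^k over k <= m being 2^m.\<close>

lemma sum_choose_pow2:
  "(\<Sum>e<2 * m. real (e choose m) * 2 ^ (2 * m - 1 - e)) = (4 ^ m - real (2 * m choose m)) / 2"
proof -
  have "2 ^ m = (\<Sum>k\<le>m. (real (m + k) gchoose k) / 2 ^ k)"
    by (rule gbinomial_sum_nat_pow2 [symmetric])
  also have "\<dots> = (\<Sum>k\<le>m. real (m + k choose m) / 2 ^ k)"
  proof (rule sum.cong)
    fix k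
    have "(m + k) choose m = (m + k) choose k"
      by (subst binomial_symmetric) auto
    then show "(real (m + k) gchoose k) / 2 ^ k = real (m + k choose m) / 2 ^ k"
      by (simp only: binomial_gbinomial)
  qed simp
  finally have *: "(\<Sum>k\<le>m. real (m + k choose m) / 2 ^ k) = 2 ^ m" ..
  have "(\<Sum>e<2 * m. real (e choose m) * 2 ^ (2 * m - 1 - e))
      = (\<Sum>e\<in>{m..<2 * m}. real (e choose m) * 2 ^ (2 * m - 1 - e))"
    by (rule sum.mono_neutral_right) auto
  also have "\<dots> = (\<Sum>k<m. real (m + k choose m) * 2 ^ (m - 1 - k))"
    by (rule sum.reindex_bij_witness [of _ "\<lambda>k. m + k" "\<lambda>e. e - m"]) auto
  also have "\<dots> = (\<Sum>k<m. 2 ^ m / 2 * (real (m + k choose m) / 2 ^ k))"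
  proof (rule sum.cong)
    fix k assume "k \<in> {..<m}"
    then have "m = 1 + (m - 1 - k) + k" by auto
    then have "(2::real) ^ m = 2 ^ (1 + (m - 1 - k) + k)" by (rule arg_cong)
    then have "(2::real) ^ m = 2 * 2 ^ (m - 1 - k) * 2 ^ k"
      by (simp only: power_add power_one_right)
    then show "real (m + k choose m) * 2 ^ (m - 1 - k) = 2 ^ m / 2 * (real (m + k choose m) / 2 ^ k)"
      by simp
  qed simp
  also have "\<dots> = 2 ^ m / 2 * (\<Sum>k<m. real (m + k choose m) / 2 ^ k)"
    by (rule sum_distrib_left [symmetric])
  also have "(\<Sum>k<m. real (m + k choose m) / 2 ^ k) = 2 ^ m - real (2 * m choose m) / 2 ^ m"
    using * by (simp add: lessThan_Suc_atMost [symmetric] mult_2)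
  also have "2 ^ m / 2 * \<dots> = (4 ^ m - real (2 * m choose m)) / 2"
    by (simp add: right_diff_distrib flip: power_mult_distrib)
  finally show ?thesis .
qed

lemma central_binomial_Suc:
  "(real m + 1) * real (2 * Suc m choose Suc m) = 2 * (2 * real m + 1) * real (2 * m choose m)"
proof -
  have "Suc m * (Suc (2 * m + 1) choose Suc m) = Suc (2 * m + 1) * (2 * m + 1 choose m)"
    by (rule Suc_times_binomial)
  moreover have "2 * m + 1 choose m = 2 * m + 1 choose Suc m"
    by (subst binomial_symmetric) auto
  moreover have "Suc m * (Suc (2 * m) choose Suc m) = Suc (2 * m) * (2 * m choose m)"
    by (rule Suc_times_binomial)
  moreover have "Suc (2 * m + 1) = 2 * Suc m" "Suc (2 * m) = 2 * m + 1" by simp_all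
  ultimately have "Suc m * (2 * Suc m choose Suc m) = 2 * (Suc (2 * m) * (2 * m choose m))"
    by (metis mult.assoc)
  then have "real (Suc m * (2 * Suc m choose Suc m)) = real (2 * (Suc (2 * m) * (2 * m choose m)))"
    by (rule arg_cong)
  then show ?thesis by (simp only: of_nat_mult of_nat_Suc of_nat_numeral) (simp add: algebra_simps)
qed

text \<open>From m to m + 1, Pascal's rule splits the shifted sum into the old sum \<open>?U\<close>
  and a mixed sum \<open>?X\<close>, and \<open>sum_choose_pow2\<close> expresses \<open>?X\<close>
  through \<open>?U\<close>. The outcome, 4 \<open>?U\<close> plus a central binomial, fits the
  ratio of consecutive central binomials.\<close>

lemma sum_tail_sum_pow2:
  "(\<Sum>e<2 * m. tail_sum m e * 2 ^ (2 * m - 1 - e)) = real m * real (2 * m choose m) / 2"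
proof (induction m)
  case 0 then show ?case by simp
next
  case (Suc m)
  let ?U = "\<Sum>e<2 * m. tail_sum m e * 2 ^ (2 * m - 1 - e)"
  let ?X = "\<Sum>e<2 * m. tail_sum (Suc m) e * 2 ^ (2 * m - 1 - e)"
  have shift: "(\<Sum>e<2 * m. f e * 2 ^ (2 * m - e)) = 2 * (\<Sum>e<2 * m. f e * 2 ^ (2 * m - 1 - e))"
    for f :: "nat \<Rightarrow> real"
    unfolding sum_distrib_left
  proof (rule sum.cong)
    fix e assume "e \<in> {..<2 * m}"
    then have "2 * m - e = Suc (2 * m - 1 - e)" by auto
    then show "f e * 2 ^ (2 * m - e) = 2 * (f e * 2 ^ (2 * m - 1 - e))" by simp
  qed simp
  have diff: "?U = (4 ^ m - real (2 * m choose m)) / 2 + ?X"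
    by (subst tail_sum_step) (simp only: distrib_right sum.distrib sum_choose_pow2)
  have refl: "tail_sum m (2 * m) + tail_sum (Suc m) (2 * m) = 4 ^ m"
    by (subst tail_sum_reflect) (auto simp: power_mult)
  have "(\<Sum>e<2 * Suc m. tail_sum (Suc m) e * 2 ^ (2 * Suc m - 1 - e))
      = (\<Sum>e<Suc (2 * m). tail_sum (Suc m) (Suc e) * 2 ^ (2 * m - e))"
    using sum.lessThan_Suc_shift [of "\<lambda>e. tail_sum (Suc m) e * 2 ^ (2 * Suc m - 1 - e)" "Suc (2 * m)"]
    by (simp add: tail_sum_def)
  also have "\<dots> = 2 * ?U + 2 * ?X + (tail_sum m (2 * m) + tail_sum (Suc m) (2 * m))"
    by (simp add: tail_sum_Suc_Suc distrib_right sum.distrib shift)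
  also have "\<dots> = 4 * ?U + real (2 * m choose m)"
    unfolding refl using diff by (simp add: field_simps)
  also have "\<dots> = (2 * real m + 1) * real (2 * m choose m)"
    unfolding Suc.IH by (simp add: algebra_simps)
  also have "\<dots> = real (Suc m) * real (2 * Suc m choose Suc m) / 2"
    using central_binomial_Suc [of m] by (simp add: algebra_simps)
  finally show ?case .
qed

text \<open>For \<open>e < 2 * m\<close> this is the number of upper sets of rank \<open>m\<close>
  whose first row has width \<open>e + 1\<close>, see \<open>sum_over_widths\<close>. The empty set,
  the only one of width 0, is counted separately.\<close>

definition width_count :: "nat \<Rightarrow> nat \<Rightarrow> real" where
  "width_count m e = 2 ^ e - 2 * tail_sum m e"

text \<open>This is the recursion under removal of the first row: the 1 stands for an empty
  remainder, the sum for remainders of smaller width \<open>e' + 1\<close>.\<close>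

lemma width_count_Suc: "width_count (Suc m) e = 1 + (\<Sum>e'<e. width_count m e')"
proof (induction e)
  case 0 then show ?case by (simp add: width_count_def tail_sum_def)
next
  case (Suc e)
  then show ?case by (simp add: width_count_def tail_sum_Suc_Suc)
qed

text \<open>A first row in rank m + 1 has only 2m + 1 cells, so width 2m + 2 does not occur. Its
  vanishing count lets sums over widths run over twice the rank, a range that also suits rank
  0.\<close>

lemma width_count_last: "width_count (Suc m) (Suc (2 * m)) = 0"
  using tail_sum_reflect [of "Suc m" "Suc m" "Suc (2 * m)"] by (simp add: width_count_def)

section \<open>Evaluation of the weighted double sum\<close>

lemma sum_pow2_squares: "(\<Sum>e<j. 2 ^ e * (real (j - e))\<^sup>2) = 6 * 2 ^ j - (real j)\<^sup>2 - 4 * real j - 6"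
proof (induction j)
  case 0 then show ?case by simp
next
  case (Suc j)
  have "(\<Sum>e<Suc j. 2 ^ e * (real (Suc j - e))\<^sup>2) = (real (Suc j))\<^sup>2 + (\<Sum>e<j. 2 ^ Suc e * (real (j - e))\<^sup>2)"
    by (subst sum.lessThan_Suc_shift) simp
  also have "(\<Sum>e<j. 2 ^ Suc e * (real (j - e))\<^sup>2) = 2 * (\<Sum>e<j. 2 ^ e * (real (j - e))\<^sup>2)"
    by (simp add: sum_distrib_left mult.assoc)
  finally show ?case unfolding Suc.IH by (simp add: power2_eq_square algebra_simps)
qed

text \<open>This is the inner sum of \<open>weighted_square_sum\<close>. The subtraction is
  truncated, so the terms with \<open>e + 2 >= M\<close> vanish and \<open>sum_pow2_squares\<close>
  for \<open>M - 2\<close> remains.\<close>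

lemma sum_pow2_squares_truncated:
  assumes "M \<ge> 1" "M \<le> N + 2"
  shows "(real M)\<^sup>2 + (\<Sum>e<N. 2 ^ e * (real (M - (e + 2)))\<^sup>2) = 3 * 2 ^ (M - 1) - 2"
proof -
  have "(\<Sum>e<N. 2 ^ e * (real (M - (e + 2)))\<^sup>2) = (\<Sum>e<M - 2. 2 ^ e * (real (M - 2 - e))\<^sup>2)"
    by (rule sum.mono_neutral_cong_right) (use assms in \<open>auto simp: diff_diff_eq add.commute\<close>)
  also have "\<dots> = 6 * 2 ^ (M - 2) - (real (M - 2))\<^sup>2 - 4 * real (M - 2) - 6"
    by (rule sum_pow2_squares)
  finally have eq: "(\<Sum>e<N. 2 ^ e * (real (M - (e + 2)))\<^sup>2) = \<dots>" .
  show ?thesis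
  \<comment> \<open>Here \<open>M - 2\<close> truncates to 0, so M = 1 cannot be treated by
    substituting M = j + 2.\<close>
  proof (cases "M = 1")
    case False
    then obtain j where "M = j + 2" using assms by (metis One_nat_def add_2_eq_Suc' le_Suc_ex le_antisym not_less_eq_eq plus_1_eq_Suc)
    then show ?thesis unfolding eq by (simp add: power2_eq_square algebra_simps)
  qed (simp add: eq)
qed

text \<open>A remainder of width \<open>l > 0\<close> forbids \<open>l + 1\<close> of the widths 0,
  ..., 2m + 1: the smallest ones for its own new first row and the largest ones for that of the
  other upper set. An empty remainder forbids none.\<close>

definition row_gap :: "nat \<Rightarrow> nat" where
  "row_gap l = (if l = 0 then 0 else l + 1)"

lemma row_gap_simps [simp]: "row_gap 0 = 0" "row_gap (Suc e) = e + 2"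
  by (simp_all add: row_gap_def)

text \<open>By \<open>sum_over_widths\<close>, \<open>S f\<close> is the sum of
  \<open>f (width A)\<close> over the upper sets of rank \<open>m\<close>. Expanding
  \<open>S = P - T\<close> in both variables leaves PP - 2 TP, since PT = TP by symmetry and TT = 0;
  the inner \<open>P\<close> has a closed form in powers of 2.\<close>

lemma weighted_square_sum:
  fixes m :: nat
  defines "q \<equiv> \<lambda>l l'. (real (2 * m + 2 - row_gap l - row_gap l'))\<^sup>2"
  defines "S \<equiv> \<lambda>f :: nat \<Rightarrow> real. f 0 + (\<Sum>e<2 * m. width_count m e * f (Suc e))"
  shows "S (\<lambda>l. S (q l)) = 4 ^ m * (3 * real m + 8) - (6 * real m + 4) * real (2 * m choose m)"
proof -
  define P where "P f = f 0 + (\<Sum>e<2 * m. 2 ^ e * f (Suc e))" for f :: "nat \<Rightarrow> real"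
  define T where "T f = 2 * (\<Sum>e<2 * m. tail_sum m e * f (Suc e))" for f :: "nat \<Rightarrow> real"
  have S: "S f = P f - T f" for f
    by (simp add: S_def P_def T_def width_count_def left_diff_distrib sum_subtractf
        sum_distrib_left mult.assoc)
  have lin: "P (\<lambda>l. f l - g l) = P f - P g" "T (\<lambda>l. f l - g l) = T f - T g" for f g
    by (simp_all add: P_def T_def right_diff_distrib sum_subtractf sum_distrib_left)
  have q_sym: "q l l' = q l' l" for l l' by (simp add: q_def add.commute)
  have swap: "P (\<lambda>l. T (q l)) = T (\<lambda>l. P (q l))"
  proof -
    have "P (\<lambda>l. T (q l)) = 2 * (\<Sum>e<2 * m. tail_sum m e * q 0 (Suc e))
        + (\<Sum>e<2 * m. \<Sum>e'<2 * m. 2 ^ e * (2 * (tail_sum m e' * q (Suc e) (Suc e'))))"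
      by (simp add: P_def T_def sum_distrib_left)
    also have "(\<Sum>e<2 * m. \<Sum>e'<2 * m. 2 ^ e * (2 * (tail_sum m e' * q (Suc e) (Suc e'))))
       = (\<Sum>e'<2 * m. \<Sum>e<2 * m. 2 ^ e * (2 * (tail_sum m e' * q (Suc e) (Suc e'))))"
      by (rule sum.swap)
    finally show ?thesis
      by (simp add: P_def T_def sum_distrib_left distrib_left sum.distrib q_sym mult_ac)
  qed
  \<comment> \<open>A tail is nonzero only for \<open>e >= m\<close>; two such widths have gaps of
    at least m + 2 each, which together exceed 2m + 2.\<close>
  have TT: "T (\<lambda>l. T (q l)) = 0"
  proof -
    have "tail_sum m e = 0 \<or> tail_sum m e' = 0 \<or> q (Suc e) (Suc e') = 0" for e e'
      by (cases "e < m"; cases "e' < m") (auto simp: tail_sum_eq_0 q_def)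
    then show ?thesis by (auto simp: T_def sum_distrib_left intro!: sum.neutral)
  qed
  \<comment> \<open>The bound keeps M >= 1 in \<open>sum_pow2_squares_truncated\<close>; for M = 0
    the closed form would give 1 instead of 0.\<close>
  have P_q: "P (q l) = 3 * 2 ^ (2 * m + 1 - row_gap l) - 2" if "row_gap l \<le> 2 * m + 1" for l
    using sum_pow2_squares_truncated [of "2 * m + 2 - row_gap l" "2 * m"] that
    by (simp add: P_def q_def)
  have "P (\<lambda>l. P (q l)) = 3 * 2 ^ (2 * m + 1) - 2 + (\<Sum>e<2 * m. 2 ^ e * (3 * 2 ^ (2 * m - 1 - e) - 2))"
    by (simp add: P_q P_def [of "\<lambda>l. P (q l)"])
  also have "(\<Sum>e<2 * m. 2 ^ e * (3 * 2 ^ (2 * m - 1 - e) - 2)) = (\<Sum>e<2 * m. 3 * 2 ^ (2 * m) / 2 - 2 * (2::real) ^ e)"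
  proof (rule sum.cong)
    fix e assume "e \<in> {..<2 * m}"
    then have "(2::real) ^ (2 * m) = 2 * (2 ^ e * 2 ^ (2 * m - 1 - e))"
      by (simp flip: power_Suc power_add)
    then show "2 ^ e * (3 * 2 ^ (2 * m - 1 - e) - 2) = 3 * 2 ^ (2 * m) / 2 - 2 * (2::real) ^ e"
      by (simp add: algebra_simps)
  qed simp
  also have "\<dots> = 3 * real m * 2 ^ (2 * m) - 2 * (2 ^ (2 * m) - 1)"
    by (simp add: sum_subtractf flip: sum_distrib_left) (simp add: sum_distrib_left [symmetric] geometric_sum lessThan_atLeast0 [symmetric])
  finally have PP: "P (\<lambda>l. P (q l)) = 4 ^ m * (3 * real m + 4)"
    using power_mult [of "2::real" 2 m] by (simp add: algebra_simps)
  have "T (\<lambda>l. P (q l)) = 2 * (\<Sum>e<2 * m. 3 * (tail_sum m e * 2 ^ (2 * m - 1 - e)) - 2 * tail_sum m e)"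
    unfolding T_def by (intro arg_cong2 [of _ _ _ _ "(*)"] sum.cong) (auto simp: P_q algebra_simps)
  also have "\<dots> = 2 * (3 * (\<Sum>e<2 * m. tail_sum m e * 2 ^ (2 * m - 1 - e)) - 2 * (\<Sum>e<2 * m. tail_sum m e))"
    by (simp only: sum_subtractf sum_distrib_left)
  finally have TP: "T (\<lambda>l. P (q l)) = 3 * real m * real (2 * m choose m) - 2 * (4 ^ m - real (2 * m choose m))"
    unfolding sum_tail_sum sum_tail_sum_pow2 by (simp add: field_simps)
  have "S (\<lambda>l. S (q l)) = P (\<lambda>l. P (q l)) - P (\<lambda>l. T (q l)) - T (\<lambda>l. P (q l)) + T (\<lambda>l. T (q l))"
    by (simp add: S lin)
  then show ?thesis unfolding swap TT PP TP by (simp add: algebra_simps)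
qed

section \<open>Pairs of upper sets of the positive roots\<close>

text \<open>The cell \<open>(i, j)\<close> stands for the positive root whose root space is spanned by the matrix
  \<open>E\<^bsub>i j\<^esub> - E\<^bsub>2n-j, 2n-i\<^esub>\<close>, that is \<open>e\<^sub>i - e\<^sub>j\<close> for \<open>j < n\<close>, \<open>e\<^sub>i\<close> for \<open>j = n\<close>, and
  \<open>e\<^sub>i + e\<^bsub>2n-j\<^esub>\<close> for \<open>j > n\<close>.\<close>

definition cells :: "nat \<Rightarrow> (nat \<times> nat) set" where
  "cells n = {(i, j). i < j \<and> i + j < 2 * n}"

definition upper_sets :: "nat \<Rightarrow> (nat \<times> nat) set set" where
  "upper_sets n = {A. A \<subseteq> cells n \<and>
     (\<forall>i j k l. (i, j) \<in> A \<longrightarrow> k \<le> i \<longrightarrow> j \<le> l \<longrightarrow> k + l < 2 * n \<longrightarrow> (k, l) \<in> A)}"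

definition width :: "(nat \<times> nat) set \<Rightarrow> nat" where
  "width A = card {j. (0, j) \<in> A}"

definition peel :: "(nat \<times> nat) set \<Rightarrow> (nat \<times> nat) set" where
  "peel A = {(i, j). (Suc i, Suc j) \<in> A}"

definition add_row :: "nat \<Rightarrow> (nat \<times> nat) set \<Rightarrow> nat \<Rightarrow> (nat \<times> nat) set" where
  "add_row m A k = {(0, j) | j. 2 * m + 2 - k \<le> j \<and> j < 2 * m + 2} \<union> {(Suc i, Suc j) | i j. (i, j) \<in> A}"

lemma upper_setsD:
  assumes "A \<in> upper_sets n" "(i, j) \<in> A"
  shows "i < j" "i + j < 2 * n" "\<And>k l. k \<le> i \<Longrightarrow> j \<le> l \<Longrightarrow> k + l < 2 * n \<Longrightarrow> (k, l) \<in> A"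
  using assms unfolding upper_sets_def cells_def by blast+

lemma finite_cells: "finite (cells n)"
  by (rule finite_subset [of _ "{..<2 * n} \<times> {..<2 * n}"]) (auto simp: cells_def)

lemma finite_upper_sets: "finite (upper_sets n)"
  by (rule finite_subset [of _ "Pow (cells n)"]) (auto simp: upper_sets_def finite_cells)

text \<open>Upward closure makes the first row a final segment of the columns 1, ..., 2n - 1, so its
  length determines it.\<close>

lemma row_iff:
  assumes "A \<in> upper_sets n"
  shows "(0, j) \<in> A \<longleftrightarrow> 2 * n - width A \<le> j \<and> j < 2 * n"
    and "width A \<le> 2 * n - 1"
proof -
  define R where "R = {j. (0, j) \<in> A}"
  have w: "width A = card R" by (simp add: width_def R_def)
  have sub: "R \<subseteq> {1..<2 * n}"
    using upper_setsD(1,2) [OF assms, of 0] by (auto simp: R_def Suc_le_eq)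
  then show "width A \<le> 2 * n - 1"
    using card_mono [OF _ sub] by (simp add: w)
  show "(0, j) \<in> A \<longleftrightarrow> 2 * n - width A \<le> j \<and> j < 2 * n"
  proof (cases "R = {}")
    case True
    then show ?thesis unfolding w by (auto simp: R_def)
  next
    case False
    define p where "p = (LEAST p. p \<in> R)"
    have p: "p \<in> R" "\<And>j. j \<in> R \<Longrightarrow> p \<le> j"
      using False LeastI_ex [of "\<lambda>p. p \<in> R"] Least_le [of "\<lambda>p. p \<in> R"] unfolding p_def by auto
    have "R = {p..<2 * n}"
    proof
      show "{p..<2 * n} \<subseteq> R"
        using upper_setsD(3) [OF assms, of 0 p 0] p(1) by (auto simp: R_def)
    qed (use sub p in auto)
    moreover from this have "width A = 2 * n - p" by (simp add: w)
    moreover have "p < 2 * n" using sub p by auto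
    ultimately show ?thesis by (auto simp: R_def set_eq_iff)
  qed
qed

lemma peel_upper:
  assumes "A \<in> upper_sets (Suc m)"
  shows "peel A \<in> upper_sets m" "width A < 2 * m + 2" "width (peel A) = 0 \<or> width (peel A) < width A"
proof -
  show peel: "peel A \<in> upper_sets m"
    unfolding upper_sets_def
  proof (intro CollectI conjI allI impI)
    show "peel A \<subseteq> cells m"
      using upper_setsD(1,2) [OF assms] by (fastforce simp: peel_def cells_def)
    show "(k, l) \<in> peel A" if "(i, j) \<in> peel A" "k \<le> i" "j \<le> l" "k + l < 2 * m" for i j k l
      using upper_setsD(3) [OF assms, of "Suc i" "Suc j" "Suc k" "Suc l"] that by (simp add: peel_def)
  qed
  show "width A < 2 * m + 2"
    using row_iff(2) [OF assms] by simp
  show "width (peel A) = 0 \<or> width (peel A) < width A"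
  proof (cases "width (peel A) = 0")
    case False
    \<comment> \<open>The leftmost cell in the first row of \<open>peel A\<close> lies in row 1 of
      \<open>A\<close>, and the cell above it in row 0. Row 0 reaches one column further to the
      right than row 1, which makes the inequality strict.\<close>
    let ?j = "2 * m - width (peel A)"
    have le: "width (peel A) \<le> 2 * m - 1" by (rule row_iff(2) [OF peel])
    then have "(0, ?j) \<in> peel A"
      using row_iff(1) [OF peel, of ?j] False by simp
    then have "(Suc 0, Suc ?j) \<in> A" by (simp add: peel_def)
    then have "(0, Suc ?j) \<in> A"
      by (rule upper_setsD(3) [OF assms]) simp_all
    then have "2 * Suc m - width A \<le> Suc ?j"
      using row_iff(1) [OF assms] by blast
    then show ?thesis using le False by arith
  qed simp
qed

lemma add_row_upper:
  assumes A: "A \<in> upper_sets m" and k: "k < 2 * m + 2" "width A = 0 \<or> width A < k"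
  shows "add_row m A k \<in> upper_sets (Suc m)" "peel (add_row m A k) = A" "width (add_row m A k) = k"
proof -
  show "peel (add_row m A k) = A"
    by (auto simp: peel_def add_row_def)
  have "{j. (0, j) \<in> add_row m A k} = {2 * m + 2 - k..<2 * m + 2}"
    by (auto simp: add_row_def)
  then show "width (add_row m A k) = k"
    using k by (simp add: width_def)
  have "(i', j') \<in> add_row m A k"
    if *: "(i, j) \<in> add_row m A k" "i' \<le> i" "j \<le> j'" "i' + j' < 2 * Suc m" for i j i' j'
  proof (cases i)
    case 0
    then show ?thesis using * by (auto simp: add_row_def)
  next
    case (Suc i0)
    then obtain j0 where j0: "j = Suc j0" "(i0, j0) \<in> A"
      using *(1) by (auto simp: add_row_def)
    obtain l where l: "j' = Suc l" "j0 \<le> l" using j0 * by (cases j') auto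
    show ?thesis
    proof (cases i')
      case 0
      have "(0, j0) \<in> A"
        using upper_setsD [OF A j0(2)] by simp
      then have "2 * m - width A \<le> j0" "j0 < 2 * m"
        using row_iff(1) [OF A] by auto
      then have "2 * m + 2 - k \<le> j'" using k l by auto
      then show ?thesis using * 0 by (simp add: add_row_def)
    next
      case (Suc i1)
      have "(i1, l) \<in> A"
        using upper_setsD(3) [OF A j0(2), of i1 l] * Suc l \<open>i = Suc i0\<close> by simp
      then show ?thesis using Suc l by (simp add: add_row_def)
    qed
  qed
  moreover have "add_row m A k \<subseteq> cells (Suc m)"
    using upper_setsD(1,2) [OF A] k by (fastforce simp: add_row_def cells_def)
  ultimately show "add_row m A k \<in> upper_sets (Suc m)"
    unfolding upper_sets_def by blast
qed

lemma add_row_peel: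
  assumes "A \<in> upper_sets (Suc m)"
  shows "add_row m (peel A) (width A) = A"
proof -
  have "(i, j) \<in> add_row m (peel A) (width A) \<longleftrightarrow> (i, j) \<in> A" for i j
  proof (cases i)
    case 0
    then show ?thesis using row_iff(1) [OF assms, of j] by (auto simp: add_row_def)
  next
    case (Suc i0)
    then show ?thesis
      using upper_setsD(1) [OF assms, of i j] by (cases j) (auto simp: add_row_def peel_def)
  qed
  then show ?thesis by auto
qed

lemma bij_betw_peel:
  "bij_betw (\<lambda>A. (peel A, width A)) (upper_sets (Suc m))
     (SIGMA A : upper_sets m. {k. k < 2 * m + 2 \<and> (width A = 0 \<or> width A < k)})"
  by (rule bij_betw_byWitness [of _ "\<lambda>(A, k). add_row m A k"])
     (auto simp: add_row_peel add_row_upper peel_upper(1) dest: peel_upper(2,3))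

text \<open>Induction over the rank via \<open>bij_betw_peel\<close>. A remainder of width l admits
  every new width if l = 0 and only larger ones otherwise; \<open>F l\<close> is the sum over these.
  Exchanging the two sums produces the recursion \<open>width_count_Suc\<close>.\<close>

lemma sum_over_widths:
  fixes f :: "nat \<Rightarrow> real"
  shows "(\<Sum>A\<in>upper_sets m. f (width A)) = f 0 + (\<Sum>e<2 * m. width_count m e * f (Suc e))"
proof (induction m arbitrary: f)
  case 0
  have "upper_sets 0 = {{}}" by (auto simp: upper_sets_def cells_def)
  then show ?case by (simp add: width_def)
next
  case (Suc m)
  define F where "F l = (\<Sum>k | k < 2 * m + 2 \<and> (l = 0 \<or> l < k). f k)" for l
  have "(\<Sum>A\<in>upper_sets (Suc m). f (width A))
      = (\<Sum>(A, k)\<in>(SIGMA A : upper_sets m. {k. k < 2 * m + 2 \<and> (width A = 0 \<or> width A < k)}). f k)"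
    using sum.reindex_bij_betw [OF bij_betw_peel, of "\<lambda>(A, k). f k" m] by simp
  also have "\<dots> = (\<Sum>A\<in>upper_sets m. F (width A))"
    unfolding F_def by (subst sum.Sigma) (auto simp: finite_upper_sets)
  also have "\<dots> = F 0 + (\<Sum>e<2 * m. width_count m e * F (Suc e))"
    by (rule Suc.IH)
  also have "F 0 = f 0 + (\<Sum>e<2 * m + 1. f (Suc e))"
  proof -
    have "F 0 = (\<Sum>k<Suc (2 * m + 1). f k)" by (simp add: F_def lessThan_def)
    then show ?thesis by (simp only: sum.lessThan_Suc_shift)
  qed
  also have "(\<Sum>e<2 * m. width_count m e * F (Suc e)) = (\<Sum>e<2 * m + 1. (\<Sum>e'<e. width_count m e') * f (Suc e))"
  proof -
    have F: "F (Suc e) = (\<Sum>e' | e' < 2 * m + 1 \<and> e < e'. f (Suc e'))" for e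
      unfolding F_def
      by (rule sum.reindex_bij_witness [of _ Suc "\<lambda>k. k - 1"]) auto
    have "(\<Sum>e<2 * m. width_count m e * F (Suc e))
        = (\<Sum>e<2 * m. \<Sum>e' | e' < 2 * m + 1 \<and> e < e'. width_count m e * f (Suc e'))"
      by (simp add: F sum_distrib_left)
    also have "\<dots> = (\<Sum>e'<2 * m + 1. \<Sum>e | e < 2 * m \<and> e < e'. width_count m e * f (Suc e'))"
      using sum.swap_restrict [of "{..<2 * m}" "{..<2 * m + 1}" "\<lambda>e e'. width_count m e * f (Suc e')" "(<)"]
      by simp
    also have "\<dots> = (\<Sum>e'<2 * m + 1. \<Sum>e<e'. width_count m e * f (Suc e'))"
      by (intro sum.cong) auto
    finally show ?thesis by (simp add: sum_distrib_right)
  qed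
  also have "f 0 + (\<Sum>e<2 * m + 1. f (Suc e)) + (\<Sum>e<2 * m + 1. (\<Sum>e'<e. width_count m e') * f (Suc e))
     = f 0 + (\<Sum>e<2 * m + 1. width_count (Suc m) e * f (Suc e))"
    by (simp add: width_count_Suc distrib_right sum.distrib)
  also have "(\<Sum>e<2 * m + 1. width_count (Suc m) e * f (Suc e)) = (\<Sum>e<2 * Suc m. width_count (Suc m) e * f (Suc e))"
    using width_count_last [of m] by simp
  finally show ?case .
qed

text \<open>For upper sets this already says that no root of \<open>A\<close> plus a root of \<open>C\<close> is a root: if a sum
  is a root, then the two summands can be raised into the first two rows; see \<open>compatible_chain\<close>
  below.\<close>

definition compatible :: "nat \<Rightarrow> (nat \<times> nat) set \<Rightarrow> (nat \<times> nat) set \<Rightarrow> bool" where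
  "compatible n A C \<longleftrightarrow> (\<forall>j. \<not> ((0, j) \<in> A \<and> (1, 2 * n - j) \<in> C) \<and> \<not> ((0, j) \<in> C \<and> (1, 2 * n - j) \<in> A))"

text \<open>As sets of columns j, the first row of \<open>A\<close> is a final segment, while the
  second row of \<open>C\<close>, reflected, is the segment from 2 to
  \<open>width (peel C) + 1\<close>. A clash is an overlap of these two intervals.\<close>

lemma no_clash_iff:
  assumes A: "A \<in> upper_sets (Suc m)" and C: "C \<in> upper_sets (Suc m)"
  shows "(\<forall>j. \<not> ((0, j) \<in> A \<and> (1, 2 * Suc m - j) \<in> C))
     \<longleftrightarrow> width (peel C) = 0 \<or> width A + width (peel C) \<le> 2 * m"
proof -
  note P = peel_upper(1) [OF C]
  have C_iff: "(1, 2 * Suc m - j) \<in> C \<longleftrightarrow> 2 \<le> j \<and> j \<le> width (peel C) + 1" if "j < 2 * m + 2" for j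
  proof -
    have "2 * Suc m - j = Suc (2 * m + 1 - j)" using that by auto
    then have "(1, 2 * Suc m - j) \<in> C \<longleftrightarrow> (0, 2 * m + 1 - j) \<in> peel C"
      by (simp only: peel_def One_nat_def mem_Collect_eq prod.case)
    also have "\<dots> \<longleftrightarrow> 2 * m - width (peel C) \<le> 2 * m + 1 - j \<and> 2 * m + 1 - j < 2 * m"
      by (rule row_iff(1) [OF P])
    also have "\<dots> \<longleftrightarrow> 2 \<le> j \<and> j \<le> width (peel C) + 1"
      using row_iff(2) [OF P] that by linarith
    finally show ?thesis .
  qed
  have A_iff: "(0, j) \<in> A \<longleftrightarrow> 2 * m + 2 - width A \<le> j \<and> j < 2 * m + 2" for j
    using row_iff(1) [OF A, of j] by simp
  have w: "width A \<le> 2 * m + 1" "width (peel C) \<le> 2 * m - 1"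
    using row_iff(2) [OF A] row_iff(2) [OF P] by simp_all
  show ?thesis
  proof
    assume L: "\<forall>j. \<not> ((0, j) \<in> A \<and> (1, 2 * Suc m - j) \<in> C)"
    show "width (peel C) = 0 \<or> width A + width (peel C) \<le> 2 * m"
    proof (rule ccontr)
      assume "\<not> ?thesis"
      then have gt: "width (peel C) \<noteq> 0" "width A + width (peel C) > 2 * m" by auto
      \<comment> \<open>The first column that both segments share; the 2 decides when
        \<open>A\<close> fills its whole first row.\<close>
      define j where "j = max 2 (2 * m + 2 - width A)"
      have j: "2 * m + 2 - width A \<le> j" "2 \<le> j" "j < 2 * m + 2" "j \<le> width (peel C) + 1"
        using gt w unfolding j_def by linarith+
      have "(0, j) \<in> A" "(1, 2 * Suc m - j) \<in> C"
        using A_iff C_iff j by blast+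
      with L show False by blast
    qed
  next
    assume R: "width (peel C) = 0 \<or> width A + width (peel C) \<le> 2 * m"
    show "\<forall>j. \<not> ((0, j) \<in> A \<and> (1, 2 * Suc m - j) \<in> C)"
    proof (intro allI notI, elim conjE)
      fix j assume "(0, j) \<in> A" "(1, 2 * Suc m - j) \<in> C"
      then have "2 * m + 2 - width A \<le> j" "2 \<le> j" "j \<le> width (peel C) + 1"
        using A_iff C_iff by blast+
      then show False using R w by linarith
    qed
  qed
qed

text \<open>For fixed remainders the two new first rows are chosen independently of each other.
  Their ranges \<open>ks\<close> are intervals of equal length, because exchanging the remainders
  only exchanges the lower and the upper loss; this gives the square.\<close>

lemma card_compatible_pairs:
  "real (card {(A, C). A \<in> upper_sets (Suc m) \<and> C \<in> upper_sets (Suc m) \<and> compatible (Suc m) A C})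
     = 4 ^ m * (3 * real m + 8) - (6 * real m + 4) * real (2 * m choose m)"
proof -
  let ?U = "upper_sets m"
  define ks where "ks l l' = {k. k < 2 * m + 2 \<and> (l = 0 \<or> l < k) \<and> (l' = 0 \<or> k + l' \<le> 2 * m)}" for l l'
  define q where "q l l' = (real (2 * m + 2 - row_gap l - row_gap l'))\<^sup>2" for l l'
  have card_ks: "card (ks l l') = 2 * m + 2 - row_gap l - row_gap l'" for l l'
  proof -
    have "ks l l' = {row_gap l..<2 * m + 2 - row_gap l'}" by (auto simp: ks_def row_gap_def)
    then show ?thesis by simp
  qed
  let ?Z = "{(A, C). A \<in> upper_sets (Suc m) \<and> C \<in> upper_sets (Suc m) \<and> compatible (Suc m) A C}"
  let ?Y = "SIGMA A : ?U. SIGMA C : ?U. ks (width A) (width C) \<times> ks (width C) (width A)"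
  have comp: "compatible (Suc m) A C \<longleftrightarrow>
      (width (peel C) = 0 \<or> width A + width (peel C) \<le> 2 * m) \<and>
      (width (peel A) = 0 \<or> width C + width (peel A) \<le> 2 * m)"
    if "A \<in> upper_sets (Suc m)" "C \<in> upper_sets (Suc m)" for A C
    using no_clash_iff [OF that] no_clash_iff [OF that(2,1)] by (auto simp: compatible_def)
  have "bij_betw (\<lambda>(A, C). (peel A, peel C, width A, width C)) ?Z ?Y"
  proof (rule bij_betw_byWitness [of _ "\<lambda>(A, C, k, l). (add_row m A k, add_row m C l)"])
    show "(\<lambda>(A, C). (peel A, peel C, width A, width C)) ` ?Z \<subseteq> ?Y"
    proof safe
      fix A C
      assume *: "A \<in> upper_sets (Suc m)" "C \<in> upper_sets (Suc m)" "compatible (Suc m) A C"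
      show "peel A \<in> ?U" "peel C \<in> ?U"
        by (rule peel_upper(1); fact *)+
      show "width A \<in> ks (width (peel A)) (width (peel C))" "width C \<in> ks (width (peel C)) (width (peel A))"
        using peel_upper(2,3) [OF *(1)] peel_upper(2,3) [OF *(2)] *(3) comp [OF *(1,2)]
        by (auto simp: ks_def)
    qed
    show "(\<lambda>(A, C, k, l). (add_row m A k, add_row m C l)) ` ?Y \<subseteq> ?Z"
    proof safe
      fix A C k l
      assume *: "A \<in> ?U" "C \<in> ?U" "k \<in> ks (width A) (width C)" "l \<in> ks (width C) (width A)"
      then have "k < 2 * m + 2" "width A = 0 \<or> width A < k" "l < 2 * m + 2" "width C = 0 \<or> width C < l"
        by (simp_all add: ks_def)
      note kl = add_row_upper [OF *(1) this(1,2)] add_row_upper [OF *(2) this(3,4)]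
      show "add_row m A k \<in> upper_sets (Suc m)" "add_row m C l \<in> upper_sets (Suc m)"
        by (fact kl)+
      show "compatible (Suc m) (add_row m A k) (add_row m C l)"
        using * by (simp add: comp kl ks_def)
    qed
  qed (auto simp: add_row_peel add_row_upper ks_def)
  then have "card ?Z = card ?Y" by (rule bij_betw_same_card)
  also have "\<dots> = (\<Sum>A\<in>?U. \<Sum>C\<in>?U. card (ks (width A) (width C)) * card (ks (width C) (width A)))"
  proof -
    have "finite (ks l l')" for l l' by (simp add: ks_def)
    then show ?thesis by (simp add: card_SigmaI finite_upper_sets finite_SigmaI card_cartesian_product)
  qed
  also have "real \<dots> = (\<Sum>A\<in>?U. \<Sum>C\<in>?U. q (width A) (width C))"
    by (simp add: card_ks q_def power2_eq_square add.commute)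
  also have "\<dots> = (\<Sum>A\<in>?U. q (width A) 0 + (\<Sum>e<2 * m. width_count m e * q (width A) (Suc e)))"
    by (subst sum_over_widths) (rule refl)
  also have "\<dots> = 4 ^ m * (3 * real m + 8) - (6 * real m + 4) * real (2 * m choose m)"
    using weighted_square_sum [of m]
    by (subst sum_over_widths) (simp only: q_def)
  finally show ?thesis .
qed

text \<open>The difference operator on the left has characteristic polynomial (x - 4)^2 and
  annihilates 4^m (3m + 8), so only the binomial part survives. With r = n - 3 all binomials
  involved are rational multiples of binomial(2r, r).\<close>

lemma recurrence_of_closed_form:
  fixes b :: "nat \<Rightarrow> real"
  assumes b: "\<And>m. b (Suc m) = 4 ^ m * (3 * real m + 8) - (6 * real m + 4) * real (2 * m choose m)"
    and n: "n \<ge> 4"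
  shows "b n - 8 * b (n - 1) + 16 * b (n - 2) = 24 / (real n - 1) * real ((2 * n - 6) choose (n - 2))"
proof -
  note [simp del] = binomial_Suc_Suc
  obtain r where r: "n = Suc (Suc (Suc r))" "r \<ge> 1"
    by (rule that [of "n - 3"]) (use n in auto)
  define c where "c = real (2 * r choose r)"
  have c1: "real (2 * Suc r choose Suc r) = 2 * (2 * real r + 1) * c / (real r + 1)"
    using central_binomial_Suc [of r] by (simp add: c_def field_simps)
  have "(real r + 2) * real (2 * Suc (Suc r) choose Suc (Suc r)) = 2 * (2 * real r + 3) * real (2 * Suc r choose Suc r)"
    using central_binomial_Suc [of "Suc r"] by (simp only: of_nat_Suc) (simp add: add.commute)
  then have "real (2 * Suc (Suc r) choose Suc (Suc r)) = 2 * (2 * real r + 3) * real (2 * Suc r choose Suc r) / (real r + 2)"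
    by (simp only: nonzero_eq_divide_eq) (simp only: mult.commute)
  then have c2: "real (2 * Suc (Suc r) choose Suc (Suc r)) = 4 * (2 * real r + 3) * (2 * real r + 1) * c / ((real r + 1) * (real r + 2))"
    unfolding c1 by (simp add: divide_simps) (simp add: algebra_simps)
  have "Suc r * (2 * r choose Suc r) = r * (2 * r choose r)"
  proof -
    have "r * (2 * r choose r) = 2 * r * (2 * r - 1 choose r)"
      by (subst binomial_absorb_comp [symmetric]) simp
    then show ?thesis
      by (simp only: binomial_absorption)
  qed
  then have "real (Suc r * (2 * r choose Suc r)) = real (r * (2 * r choose r))" by simp
  then have c3: "real (2 * r choose Suc r) = real r * c / (real r + 1)"
    by (simp add: c_def field_simps)
  have b1: "b (n - 2) = 4 ^ r * (3 * real r + 8) - (6 * real r + 4) * c"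
    using b [of r] r by (simp add: c_def)
  have b2: "b (n - 1) = 4 * 4 ^ r * (3 * real r + 11) - (6 * real r + 10) * (2 * (2 * real r + 1) * c / (real r + 1))"
    using b [of "Suc r"] r unfolding c1 by (simp add: add.commute)
  have b3: "b n = 16 * 4 ^ r * (3 * real r + 14)
      - (6 * real r + 16) * (4 * (2 * real r + 3) * (2 * real r + 1) * c / ((real r + 1) * (real r + 2)))"
    using b [of "Suc (Suc r)"] r unfolding c2 by (simp add: add.commute)
  have n': "real n - 1 = real r + 2" "2 * n - 6 = 2 * r" "n - 2 = Suc r"
    using r by auto
  have poly: "(16 * x * (3 * s + 14) - (6 * s + 16) * (4 * (2 * s + 3) * (2 * s + 1) * c / ((s + 1) * (s + 2))))
      - 8 * (4 * x * (3 * s + 11) - (6 * s + 10) * (2 * (2 * s + 1) * c / (s + 1)))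
      + 16 * (x * (3 * s + 8) - (6 * s + 4) * c) = 24 / (s + 2) * (s * c / (s + 1))"
    if "s + 1 \<noteq> 0" "s + 2 \<noteq> 0" for s x c :: real
    using that by (simp add: divide_simps) (simp add: algebra_simps)
  show ?thesis
    unfolding b1 b2 b3 unfolding n' c3 by (rule poly) linarith+
qed

section \<open>Matrices\<close>

text \<open>Used on the whole square of positions: \<open>i = j\<close> gives a Cartan element,
  \<open>i + j = 2 * n\<close> gives zero, and a position and its reflection give opposite vectors.
  The recurring condition that \<open>i + j\<close> differs from \<open>2 * n\<close> keeps the
  vector nonzero.\<close>

definition root_vec :: "nat \<Rightarrow> nat \<Rightarrow> nat \<Rightarrow> cmat" where
  "root_vec n i j = (\<lambda>k l. of_bool (k = i \<and> l = j) - of_bool (k = 2 * n - j \<and> l = 2 * n - i))"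

definition diag_part :: "cmat \<Rightarrow> cmat" where
  "diag_part A = (\<lambda>i j. if i = j then A i j else 0)"

lemma fin_alg_outside: "A \<in> fin_alg n \<Longrightarrow> 2 * n < i \<or> 2 * n < j \<Longrightarrow> A i j = 0"
  by (auto simp: fin_alg_def)

lemma fin_alg_nonzeroD: "A \<in> fin_alg n \<Longrightarrow> A i j \<noteq> 0 \<Longrightarrow> i \<le> 2 * n \<and> j \<le> 2 * n"
  using fin_alg_outside by (metis not_le)

lemma fin_alg_reflect: "A \<in> fin_alg n \<Longrightarrow> i \<le> 2 * n \<Longrightarrow> j \<le> 2 * n \<Longrightarrow> A (2 * n - j) (2 * n - i) = - A i j"
  by (auto simp: fin_alg_def eq_neg_iff_add_eq_0 add.commute)

lemma fin_alg_antidiag: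
  assumes "A \<in> fin_alg n" "i + j = 2 * n"
  shows "A i j = 0"
proof -
  have "2 * n - j = i" "2 * n - i = j" using assms(2) by auto
  then show ?thesis using fin_alg_reflect [OF assms(1), of i j] assms(2) by simp
qed

lemma fin_alg_subspace: "mat.subspace (fin_alg n)"
proof (rule mat.subspaceI)
  fix A B :: cmat assume AB: "A \<in> fin_alg n" "B \<in> fin_alg n"
  have "(A + B) i j + (A + B) (2 * n - j) (2 * n - i) = 0" if "i \<le> 2 * n" "j \<le> 2 * n" for i j
    unfolding plus_fun_def fin_alg_reflect [OF AB(1) that] fin_alg_reflect [OF AB(2) that] by simp
  moreover have "(A + B) i j = 0" if "2 * n < i \<or> 2 * n < j" for i j
    using fin_alg_outside [OF AB(1) that] fin_alg_outside [OF AB(2) that] by simp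
  ultimately show "A + B \<in> fin_alg n"
    unfolding fin_alg_def by blast
next
  fix c and A :: cmat assume "A \<in> fin_alg n"
  then show "mat_scale c A \<in> fin_alg n"
    by (simp add: fin_alg_def mat_scale_def flip: distrib_left)
qed (simp add: fin_alg_def)

lemma diff_eq_flip: "a \<le> N \<Longrightarrow> b \<le> N \<Longrightarrow> N - a = b \<longleftrightarrow> a = N - b" for a b N :: nat
  by arith

lemma diff_eq_diff: "a \<le> N \<Longrightarrow> b \<le> N \<Longrightarrow> N - a = N - b \<longleftrightarrow> a = b" for a b N :: nat
  by arith

lemma root_vec_in_fin_alg:
  assumes "i \<le> 2 * n" "j \<le> 2 * n"
  shows "root_vec n i j \<in> fin_alg n"
proof -
  have "root_vec n i j k l + root_vec n i j (2 * n - l) (2 * n - k) = 0" if "k \<le> 2 * n" "l \<le> 2 * n" for k l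
  proof -
    have "2 * n - l = i \<longleftrightarrow> l = 2 * n - i" "2 * n - k = j \<longleftrightarrow> k = 2 * n - j"
      by (rule diff_eq_flip; fact)+
    moreover have "2 * n - l = 2 * n - j \<longleftrightarrow> l = j" "2 * n - k = 2 * n - i \<longleftrightarrow> k = i"
      by (rule diff_eq_diff; fact)+
    ultimately show ?thesis by (simp only: root_vec_def conj_commute) simp
  qed
  moreover have "root_vec n i j k l = 0" if "2 * n < k \<or> 2 * n < l" for k l
  proof -
    have "\<not> (k = i \<and> l = j)" "\<not> (k = 2 * n - j \<and> l = 2 * n - i)"
      using that assms by linarith+
    then show ?thesis by (simp only: root_vec_def) simp
  qed
  ultimately show ?thesis unfolding fin_alg_def by blast
qed

lemma root_vec_reflect:
  assumes "i \<le> 2 * n" "j \<le> 2 * n"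
  shows "root_vec n (2 * n - j) (2 * n - i) = - root_vec n i j"
  using assms by (simp add: root_vec_def fun_eq_iff)

lemma root_vec_entry [simp]: "i + j \<noteq> 2 * n \<Longrightarrow> root_vec n i j i j = 1"
  by (auto simp: root_vec_def)

lemma root_vec_diag: "i \<le> 2 * n \<Longrightarrow> root_vec n i i \<in> fin_cartan n"
  using root_vec_in_fin_alg [of i n i] by (auto simp: fin_cartan_def root_vec_def)

lemma diag_part_in_cartan: "A \<in> fin_alg n \<Longrightarrow> diag_part A \<in> fin_cartan n"
  unfolding fin_cartan_def fin_alg_def diag_part_def by (auto dest: le_imp_diff_is_add) 

lemma fin_bracket_entry:
  "fin_bracket n A B i j = (\<Sum>k\<le>2 * n. A i k * B k j) - (\<Sum>k\<le>2 * n. B i k * A k j)"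
  by (simp add: fin_bracket_def mat_mult_def)

lemma fin_bracket_in_fin_alg:
  assumes A: "A \<in> fin_alg n" and B: "B \<in> fin_alg n"
  shows "fin_bracket n A B \<in> fin_alg n"
proof -
  have reflect: "(\<Sum>k\<le>2 * n. A (2 * n - j) k * B k (2 * n - i)) = (\<Sum>k\<le>2 * n. B i k * A k j)"
    if "i \<le> 2 * n" "j \<le> 2 * n" "A \<in> fin_alg n" "B \<in> fin_alg n" for i j A B
  proof (rule sum.reindex_bij_witness [of _ "\<lambda>k. 2 * n - k" "\<lambda>k. 2 * n - k"])
    fix k assume "k \<in> {..2 * n}"
    then have k: "k \<le> 2 * n" "2 * n - k \<le> 2 * n" "2 * n - (2 * n - k) = k" by auto
    have "A (2 * n - j) (2 * n - (2 * n - k)) = - A (2 * n - k) j" "B (2 * n - (2 * n - k)) (2 * n - i) = - B i (2 * n - k)"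
      by (rule fin_alg_reflect; fact)+
    then show "B i (2 * n - k) * A (2 * n - k) j = A (2 * n - j) k * B k (2 * n - i)"
      unfolding k(3) by simp
  qed auto
  show ?thesis
    unfolding fin_alg_def
  proof (intro CollectI conjI allI impI)
    fix i j assume "2 * n < i \<or> 2 * n < j"
    then have "A i k * B k j = 0" "B i k * A k j = 0" for k
      using fin_alg_outside [OF A] fin_alg_outside [OF B] by (metis mult_eq_0_iff)+
    then show "fin_bracket n A B i j = 0"
      by (simp only: fin_bracket_entry sum.neutral_const diff_self)
  next
    fix i j assume ij: "i \<le> 2 * n" "j \<le> 2 * n"
    show "fin_bracket n A B i j + fin_bracket n A B (2 * n - j) (2 * n - i) = 0"
      unfolding fin_bracket_entry reflect [OF ij A B] reflect [OF ij B A] by simp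
  qed
qed

lemma fin_bracket_nonzero:
  assumes "fin_bracket n A B i j \<noteq> 0"
  obtains k where "A i k \<noteq> 0" "B k j \<noteq> 0" | k where "B i k \<noteq> 0" "A k j \<noteq> 0"
proof -
  have "(\<Sum>k\<le>2 * n. A i k * B k j) \<noteq> 0 \<or> (\<Sum>k\<le>2 * n. B i k * A k j) \<noteq> 0"
    using assms by (auto simp: fin_bracket_entry)
  then show thesis
    by (elim disjE sum.not_neutral_contains_not_neutral) (use that in auto)
qed

lemma fin_bracket_diag:
  assumes h: "h \<in> fin_cartan n" and A: "A \<in> fin_alg n"
  shows "fin_bracket n h A i j = (h i i - h j j) * A i j"
proof (cases "i \<le> 2 * n \<and> j \<le> 2 * n")
  case True
  have "(\<Sum>k\<le>2 * n. h i k * A k j) = (\<Sum>k\<le>2 * n. if k = i then h i i * A i j else 0)"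
    using h by (intro sum.cong) (auto simp: fin_cartan_def)
  moreover have "(\<Sum>k\<le>2 * n. A i k * h k j) = (\<Sum>k\<le>2 * n. if k = j then A i j * h j j else 0)"
    using h by (intro sum.cong) (auto simp: fin_cartan_def)
  ultimately show ?thesis using True by (simp add: fin_bracket_entry algebra_simps)
next
  case False
  then have out: "2 * n < i \<or> 2 * n < j" by auto
  have h': "h \<in> fin_alg n" using h by (simp add: fin_cartan_def)
  have "h i k * A k j = 0" "A i k * h k j = 0" for k
    using fin_alg_outside [OF A] fin_alg_outside [OF h'] out by (metis mult_eq_0_iff)+
  then have "fin_bracket n h A i j = 0"
    by (simp only: fin_bracket_entry sum.neutral_const diff_self)
  then show ?thesis using fin_alg_outside [OF A out] by simp
qed

lemma fin_bracket_root_vec_entry: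
  assumes "i \<le> 2 * n" "j \<le> 2 * n"
  shows "fin_bracket n A (root_vec n i j) k l =
     of_bool (l = j) * A k i - of_bool (l = 2 * n - i) * A k (2 * n - j)
     - of_bool (k = i) * A j l + of_bool (k = 2 * n - j) * A (2 * n - i) l"
proof -
  have "(\<Sum>p\<le>2 * n. A k p * root_vec n i j p l)
      = (\<Sum>p\<le>2 * n. if p = i then of_bool (l = j) * A k i else 0)
        - (\<Sum>p\<le>2 * n. if p = 2 * n - j then of_bool (l = 2 * n - i) * A k (2 * n - j) else 0)"
    unfolding sum_subtractf [symmetric] by (intro sum.cong) (auto simp: root_vec_def)
  moreover have "(\<Sum>p\<le>2 * n. root_vec n i j k p * A p l)
      = (\<Sum>p\<le>2 * n. if p = j then of_bool (k = i) * A j l else 0)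
        - (\<Sum>p\<le>2 * n. if p = 2 * n - i then of_bool (k = 2 * n - j) * A (2 * n - i) l else 0)"
    unfolding sum_subtractf [symmetric] by (intro sum.cong) (auto simp: root_vec_def)
  ultimately show ?thesis using assms by (simp add: fin_bracket_entry)
qed

lemma root_vec_rows_cols:
  assumes "i \<le> 2 * n" "j \<le> 2 * n" "i + j \<noteq> 2 * n"
  shows "root_vec n i j p j = of_bool (p = i)" "root_vec n i j p (2 * n - i) = - of_bool (p = 2 * n - j)"
    "root_vec n i j i q = of_bool (q = j)" "root_vec n i j (2 * n - j) q = - of_bool (q = 2 * n - i)"
    "k \<noteq> i \<Longrightarrow> k + j \<noteq> 2 * n \<Longrightarrow> root_vec n i j k q = 0"
    "k \<noteq> j \<Longrightarrow> k + i \<noteq> 2 * n \<Longrightarrow> root_vec n i j p k = 0"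
proof -
  have "j \<noteq> 2 * n - i" "2 * n - i \<noteq> j" "i \<noteq> 2 * n - j" "2 * n - j \<noteq> i" using assms by linarith+
  then show "root_vec n i j p j = of_bool (p = i)" "root_vec n i j p (2 * n - i) = - of_bool (p = 2 * n - j)"
    "root_vec n i j i q = of_bool (q = j)" "root_vec n i j (2 * n - j) q = - of_bool (q = 2 * n - i)"
    by (simp_all add: root_vec_def)
  show "root_vec n i j k q = 0" if "k \<noteq> i" "k + j \<noteq> 2 * n"
  proof -
    have "k \<noteq> 2 * n - j" using that assms by linarith
    then show ?thesis using that by (simp add: root_vec_def)
  qed
  show "root_vec n i j p k = 0" if "k \<noteq> j" "k + i \<noteq> 2 * n"
  proof -
    have "k \<noteq> 2 * n - i" using that assms by linarith
    then show ?thesis using that by (simp add: root_vec_def)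
  qed
qed

text \<open>The three inequalities kill every product of matrix units except E_ij E_jk and its
  reflection. The case i + k = 2n is included; both sides are then zero.\<close>

lemma fin_bracket_root_vec:
  assumes "i \<le> 2 * n" "j \<le> 2 * n" "k \<le> 2 * n" "i + j \<noteq> 2 * n" "j + k \<noteq> 2 * n" "i \<noteq> k"
  shows "fin_bracket n (root_vec n i j) (root_vec n j k) = root_vec n i k"
proof (intro ext)
  fix p q
  have ne: "2 * n - k \<noteq> j" "2 * n - k + i \<noteq> 2 * n" "k \<noteq> i" "k + j \<noteq> 2 * n" using assms by linarith+
  note X = root_vec_rows_cols [OF assms(1,2,4)]
  show "fin_bracket n (root_vec n i j) (root_vec n j k) p q = root_vec n i k p q"
    unfolding fin_bracket_root_vec_entry [OF assms(2,3)] X(1,4) X(5) [OF ne(3,4)] X(6) [OF ne(1,2)]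
    unfolding root_vec_def of_bool_conj by simp
qed

lemma fin_bracket_root_vec_opposite:
  assumes "i \<le> 2 * n" "j \<le> 2 * n" "i + j \<noteq> 2 * n"
  shows "fin_bracket n (root_vec n i j) (root_vec n j i) = root_vec n i i - root_vec n j j"
proof (intro ext)
  fix p q
  show "fin_bracket n (root_vec n i j) (root_vec n j i) p q = (root_vec n i i - root_vec n j j) p q"
    unfolding fin_bracket_root_vec_entry [OF assms(2,1)] root_vec_rows_cols(1-4) [OF assms]
    unfolding root_vec_def of_bool_conj minus_apply by simp
qed

lemma fin_bracket_flip: "fin_bracket n A B = - fin_bracket n B A"
  by (simp add: fin_bracket_def)

section \<open>The affine algebra\<close>

lemma loop_zero [simp]: "loop 0 k = 0"
  by (simp add: loop_def zero_prod_def fun_eq_iff)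

lemma loop_add: "loop (x + y) k = loop x k + loop y k"
  by (auto simp: loop_def plus_prod_def fun_eq_iff)

lemma loop_minus: "loop (- x) k = - loop x k"
  by (auto simp: loop_def uminus_prod_def fun_eq_iff)

lemma loop_scale: "loop (mat_scale c x) k = aff_scale c (loop x k)"
  by (auto simp: loop_def aff_scale_def mat_scale_def fun_eq_iff)

lemma loop_sum: "loop (\<Sum>x\<in>S. g x) k = (\<Sum>x\<in>S. loop (g x) k)"
  by (rule sum_comp_morphism [of "\<lambda>x. loop x k", unfolded o_def, symmetric]) (rule loop_zero, rule loop_add)

lemma cmat_sum_apply: "(\<Sum>x\<in>S. g x) i j = (\<Sum>x\<in>S. g x i j)" for g :: "_ \<Rightarrow> cmat"
  by (induction S rule: infinite_finite_induct) simp_all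

lemma sum_loops:
  assumes "finite K"
  shows "(\<Sum>k\<in>K. loop (f k) k) = (\<lambda>k. if k \<in> K then f k else 0, 0, 0)"
  using assms
proof (induction K rule: finite_induct)
  case empty
  then show ?case by (simp add: zero_prod_def fun_eq_iff)
next
  case (insert k K)
  then show ?case by (auto simp: loop_def plus_prod_def fun_eq_iff)
qed

lemma subspace_of_loops:
  assumes "aff.subspace W" "finite {k. f k \<noteq> 0}" "\<And>k. f k \<noteq> 0 \<Longrightarrow> loop (f k) k \<in> W"
  shows "(f, 0, 0) \<in> W"
proof -
  have "(f, 0, 0) = (\<Sum>k | f k \<noteq> 0. loop (f k) k)"
    using assms(2) by (subst sum_loops) (auto simp: fun_eq_iff)
  then show ?thesis using assms by (auto intro!: aff.subspace_sum)
qed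

text \<open>The factor 1/2 compensates that every entry is produced twice, once from its own
  position and once from the reflected one.\<close>

lemma fin_alg_expand:
  assumes A: "A \<in> fin_alg n"
  shows "A = mat_scale (1 / 2) (\<Sum>x\<in>{..2 * n} \<times> {..2 * n}. mat_scale (A (fst x) (snd x)) (root_vec n (fst x) (snd x)))"
proof (intro ext)
  fix p q
  let ?S = "{..2 * n} \<times> {..2 * n}"
  have *: "(\<Sum>x\<in>?S. mat_scale (A (fst x) (snd x)) (root_vec n (fst x) (snd x))) p q
     = (\<Sum>x\<in>?S. A (fst x) (snd x) * root_vec n (fst x) (snd x) p q)"
    by (simp add: cmat_sum_apply mat_scale_def)
  show "A p q = mat_scale (1 / 2) (\<Sum>x\<in>?S. mat_scale (A (fst x) (snd x)) (root_vec n (fst x) (snd x))) p q"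
  proof (cases "p \<le> 2 * n \<and> q \<le> 2 * n")
    case True
    have "A (fst x) (snd x) * root_vec n (fst x) (snd x) p q =
        (if x = (p, q) then A p q else 0) - (if x = (2 * n - q, 2 * n - p) then - A p q else 0)"
      if "x \<in> ?S" for x
    proof -
      obtain i j where x: "x = (i, j)" "i \<le> 2 * n" "j \<le> 2 * n" using \<open>x \<in> ?S\<close> by (cases x) auto
      have "p = 2 * n - j \<longleftrightarrow> j = 2 * n - p" "q = 2 * n - i \<longleftrightarrow> i = 2 * n - q"
        using True x diff_eq_flip by metis+
      moreover have "A (2 * n - q) (2 * n - p) = - A p q"
        using fin_alg_reflect [OF A] True by blast
      ultimately show ?thesis unfolding x root_vec_def by (auto simp only: fst_conv snd_conv prod.inject of_bool_def split: if_splits) auto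
    qed
    then have "(\<Sum>x\<in>?S. A (fst x) (snd x) * root_vec n (fst x) (snd x) p q)
      = (\<Sum>x\<in>?S. (if x = (p, q) then A p q else 0) - (if x = (2 * n - q, 2 * n - p) then - A p q else 0))"
      by (rule sum.cong [OF refl])
    also have "\<dots> = 2 * A p q"
      using True by (simp add: sum_subtractf)
    finally show ?thesis unfolding mat_scale_def [of "1 / 2"] * by simp
  next
    case False
    have "A (fst x) (snd x) * root_vec n (fst x) (snd x) p q = 0" if "x \<in> ?S" for x
      using fin_alg_outside [OF root_vec_in_fin_alg [of "fst x" n "snd x"], of p q] that False by auto
    moreover have "A p q = 0" using fin_alg_outside [OF A] False by auto
    ultimately show ?thesis unfolding mat_scale_def [of "1 / 2"] * by (simp add: sum.neutral)
  qed
qed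

lemma loop_in_subspace:
  assumes W: "aff.subspace W" and A: "A \<in> fin_alg n"
    and r: "\<And>i j. A i j \<noteq> 0 \<Longrightarrow> loop (root_vec n i j) k \<in> W"
  shows "loop A k \<in> W"
proof -
  have "loop (mat_scale (A i j) (root_vec n i j)) k \<in> W" for i j
  proof (cases "A i j = 0")
    case True
    then show ?thesis using aff.subspace_0 [OF W] by (simp add: loop_scale)
  next
    case False
    then show ?thesis unfolding loop_scale by (intro aff.subspace_scale [OF W] r)
  qed
  then show ?thesis
    by (subst fin_alg_expand [OF A], unfold loop_scale [of "1 / 2"] loop_sum)
       (intro aff.subspace_scale [OF W] aff.subspace_sum [OF W])
qed

lemma in_subspace_by_root_vecs:
  assumes W: "aff.subspace W" and f: "finite {k. f k \<noteq> 0}" "\<And>k. f k \<in> fin_alg n"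
    and r: "\<And>i j k. f k i j \<noteq> 0 \<Longrightarrow> loop (root_vec n i j) k \<in> W"
  shows "(f, 0, 0) \<in> W"
  by (rule subspace_of_loops [OF W f(1)]) (rule loop_in_subspace [OF W f(2)], rule r)

lemma finite_support_add:
  assumes "finite {k. f k \<noteq> 0}" "finite {k. g k \<noteq> (0::'a::monoid_add)}"
  shows "finite {k. f k + g k \<noteq> 0}"
  by (rule finite_subset [OF _ finite_UnI [OF assms]]) auto

section \<open>Entrywise descriptions of the affine subalgebras\<close>

lemma fin_cartan_iff: "h \<in> fin_cartan n \<longleftrightarrow> h \<in> fin_alg n \<and> (\<forall>i j. i \<noteq> j \<longrightarrow> h i j = 0)"
  by (simp add: fin_cartan_def)

lemma fin_npos_iff: "x \<in> fin_npos n \<longleftrightarrow> x \<in> fin_alg n \<and> (\<forall>i j. j \<le> i \<longrightarrow> x i j = 0)"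
  by (simp add: fin_npos_def)

lemma fin_alg_closed:
  "0 \<in> fin_alg n" "A \<in> fin_alg n \<Longrightarrow> B \<in> fin_alg n \<Longrightarrow> A + B \<in> fin_alg n"
  "A \<in> fin_alg n \<Longrightarrow> mat_scale c A \<in> fin_alg n"
  "A \<in> fin_alg n \<Longrightarrow> B \<in> fin_alg n \<Longrightarrow> A - B \<in> fin_alg n"
  using fin_alg_subspace mat.subspace_0 mat.subspace_add mat.subspace_scale mat.subspace_diff by blast+

lemma aff_cartan_eq: "aff_cartan n = {(f, a, b). f 0 \<in> fin_cartan n \<and> (\<forall>k. k \<noteq> 0 \<longrightarrow> f k = 0)}" (is "_ = ?R")
proof
  have "aff.subspace ?R"
    by (rule aff.subspaceI)
       (auto simp: zero_prod_def plus_prod_def aff_scale_def mat_scale_def fin_cartan_iff fun_eq_iff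
         intro: fin_alg_closed fin_alg_closed(3) [unfolded mat_scale_def])
  moreover have "{aff_c, aff_d} \<union> {loop h 0 | h. h \<in> fin_cartan n} \<subseteq> ?R"
    by (auto simp: aff_c_def aff_d_def loop_def fin_cartan_iff fin_alg_closed)
  ultimately show "aff_cartan n \<subseteq> ?R"
    unfolding aff_cartan_def by (rule aff.span_minimal [rotated])
  show "?R \<subseteq> aff_cartan n"
  proof clarify
    fix f :: "int \<Rightarrow> cmat" and a b assume f: "f 0 \<in> fin_cartan n" "\<forall>k. k \<noteq> 0 \<longrightarrow> f k = 0"
    have "(f, a, b) = loop (f 0) 0 + aff_scale a aff_c + aff_scale b aff_d"
      using f(2) by (auto simp: loop_def aff_c_def aff_d_def aff_scale_def mat_scale_def plus_prod_def fun_eq_iff)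
    moreover have "loop (f 0) 0 \<in> aff_cartan n" "aff_c \<in> aff_cartan n" "aff_d \<in> aff_cartan n"
      unfolding aff_cartan_def using f(1) by (auto intro: aff.span_base)
    ultimately show "(f, a, b) \<in> aff_cartan n"
      by (simp only: aff_cartan_def aff.span_add aff.span_scale)
  qed
qed

lemma aff_npos_eq: "aff_npos n = {(f, a, b). a = 0 \<and> b = 0 \<and> finite {k. f k \<noteq> 0} \<and> (\<forall>k. f k \<in> fin_alg n)
     \<and> (\<forall>k<0. f k = 0) \<and> (\<forall>i j. j \<le> i \<longrightarrow> f 0 i j = 0)}" (is "_ = ?R")
proof
  have "aff.subspace ?R"
  proof (rule aff.subspaceI)
    show "0 \<in> ?R" by (simp add: zero_prod_def fin_alg_closed)
    show "x + y \<in> ?R" if "x \<in> ?R" "y \<in> ?R" for x y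
      using that by (auto simp: plus_prod_def intro!: fin_alg_closed finite_support_add)
    show "aff_scale c x \<in> ?R" if "x \<in> ?R" for c x
    proof -
      obtain f where x: "x = (f, 0, 0)" using \<open>x \<in> ?R\<close> by auto
      have "finite {k. f k \<noteq> 0}" using that x by simp
      then have "finite {k. mat_scale c (f k) \<noteq> 0}"
        by (rule rev_finite_subset) (auto simp: mat_scale_def fun_eq_iff)
      then show ?thesis using that unfolding x
        by (auto simp: aff_scale_def intro!: fin_alg_closed) (auto simp: mat_scale_def fun_eq_iff)
    qed
  qed
  moreover have "{loop x 0 | x. x \<in> fin_npos n} \<union> {loop x k | x k. x \<in> fin_alg n \<and> 0 < k} \<subseteq> ?R"
    by (auto simp: loop_def fin_npos_iff fin_alg_closed)
  ultimately show "aff_npos n \<subseteq> ?R"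
    unfolding aff_npos_def by (rule aff.span_minimal [rotated])
  show "?R \<subseteq> aff_npos n"
  proof clarify
    fix f :: "int \<Rightarrow> cmat"
    assume f: "finite {k. f k \<noteq> 0}" "\<forall>k. f k \<in> fin_alg n" "\<forall>k<0. f k = 0" "\<forall>i j. j \<le> i \<longrightarrow> f 0 i j = 0"
    show "(f, 0, 0) \<in> aff_npos n"
      unfolding aff_npos_def
    proof (rule subspace_of_loops [OF aff.subspace_span f(1)], rule aff.span_base)
      fix k assume "f k \<noteq> 0"
      then have "k = 0 \<or> 0 < k" using f(3) by (meson linorder_neqE)
      moreover have "f 0 \<in> fin_npos n" using f by (simp add: fin_npos_iff)
      ultimately show "loop (f k) k \<in> {loop x 0 | x. x \<in> fin_npos n} \<union> {loop x k | x k. x \<in> fin_alg n \<and> 0 < k}"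
        using f(2) by blast
    qed
  qed
qed

lemma aff_npos_iff: "(f, a, b) \<in> aff_npos n \<longleftrightarrow> a = 0 \<and> b = 0 \<and> finite {k. f k \<noteq> 0} \<and> (\<forall>k. f k \<in> fin_alg n)
     \<and> (\<forall>k<0. f k = 0) \<and> (\<forall>i j. j \<le> i \<longrightarrow> f 0 i j = 0)"
  by (simp add: aff_npos_eq)

lemma aff_cartan_iff: "(f, a, b) \<in> aff_cartan n \<longleftrightarrow> f 0 \<in> fin_cartan n \<and> (\<forall>k. k \<noteq> 0 \<longrightarrow> f k = 0)"
  by (simp add: aff_cartan_eq)

lemma borel_iff: "(f, a, b) \<in> borel n \<longleftrightarrow> finite {k. f k \<noteq> 0} \<and> (\<forall>k. f k \<in> fin_alg n)
     \<and> (\<forall>k<0. f k = 0) \<and> (\<forall>i j. j < i \<longrightarrow> f 0 i j = 0)" (is "_ \<longleftrightarrow> ?R")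
proof
  assume "(f, a, b) \<in> borel n"
  then obtain x y where xy: "(f, a, b) = x + y" "x \<in> aff_cartan n" "y \<in> aff_npos n"
    unfolding borel_def by auto
  obtain g a' b' where x: "x = (g, a', b')" by (cases x) auto
  obtain u a'' b'' where y: "y = (u, a'', b'')" by (cases y) auto
  have g: "g 0 \<in> fin_cartan n" "\<And>k. k \<noteq> 0 \<Longrightarrow> g k = 0" using xy(2) unfolding x aff_cartan_iff by auto
  have u: "finite {k. u k \<noteq> 0}" "\<And>k. u k \<in> fin_alg n" "\<And>k. k < 0 \<Longrightarrow> u k = 0" "\<And>i j. j \<le> i \<Longrightarrow> u 0 i j = 0"
    using xy(3) unfolding y aff_npos_iff by auto
  have f: "f = (\<lambda>k. g k + u k)" using xy(1) unfolding x y by (simp add: plus_prod_def fun_eq_iff)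
  have "finite {k. g k \<noteq> 0}" by (rule finite_subset [of _ "{0}"]) (use g in auto)
  moreover have "g k \<in> fin_alg n" for k using g by (cases "k = 0") (auto simp: fin_cartan_iff fin_alg_closed)
  ultimately show ?R unfolding f using u g by (auto simp: fin_cartan_iff intro!: finite_support_add fin_alg_closed)
next
  assume R: ?R
  let ?g = "\<lambda>k::int. if k = 0 then diag_part (f 0) else 0"
  let ?u = "\<lambda>k. if k = 0 then f 0 - diag_part (f 0) else f k"
  have D: "diag_part (f 0) \<in> fin_cartan n" by (rule diag_part_in_cartan) (use R in blast)
  have "(?g, a, b) \<in> aff_cartan n" unfolding aff_cartan_iff using D by simp
  moreover have "(?u, 0, 0) \<in> aff_npos n"
    unfolding aff_npos_iff
  proof (intro conjI allI impI)
    have "{k. ?u k \<noteq> 0} \<subseteq> insert 0 {k. f k \<noteq> 0}" by auto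
    then show "finite {k. ?u k \<noteq> 0}" by (rule finite_subset) (use R in simp)
    show "?u k \<in> fin_alg n" for k using R D by (auto simp: fin_cartan_iff intro!: fin_alg_closed)
  qed (use R in \<open>auto simp: diag_part_def\<close>)
  moreover have "(f, a, b) = (?g, a, b) + (?u, 0, 0)" by (auto simp: plus_prod_def fun_eq_iff)
  ultimately show "(f, a, b) \<in> borel n" unfolding borel_def by blast
qed

lemma aff_alg_iff: "(f, a, b) \<in> aff_alg n \<longleftrightarrow> finite {k. f k \<noteq> 0} \<and> (\<forall>k. f k \<in> fin_alg n)"
  by (simp add: aff_alg_def)

lemma aff_cartan_subset_borel: "aff_cartan n \<subseteq> borel n"
proof
  fix x assume "x \<in> aff_cartan n"
  moreover have "0 \<in> aff_npos n" by (simp add: aff_npos_def aff.span_zero)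
  ultimately have "x + 0 \<in> borel n" unfolding borel_def by blast
  then show "x \<in> borel n" by simp
qed

lemma aff_npos_subset: "aff_npos n \<subseteq> borel n" "aff_npos n \<subseteq> aff_alg n"
  by (auto simp: aff_npos_iff borel_iff aff_alg_iff)

lemma loop_in_borel: "x \<in> fin_alg n \<Longrightarrow> 0 < k \<Longrightarrow> loop x k \<in> borel n"
  by (auto simp: loop_def borel_iff fin_alg_closed)

text \<open>The functional e_i - e_j + k delta, by which the Cartan subalgebra acts on position (i,
  j) in degree k. It is set to 0 outside the Cartan subalgebra to obey the convention of
  \<open>dual_of\<close>. Every diagonal position in degree k has the same weight k delta.\<close>

definition weight :: "nat \<Rightarrow> nat \<Rightarrow> nat \<Rightarrow> int \<Rightarrow> affine \<Rightarrow> complex" where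
  "weight n i j k = (\<lambda>h. if h \<in> aff_cartan n then fst h 0 i i - fst h 0 j j + of_int k * snd (snd h) else 0)"

lemma weight_in_dual: "weight n i j k \<in> dual_of aff_scale (aff_cartan n)"
proof -
  have "aff.subspace (aff_cartan n)" unfolding aff_cartan_def by (rule aff.subspace_span)
  then have "x + y \<in> aff_cartan n" "aff_scale c x \<in> aff_cartan n"
    if "x \<in> aff_cartan n" "y \<in> aff_cartan n" for x y c
    using that by (auto intro: aff.subspace_add aff.subspace_scale)
  then show ?thesis
    by (auto simp: dual_of_def weight_def plus_prod_def aff_scale_def mat_scale_def algebra_simps split: prod.splits)
qed

text \<open>A Cartan element \<open>h\<close> has only a degree 0 matrix part, so no central term
  arises and the \<open>d\<close>-part of \<open>x\<close> meets only zero terms. The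
  \<open>d\<close>-part of \<open>h\<close> contributes the degree k, its diagonal matrix the
  difference of two entries.\<close>

lemma aff_bracket_cartan:
  assumes h: "h \<in> aff_cartan n" and x: "x \<in> aff_alg n"
  shows "aff_bracket n h x = (\<lambda>k i j. weight n i j k h * fst x k i j, 0, 0)"
proof -
  obtain f a b where h': "h = (f, a, b)" by (cases h) auto
  obtain g a' b' where x': "x = (g, a', b')" by (cases x) auto
  have f: "f 0 \<in> fin_cartan n" "\<And>k. k \<noteq> 0 \<Longrightarrow> f k = 0" using h unfolding h' aff_cartan_iff by auto
  have g: "g k \<in> fin_alg n" for k using x unfolding x' aff_alg_iff by auto
  have supp: "{k. f k \<noteq> 0} = (if f 0 = 0 then {} else {0})" using f(2) by (cases "f 0 = 0") (auto, metis)
  have "(\<Sum>k | f k \<noteq> 0. fin_bracket n (f k) (g (m - k))) = fin_bracket n (f 0) (g m)" for m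
    by (simp add: supp)
  moreover have "(\<Sum>k | f k \<noteq> 0. of_int k * killing n (f k) (g (- k))) = 0" by (simp add: supp)
  moreover have "mat_scale (b' * of_int m) (f m) = 0" for m
    by (cases "m = 0") (auto simp: f(2) mat_scale_def fun_eq_iff)
  ultimately show ?thesis
    using h unfolding h' x' aff_bracket_def
    by (auto simp: fun_eq_iff fin_bracket_diag [OF f(1) g] weight_def mat_scale_def algebra_simps)
qed

section \<open>Root spaces\<close>

text \<open>The value of the \<open>i\<close>-th diagonal entry on the Cartan element \<open>E\<^bsub>p p\<^esub> - E\<^bsub>2n-p, 2n-p\<^esub>\<close>.\<close>

definition coord_sign :: "nat \<Rightarrow> nat \<Rightarrow> nat \<Rightarrow> complex" where
  "coord_sign n p i = of_bool (i = p) - of_bool (i + p = 2 * n)"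

lemma coord_sign_self: "p + p \<noteq> 2 * n \<Longrightarrow> coord_sign n p p = 1"
  by (simp add: coord_sign_def)

lemma coord_sign_eq_0: "i \<noteq> p \<Longrightarrow> i + p \<noteq> 2 * n \<Longrightarrow> coord_sign n p i = 0"
  by (simp add: coord_sign_def)

lemma coord_sign_eq_1D: "coord_sign n p i = 1 \<Longrightarrow> i = p"
  by (auto simp: coord_sign_def of_bool_def split: if_splits)

lemma coord_sign_eq_minus_1D: "coord_sign n p i = - 1 \<Longrightarrow> i + p = 2 * n"
  by (auto simp: coord_sign_def of_bool_def split: if_splits)

lemma coord_sign_diff_eq_1D: "coord_sign n p i - coord_sign n p j = 1 \<Longrightarrow> i = p \<or> j + p = 2 * n"
  by (auto simp: coord_sign_def of_bool_def split: if_splits)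

lemma coord_sign_inject:
  assumes "\<And>p. p \<le> 2 * n \<Longrightarrow> coord_sign n p x = coord_sign n p y" "x \<le> 2 * n" "y \<le> 2 * n"
  shows "x = y"
proof (cases "x + x = 2 * n \<and> y + y = 2 * n")
  case False
  then show ?thesis
    using assms(1) [OF assms(2)] assms(1) [OF assms(3)] coord_sign_self coord_sign_eq_1D by metis
qed auto

lemma coord_sign_inject_minus:
  assumes "\<And>p. p \<le> 2 * n \<Longrightarrow> coord_sign n p x = - coord_sign n p y" "x \<le> 2 * n" "y \<le> 2 * n"
  shows "x + y = 2 * n"
proof (cases "x + x = 2 * n \<and> y + y = 2 * n")
  case False
  then show ?thesis
    using assms(1) [OF assms(2)] assms(1) [OF assms(3)] coord_sign_self coord_sign_eq_minus_1D
    by (metis add.commute minus_minus)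
qed auto

lemma coord_sign_minus: "x + y = 2 * n \<Longrightarrow> p \<le> 2 * n \<Longrightarrow> coord_sign n p x = - coord_sign n p y"
proof -
  assume "x + y = 2 * n" "p \<le> 2 * n"
  then have "x = p \<longleftrightarrow> y + p = 2 * n" "x + p = 2 * n \<longleftrightarrow> y = p" by linarith+
  then show ?thesis by (simp add: coord_sign_def)
qed

text \<open>Off the diagonal, a weight determines its position up to reflection. At a test point p
  where the left side is 1, one index of the second position must agree with the first position or
  its reflection; the other index follows by cancellation.\<close>

lemma coord_sign_diff_inject:
  assumes eq: "\<And>p. p \<le> 2 * n \<Longrightarrow> coord_sign n p i - coord_sign n p j = coord_sign n p i' - coord_sign n p j'"
    and le: "i \<le> 2 * n" "j \<le> 2 * n" "i' \<le> 2 * n" "j' \<le> 2 * n" and ij: "i + j \<noteq> 2 * n"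
  shows "(i' = i \<and> j' = j) \<or> (i' = 2 * n - j \<and> j' = 2 * n - i) \<or> (i = j \<and> i' = j')"
proof (cases "i = j")
  case True
  then have "i' = j'" by (intro coord_sign_inject [OF _ le(3,4)]) (use eq in auto)
  then show ?thesis using True by blast
next
  case False
  have "i' = i \<or> j' + i = 2 * n \<or> j' = j \<or> i' + j = 2 * n"
  \<comment> \<open>The sign of the middle index is 0 for every p, so in that case \<open>j\<close>
    has to serve as the test point.\<close>
  proof (cases "i + i = 2 * n")
    case i: False
    have "coord_sign n i i' - coord_sign n i j' = 1"
      using eq [OF le(1)] coord_sign_self [OF i] coord_sign_eq_0 [of j i n] False ij by (simp add: add.commute)
    then show ?thesis using coord_sign_diff_eq_1D by blast
  next
    case True
    then have j: "j + j \<noteq> 2 * n" using False by linarith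
    have "coord_sign n j j' - coord_sign n j i' = 1"
      using eq [OF le(2)] coord_sign_self [OF j] coord_sign_eq_0 [of i j n] False ij by (simp add: algebra_simps)
    then show ?thesis using coord_sign_diff_eq_1D by blast
  qed
  then consider "i' = i" | "j' + i = 2 * n" | "j' = j" | "i' + j = 2 * n" by blast
  then show ?thesis
  proof cases
    case 1
    then have "j' = j" by (intro coord_sign_inject [OF _ le(4,2)]) (use eq in auto)
    then show ?thesis using 1 by blast
  next
    case 3
    then have "i' = i" by (intro coord_sign_inject [OF _ le(3,1)]) (use eq in auto)
    then show ?thesis using 3 by blast
  next
    case 2
    have "i' + j = 2 * n"
    proof (rule coord_sign_inject_minus [OF _ le(3,2)])
      fix p assume "p \<le> 2 * n"
      then have "coord_sign n p i' = coord_sign n p i - coord_sign n p j + coord_sign n p j'" "coord_sign n p j' = - coord_sign n p i"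
        using eq [of p] coord_sign_minus [OF 2, of p] by simp_all
      then show "coord_sign n p i' = - coord_sign n p j" by simp
    qed
    then show ?thesis using 2 by auto
  next
    case 4
    have "j' + i = 2 * n"
    proof (rule coord_sign_inject_minus [OF _ le(4,1)])
      fix p assume "p \<le> 2 * n"
      then have "coord_sign n p j' = coord_sign n p i' - (coord_sign n p i - coord_sign n p j)" "coord_sign n p i' = - coord_sign n p j"
        using eq [of p] coord_sign_minus [OF 4, of p] by simp_all
      then show "coord_sign n p j' = - coord_sign n p i" by simp
    qed
    then show ?thesis using 4 by auto
  qed
qed

lemma aff_d_in_cartan: "aff_d \<in> aff_cartan n"
  unfolding aff_cartan_def by (rule aff.span_base) simp

lemma loop_in_cartan: "h \<in> fin_cartan n \<Longrightarrow> loop h 0 \<in> aff_cartan n"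
  unfolding aff_cartan_def by (rule aff.span_base) auto

lemma weight_aff_d: "weight n i j k aff_d = of_int k"
  using aff_d_in_cartan [of n] by (simp add: weight_def) (simp add: aff_d_def)

lemma weight_loop: "h \<in> fin_cartan n \<Longrightarrow> weight n i j k (loop h 0) = h i i - h j j"
  using loop_in_cartan [of h n] by (simp add: weight_def) (simp add: loop_def)

lemma root_vec_diag_entry: "p \<le> 2 * n \<Longrightarrow> i \<le> 2 * n \<Longrightarrow> root_vec n p p i i = coord_sign n p i"
proof -
  assume "p \<le> 2 * n" "i \<le> 2 * n"
  then have "i = 2 * n - p \<longleftrightarrow> i + p = 2 * n" by linarith
  then show ?thesis by (simp add: root_vec_def coord_sign_def)
qed

lemma weight_inject:
  assumes eq: "weight n i j k = weight n i' j' k'"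
    and le: "i \<le> 2 * n" "j \<le> 2 * n" "i' \<le> 2 * n" "j' \<le> 2 * n" and ij: "i + j \<noteq> 2 * n"
  shows "k' = k" "(i' = i \<and> j' = j) \<or> (i' = 2 * n - j \<and> j' = 2 * n - i) \<or> (i = j \<and> i' = j')"
proof -
  show "k' = k" using fun_cong [OF eq, of aff_d] by (simp add: weight_aff_d)
  show "(i' = i \<and> j' = j) \<or> (i' = 2 * n - j \<and> j' = 2 * n - i) \<or> (i = j \<and> i' = j')"
  proof (rule coord_sign_diff_inject [OF _ le ij])
    fix p assume p: "p \<le> 2 * n"
    show "coord_sign n p i - coord_sign n p j = coord_sign n p i' - coord_sign n p j'"
      using fun_cong [OF eq, of "loop (root_vec n p p) 0"]
      unfolding weight_loop [OF root_vec_diag [OF p]] root_vec_diag_entry [OF p le(1)]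
        root_vec_diag_entry [OF p le(2)] root_vec_diag_entry [OF p le(3)] root_vec_diag_entry [OF p le(4)] .
  qed
qed

lemma weight_reflect:
  assumes "i \<le> 2 * n" "j \<le> 2 * n"
  shows "weight n (2 * n - j) (2 * n - i) k = weight n i j k"
proof
  fix h :: affine
  obtain f a b where h: "h = (f, a, b)" by (cases h) auto
  show "weight n (2 * n - j) (2 * n - i) k h = weight n i j k h"
  proof (cases "h \<in> aff_cartan n")
    case True
    then have "f 0 \<in> fin_alg n" unfolding h aff_cartan_iff fin_cartan_iff by blast
    then have "f 0 (2 * n - j) (2 * n - j) = - f 0 j j" "f 0 (2 * n - i) (2 * n - i) = - f 0 i i"
      using fin_alg_reflect assms by blast+
    then show ?thesis by (simp add: weight_def h)
  qed (simp add: weight_def)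
qed

lemma weight_imaginary: "weight n i i k = weight n 0 0 k"
  by (rule ext) (simp add: weight_def)

lemma fin_alg_entryD:
  assumes "A \<in> fin_alg n" "A i j \<noteq> 0"
  shows "i \<le> 2 * n" "j \<le> 2 * n" "i + j \<noteq> 2 * n"
  using fin_alg_nonzeroD [OF assms] fin_alg_antidiag [OF assms(1)] assms(2) by auto

lemma root_vec_nonzeroD: "root_vec n i j p q \<noteq> 0 \<Longrightarrow> (p = i \<and> q = j) \<or> (p = 2 * n - j \<and> q = 2 * n - i)"
  by (auto simp: root_vec_def of_bool_def split: if_splits)

lemma loop_entry: "fst (loop x k) l = (if l = k then x else 0)"
  by (simp add: loop_def)

lemma loop_in_aff_alg: "x \<in> fin_alg n \<Longrightarrow> loop x k \<in> aff_alg n"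
  by (auto simp: loop_def aff_alg_iff fin_alg_closed)

text \<open>The Cartan subalgebra acts entry by entry, so an eigenvector can have nonzero entries
  only at positions of the right weight. The parts along \<open>c\<close> and \<open>d\<close> have
  weight 0 and are excluded by \<open>\<alpha> \<noteq> 0\<close>.\<close>

lemma aff_root_space_iff:
  assumes \<alpha>: "\<alpha> \<in> dual_of aff_scale (aff_cartan n)" "\<alpha> \<noteq> 0"
  shows "x \<in> aff_root_space n \<alpha> \<longleftrightarrow>
    x \<in> aff_alg n \<and> snd x = (0, 0) \<and> (\<forall>k i j. fst x k i j \<noteq> 0 \<longrightarrow> weight n i j k = \<alpha>)"
proof -
  obtain f a b where x: "x = (f, a, b)" by (cases x) auto
  have outside: "\<alpha> h = 0" if "h \<notin> aff_cartan n" for h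
    using \<alpha>(1) that unfolding dual_of_def by blast
  obtain h0 where h0: "\<alpha> h0 \<noteq> 0" using \<alpha>(2) by (auto simp: fun_eq_iff)
  have h0': "h0 \<in> aff_cartan n" using outside h0 by blast
  have scale: "aff_scale c x = (\<lambda>k i j. c * f k i j, c * a, c * b)" for c
    by (simp add: x aff_scale_def mat_scale_def)
  have eq: "aff_bracket n h x = aff_scale (\<alpha> h) x \<longleftrightarrow>
      (\<forall>k i j. f k i j \<noteq> 0 \<longrightarrow> weight n i j k h = \<alpha> h) \<and> \<alpha> h * a = 0 \<and> \<alpha> h * b = 0"
    if "h \<in> aff_cartan n" "x \<in> aff_alg n" for h
  proof -
    have "aff_bracket n h x = (\<lambda>k i j. weight n i j k h * f k i j, 0, 0)"
      using aff_bracket_cartan [OF that] by (simp add: x)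
    then show ?thesis by (auto simp: scale fun_eq_iff)
  qed
  show ?thesis
  proof
    assume "x \<in> aff_root_space n \<alpha>"
    then have alg: "x \<in> aff_alg n" and br: "\<And>h. h \<in> aff_cartan n \<Longrightarrow> aff_bracket n h x = aff_scale (\<alpha> h) x"
      by (auto simp: aff_root_space_def root_space_of_def)
    have "weight n i j k = \<alpha>" if "f k i j \<noteq> 0" for k i j
    proof
      fix h show "weight n i j k h = \<alpha> h"
      proof (cases "h \<in> aff_cartan n")
        case True
        then show ?thesis using br [OF True] that unfolding eq [OF True alg] by blast
      qed (simp add: outside weight_def)
    qed
    moreover have "a = 0 \<and> b = 0" using br [OF h0'] h0 unfolding eq [OF h0' alg] by simp
    ultimately show "x \<in> aff_alg n \<and> snd x = (0, 0) \<and> (\<forall>k i j. fst x k i j \<noteq> 0 \<longrightarrow> weight n i j k = \<alpha>)"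
      using alg by (simp add: x)
  next
    assume R: "x \<in> aff_alg n \<and> snd x = (0, 0) \<and> (\<forall>k i j. fst x k i j \<noteq> 0 \<longrightarrow> weight n i j k = \<alpha>)"
    have "aff_bracket n h x = aff_scale (\<alpha> h) x" if h: "h \<in> aff_cartan n" for h
      unfolding eq [OF h conjunct1 [OF R]] using R by (auto simp: x)
    then show "x \<in> aff_root_space n \<alpha>"
      using R by (auto simp: aff_root_space_def root_space_of_def)
  qed
qed

lemma weight_nonzero:
  assumes "n \<ge> 1" "i \<le> 2 * n" "j \<le> 2 * n" "i + j \<noteq> 2 * n" "i \<noteq> j \<or> k \<noteq> 0"
  shows "weight n i j k \<noteq> 0"
proof
  assume eq: "weight n i j k = 0"
  have "k = 0" using fun_cong [OF eq, of aff_d] by (simp add: weight_aff_d)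
  moreover have "weight n 0 0 0 = 0" by (auto simp: weight_def fun_eq_iff)
  ultimately have "i = j" using weight_inject(2) [of n 0 0 0 i j 0] eq assms by auto
  then show False using assms \<open>k = 0\<close> by blast
qed

lemma weight_root_space_iff:
  assumes "n \<ge> 1" "i \<le> 2 * n" "j \<le> 2 * n" "i + j \<noteq> 2 * n" "i \<noteq> j \<or> k \<noteq> 0"
  shows "x \<in> aff_root_space n (weight n i j k) \<longleftrightarrow>
    x \<in> aff_alg n \<and> snd x = (0, 0) \<and> (\<forall>k' i' j'. fst x k' i' j' \<noteq> 0 \<longrightarrow> weight n i' j' k' = weight n i j k)"
  by (rule aff_root_space_iff [OF weight_in_dual weight_nonzero [OF assms]])

lemma loop_root_vec_in_root_space:
  assumes "n \<ge> 1" "i \<le> 2 * n" "j \<le> 2 * n" "i + j \<noteq> 2 * n" "i \<noteq> j \<or> k \<noteq> 0"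
  shows "loop (root_vec n i j) k \<in> aff_root_space n (weight n i j k)"
  unfolding weight_root_space_iff [OF assms]
proof (intro conjI allI impI)
  show "loop (root_vec n i j) k \<in> aff_alg n"
    by (intro loop_in_aff_alg root_vec_in_fin_alg assms)
  show "snd (loop (root_vec n i j) k) = (0, 0)" by (simp add: loop_def)
  fix k' i' j' assume "fst (loop (root_vec n i j) k) k' i' j' \<noteq> 0"
  then have "k' = k" "root_vec n i j i' j' \<noteq> 0" by (auto simp: loop_entry split: if_splits)
  then show "weight n i' j' k' = weight n i j k"
    using root_vec_nonzeroD [of n i j i' j'] weight_reflect [OF assms(2,3)] by auto
qed

lemma loop_root_vec_nonzero:
  assumes "i + j \<noteq> 2 * n" shows "loop (root_vec n i j) k \<noteq> 0"
proof
  assume "loop (root_vec n i j) k = 0"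
  then have "fst (loop (root_vec n i j) k) k i j = 0" by (simp add: zero_prod_def)
  then show False using assms by (simp add: loop_entry)
qed

lemma weight_in_aff_roots:
  assumes "n \<ge> 1" "i \<le> 2 * n" "j \<le> 2 * n" "i + j \<noteq> 2 * n" "i \<noteq> j \<or> k \<noteq> 0"
  shows "weight n i j k \<in> aff_roots n"
  using weight_in_dual weight_nonzero [OF assms] loop_root_vec_in_root_space [OF assms]
    loop_root_vec_nonzero [OF assms(4)]
  by (auto simp: aff_roots_def roots_of_def aff_root_space_def)

lemma aff_pos_roots_iff:
  "\<alpha> \<in> aff_pos_roots n \<longleftrightarrow> \<alpha> \<in> aff_roots n \<and> aff_root_space n \<alpha> \<subseteq> aff_npos n"
  by (auto simp: aff_pos_roots_def pos_roots_of_def aff_roots_def aff_root_space_def)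

lemma weight_in_aff_pos_roots:
  assumes "n \<ge> 1" "i \<le> 2 * n" "j \<le> 2 * n" "i + j \<noteq> 2 * n" "0 < k \<or> k = 0 \<and> i < j"
  shows "weight n i j k \<in> aff_pos_roots n"
proof -
  have r: "i \<noteq> j \<or> k \<noteq> 0" using assms(5) by auto
  have "x \<in> aff_npos n" if "x \<in> aff_root_space n (weight n i j k)" for x
  proof -
    obtain f a b where x: "x = (f, a, b)" by (cases x) auto
    have x': "(f, a, b) \<in> aff_alg n" "a = 0" "b = 0"
      and w: "\<And>k' i' j'. f k' i' j' \<noteq> 0 \<Longrightarrow> weight n i' j' k' = weight n i j k"
      using that unfolding weight_root_space_iff [OF assms(1-4) r] x by auto
    have f: "finite {k. f k \<noteq> 0}" "\<And>k. f k \<in> fin_alg n" using x'(1) unfolding aff_alg_iff by auto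
    have entry: "k' = k \<and> ((i' = i \<and> j' = j) \<or> (i' = 2 * n - j \<and> j' = 2 * n - i) \<or> (i = j \<and> i' = j'))"
      if "f k' i' j' \<noteq> 0" for k' i' j'
      using weight_inject [OF w [OF that, symmetric] assms(2,3) fin_alg_entryD(1,2) [OF f(2) that] assms(4)] by blast
    have "f k' = 0" if "k' < 0" for k'
      using entry [of k'] that assms(5) by (force simp: fun_eq_iff)
    moreover have "f 0 i' j' = 0" if "j' \<le> i'" for i' j'
    proof (rule ccontr)
      assume nz: "f 0 i' j' \<noteq> 0"
      with entry [OF nz] assms(2,3,5) that show False by auto
    qed
    ultimately show ?thesis unfolding x aff_npos_iff using x' f by auto
  qed
  then show ?thesis
    unfolding aff_pos_roots_iff using weight_in_aff_roots [OF assms(1-4) r] by blast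
qed

lemma aff_rootsE:
  assumes "\<alpha> \<in> aff_roots n"
  obtains x where "x \<in> aff_root_space n \<alpha>" "x \<noteq> 0" "\<alpha> \<in> dual_of aff_scale (aff_cartan n)" "\<alpha> \<noteq> 0"
proof -
  have \<alpha>: "\<alpha> \<in> dual_of aff_scale (aff_cartan n)" "\<alpha> \<noteq> 0" "aff_root_space n \<alpha> \<noteq> {0}"
    using assms by (auto simp: aff_roots_def roots_of_def aff_root_space_def)
  have "0 \<in> aff_root_space n \<alpha>"
    unfolding aff_root_space_iff [OF \<alpha>(1,2)] by (simp add: zero_prod_def aff_alg_iff fin_alg_closed)
  then show thesis using that \<alpha> by blast
qed

lemma root_space_imaginary:
  assumes "n \<ge> 1" "k \<noteq> 0"
  shows "aff_root_space n (weight n 0 0 k) = {loop h k | h. h \<in> fin_cartan n}"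
proof -
  have pre: "n \<ge> 1" "0 \<le> 2 * n" "0 \<le> 2 * n" "0 + 0 \<noteq> 2 * n" "0 \<noteq> (0::nat) \<or> k \<noteq> 0" using assms by auto
  show ?thesis
  proof (intro set_eqI iffI)
    fix x assume "x \<in> aff_root_space n (weight n 0 0 k)"
    moreover obtain f a b where x: "x = (f, a, b)" by (cases x) auto
    ultimately have x': "(f, a, b) \<in> aff_alg n" "a = 0" "b = 0"
      and w: "\<And>k' i' j'. f k' i' j' \<noteq> 0 \<Longrightarrow> weight n i' j' k' = weight n 0 0 k"
      unfolding weight_root_space_iff [OF pre] by auto
    have f: "\<And>k. f k \<in> fin_alg n" using x'(1) unfolding aff_alg_iff by auto
    have entry: "k' = k \<and> i' = j'" if "f k' i' j' \<noteq> 0" for k' i' j'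
      using weight_inject [OF w [OF that, symmetric] pre(2,3) fin_alg_entryD(1,2) [OF f that] pre(4)] by auto
    have "x = loop (f k) k" unfolding x x' loop_def using entry by (auto simp: fun_eq_iff)
    moreover have "f k \<in> fin_cartan n" unfolding fin_cartan_iff using f entry by blast
    ultimately show "x \<in> {loop h k | h. h \<in> fin_cartan n}" by blast
  next
    fix x assume "x \<in> {loop h k | h. h \<in> fin_cartan n}"
    then obtain h where h: "x = loop h k" "h \<in> fin_cartan n" by blast
    have "k' = k \<and> i' = j'" if "fst x k' i' j' \<noteq> 0" for k' i' j'
      using that h by (auto simp: loop_entry fin_cartan_iff split: if_splits)
    then have "weight n i' j' k' = weight n 0 0 k" if "fst x k' i' j' \<noteq> 0" for k' i' j'
      using that weight_imaginary [of n i' k] by blast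
    moreover have "x \<in> aff_alg n" "snd x = (0, 0)"
      using h by (simp_all add: fin_cartan_iff loop_in_aff_alg) (simp add: loop_def)
    ultimately show "x \<in> aff_root_space n (weight n 0 0 k)"
      unfolding weight_root_space_iff [OF pre] by blast
  qed
qed

text \<open>The definite description is unique because a single nonzero entry of an element of a
  root space already determines the root.\<close>

lemma delta_eq:
  assumes "n \<ge> 1"
  shows "delta n = weight n 0 0 1"
  unfolding delta_def
proof (rule the_equality)
  show "weight n 0 0 1 \<in> aff_roots n \<and> aff_root_space n (weight n 0 0 1) = {loop h 1 | h. h \<in> fin_cartan n}"
    using assms by (auto intro: weight_in_aff_roots simp: root_space_imaginary)
next
  fix \<beta> assume \<beta>: "\<beta> \<in> aff_roots n \<and> aff_root_space n \<beta> = {loop h 1 | h. h \<in> fin_cartan n}"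
  have "loop (root_vec n 0 0) 1 \<in> aff_root_space n \<beta>"
    using \<beta> root_vec_diag [of 0 n] by auto
  moreover have "fst (loop (root_vec n 0 0) 1) 1 0 0 \<noteq> 0"
    using assms by (simp add: loop_entry)
  moreover have "\<beta> \<in> dual_of aff_scale (aff_cartan n)" "\<beta> \<noteq> 0" using \<beta> by (auto elim: aff_rootsE)
  ultimately show "\<beta> = weight n 0 0 1"
    by (subst (asm) aff_root_space_iff) auto
qed

section \<open>Weight components of elements of an ideal\<close>

definition component :: "nat \<Rightarrow> (affine \<Rightarrow> complex) \<Rightarrow> affine \<Rightarrow> affine" where
  "component n \<alpha> x = (\<lambda>k i j. if weight n i j k = \<alpha> then fst x k i j else 0, 0, 0)"

text \<open>If \<open>\<alpha> h \<noteq> \<beta> h\<close>, then \<open>x \<mapsto> [h, x] - \<beta> h x\<close> kills the component of weight \<open>\<beta>\<close> and rescales that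
  of weight \<open>\<alpha>\<close>; all other weights are removed one by one.\<close>

lemma component_in_ideal_aux:
  assumes I: "aff.subspace I" "I \<subseteq> aff_npos n" "\<And>h y. h \<in> aff_cartan n \<Longrightarrow> y \<in> I \<Longrightarrow> aff_bracket n h y \<in> I"
    and \<alpha>: "\<And>h. h \<notin> aff_cartan n \<Longrightarrow> \<alpha> h = 0"
    and F: "finite F" "\<alpha> \<notin> F" "\<And>\<beta> h. \<beta> \<in> F \<Longrightarrow> h \<notin> aff_cartan n \<Longrightarrow> \<beta> h = 0"
    and x: "x \<in> I" "\<And>k i j. fst x k i j \<noteq> 0 \<Longrightarrow> weight n i j k \<in> insert \<alpha> F"
  shows "component n \<alpha> x \<in> I"
  using F x
proof (induction F arbitrary: x rule: finite_induct)
  case empty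
  obtain f where x: "x = (f, 0, 0)"
    using empty.prems(3) I(2) aff_npos_eq by auto
  have "(if weight n i j k = \<alpha> then f k i j else 0) = f k i j" for k i j
    using empty.prems(4) [of k i j] x by auto
  then have "component n \<alpha> x = x"
    unfolding component_def x fst_conv by simp
  then show ?case using empty.prems by simp
next
  case (insert \<beta> F)
  obtain f where x: "x = (f, 0, 0)"
    using insert.prems(3) I(2) aff_npos_eq by auto
  have alg: "x \<in> aff_alg n" using insert.prems(3) I(2) aff_npos_subset by blast
  have "\<alpha> \<noteq> \<beta>" using insert.prems(1) by blast
  then obtain h where ne: "\<alpha> h \<noteq> \<beta> h" by (auto simp: fun_eq_iff)
  then have h: "h \<in> aff_cartan n" using \<alpha> insert.prems(2) by (metis insertI1)
  define y where "y = aff_bracket n h x - aff_scale (\<beta> h) x"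
  have y: "y = (\<lambda>k i j. (weight n i j k h - \<beta> h) * f k i j, 0, 0)"
    unfolding y_def aff_bracket_cartan [OF h alg] unfolding x
    by (simp add: aff_scale_def mat_scale_def fun_eq_iff left_diff_distrib minus_prod_def zero_prod_def)
  have "y \<in> I"
    unfolding y_def by (intro aff.subspace_diff aff.subspace_scale I h insert.prems)
  moreover have "weight n i j k \<in> insert \<alpha> F" if "fst y k i j \<noteq> 0" for k i j
    using that insert.prems(4) [of k i j] by (auto simp: y x)
  ultimately have "component n \<alpha> y \<in> I"
    using insert.prems(1,2) by (intro insert.IH) auto
  moreover have "component n \<alpha> y = aff_scale (\<alpha> h - \<beta> h) (component n \<alpha> x)"
  proof -
    have "(if weight n i j k = \<alpha> then (weight n i j k h - \<beta> h) * f k i j else 0)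
        = (\<alpha> h - \<beta> h) * (if weight n i j k = \<alpha> then f k i j else 0)" for i j k
      by auto
    then show ?thesis
      by (simp only: component_def y x fst_conv aff_scale_def mat_scale_def prod.case mult_zero_right)
  qed
  ultimately have "aff_scale (inverse (\<alpha> h - \<beta> h)) (aff_scale (\<alpha> h - \<beta> h) (component n \<alpha> x)) \<in> I"
    by (metis aff.subspace_scale I(1))
  then show ?case using ne by simp
qed

lemma component_in_ideal:
  assumes I: "aff.subspace I" "I \<subseteq> aff_npos n" "\<And>h y. h \<in> aff_cartan n \<Longrightarrow> y \<in> I \<Longrightarrow> aff_bracket n h y \<in> I"
    and x: "x \<in> I"
  shows "component n (weight n i j k) x \<in> I"
proof -
  obtain f a b where x': "x = (f, a, b)" by (cases x) auto
  have f: "finite {k. f k \<noteq> 0}" "\<And>k. f k \<in> fin_alg n"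
    using x I(2) unfolding x' by (auto simp: aff_npos_iff)
  let ?E = "{(k, i, j). f k i j \<noteq> 0}"
  have "?E \<subseteq> {k. f k \<noteq> 0} \<times> {..2 * n} \<times> {..2 * n}"
    using fin_alg_nonzeroD [OF f(2)] by force
  then have "finite ?E" by (rule finite_subset) (use f in blast)
  then have fin: "finite ((\<lambda>(k, i, j). weight n i j k) ` ?E - {weight n i j k})" by blast
  have outside: "weight n i j k h = 0" if "h \<notin> aff_cartan n" for i j k h
    using that by (simp add: weight_def)
  show ?thesis
  proof (rule component_in_ideal_aux [OF I _ fin _ _ x])
    fix k' i' j' assume "fst x k' i' j' \<noteq> 0"
    then have "(k', i', j') \<in> ?E" by (simp add: x')
    then show "weight n i' j' k' \<in> insert (weight n i j k) ((\<lambda>(k, i, j). weight n i j k) ` ?E - {weight n i j k})"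
      by force
  qed (use outside in auto)
qed

text \<open>By \<open>weight_inject\<close> only a position and its reflection share a real weight,
  and their entries are opposite; so a real root space is a line.\<close>

lemma component_real:
  assumes f: "\<And>k. f k \<in> fin_alg n" and ij: "i \<noteq> j" "i \<le> 2 * n" "j \<le> 2 * n" "i + j \<noteq> 2 * n"
  shows "component n (weight n i j k) (f, a, b) = aff_scale (f k i j) (loop (root_vec n i j) k)"
proof -
  have "(if weight n i' j' k' = weight n i j k then f k' i' j' else 0) = f k i j * (if k' = k then root_vec n i j i' j' else 0)"
    for k' i' j'
  proof -
    consider "k' = k" "i' = i" "j' = j" | "k' = k" "i' = 2 * n - j" "j' = 2 * n - i"
      | "\<not> (k' = k \<and> (i' = i \<and> j' = j \<or> i' = 2 * n - j \<and> j' = 2 * n - i))" by blast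
    then show ?thesis
    proof cases
      case 2
      have "root_vec n i j i' j' = - root_vec n i j i j"
        unfolding 2 by (rule fin_alg_reflect [OF root_vec_in_fin_alg]) (use ij in auto)
      moreover have "f k i' j' = - f k i j" unfolding 2 by (rule fin_alg_reflect [OF f ij(2,3)])
      ultimately show ?thesis using ij weight_reflect [OF ij(2,3)] by (simp add: 2)
    next
      case 3
      then have "(if k' = k then root_vec n i j i' j' else 0) = 0"
        using root_vec_nonzeroD [of n i j i' j'] by (cases "k' = k") auto
      moreover have "f k' i' j' = 0" if "weight n i' j' k' = weight n i j k"
      proof (rule ccontr)
        assume "f k' i' j' \<noteq> 0"
        from weight_inject [OF that [symmetric] ij(2,3) fin_alg_entryD(1,2) [OF f this] ij(4)] ij(1) 3
        show False by blast
      qed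
      ultimately show ?thesis by auto
    qed (use ij in simp)
  qed
  moreover have "aff_scale (f k i j) (loop (root_vec n i j) k)
      = (\<lambda>k' i' j'. f k i j * (if k' = k then root_vec n i j i' j' else 0), 0, 0)"
    by (auto simp: aff_scale_def loop_def mat_scale_def fun_eq_iff)
  ultimately show ?thesis by (simp only: component_def fst_conv)
qed

section \<open>From basic ideals to pairs of upper sets\<close>

lemma aff_bracket_loop_nonneg:
  assumes "0 \<le> k" "0 \<le> l"
  shows "aff_bracket n (loop x k) (loop y l) = loop (fin_bracket n x y) (k + l)"
proof -
  have "(if k + l = 0 then of_int k * killing n x y else 0) = 0" using assms by auto
  then show ?thesis by (simp add: aff_bracket_loop del: if_split)
qed

lemma root_vec_in_borel:
  assumes "i \<le> 2 * n" "j \<le> 2 * n" "0 < k \<or> k = 0 \<and> i \<le> j"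
  shows "loop (root_vec n i j) k \<in> borel n"
proof (cases "0 < k")
  case True
  then show ?thesis by (intro loop_in_borel root_vec_in_fin_alg assms)
next
  case False
  then have k: "k = 0" "i \<le> j" using assms by auto
  have "root_vec n i j p q = 0" if "q < p" for p q
    using root_vec_nonzeroD [of n i j p q] that k(2) by fastforce
  then show ?thesis
    unfolding k loop_def borel_iff using root_vec_in_fin_alg [OF assms(1,2)] by (auto simp: fin_alg_closed)
qed

lemma lie_ideal_ofD:
  assumes "lie_ideal_of aff_scale (aff_bracket n) L I"
  shows "aff.subspace I" "I \<subseteq> L" "\<And>x y. x \<in> L \<Longrightarrow> y \<in> I \<Longrightarrow> aff_bracket n x y \<in> I"
  using assms by (auto simp: lie_ideal_of_def)

lemma combinatorial_idealD:
  assumes "combinatorial_ideal n I"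
  shows "lie_ideal_of aff_scale (aff_bracket n) (borel n) I" "I \<subseteq> aff_npos n"
    "\<And>\<alpha>. \<alpha> \<in> aff_pos_roots n \<Longrightarrow> I \<inter> aff_root_space n \<alpha> \<in> {{0}, aff_root_space n \<alpha>}"
  using assms by (auto simp: combinatorial_ideal_def)

lemma ideal_root_vec_trans:
  assumes I: "lie_ideal_of aff_scale (aff_bracket n) (borel n) I"
    and le: "i \<le> 2 * n" "j \<le> 2 * n" "l \<le> 2 * n" "0 \<le> k" "0 \<le> k'"
    and ne: "i + j \<noteq> 2 * n" "j + l \<noteq> 2 * n" "i \<noteq> l"
  shows "loop (root_vec n i j) k \<in> borel n \<Longrightarrow> loop (root_vec n j l) k' \<in> I \<Longrightarrow> loop (root_vec n i l) (k + k') \<in> I"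
    and "loop (root_vec n i j) k \<in> I \<Longrightarrow> loop (root_vec n j l) k' \<in> borel n \<Longrightarrow> loop (root_vec n i l) (k + k') \<in> I"
proof -
  note br = fin_bracket_root_vec [OF le(1-3) ne]
  show "loop (root_vec n i l) (k + k') \<in> I"
    if "loop (root_vec n i j) k \<in> borel n" "loop (root_vec n j l) k' \<in> I"
    using lie_ideal_ofD(3) [OF I that] le by (simp add: aff_bracket_loop_nonneg br)
  show "loop (root_vec n i l) (k + k') \<in> I"
    if "loop (root_vec n i j) k \<in> I" "loop (root_vec n j l) k' \<in> borel n"
  proof -
    have "loop (fin_bracket n (root_vec n j l) (root_vec n i j)) (k' + k) \<in> I"
      using lie_ideal_ofD(3) [OF I that(2,1)] by (simp only: aff_bracket_loop_nonneg [OF le(5,4)])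
    then have "- loop (root_vec n i l) (k + k') \<in> I"
      by (simp only: fin_bracket_flip [of n "root_vec n j l"] br loop_minus add.commute)
    then show ?thesis
      using aff.subspace_neg [OF lie_ideal_ofD(1) [OF I]] by (metis minus_minus)
  qed
qed

text \<open>Degree 0 root vectors above the diagonal lie in the Borel subalgebra; bracketing with
  them lowers the row index or raises the column index without changing the degree.\<close>

lemma ideal_raise:
  assumes I: "lie_ideal_of aff_scale (aff_bracket n) (borel n) I" and k: "0 \<le> k"
  shows "loop (root_vec n j l) k \<in> I \<Longrightarrow> i < j \<Longrightarrow> j \<le> 2 * n \<Longrightarrow> l \<le> 2 * n \<Longrightarrow>
      i + j \<noteq> 2 * n \<Longrightarrow> j + l \<noteq> 2 * n \<Longrightarrow> i \<noteq> l \<Longrightarrow> loop (root_vec n i l) k \<in> I"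
    and "loop (root_vec n i j) k \<in> I \<Longrightarrow> j < l \<Longrightarrow> l \<le> 2 * n \<Longrightarrow> i \<le> 2 * n \<Longrightarrow>
      i + j \<noteq> 2 * n \<Longrightarrow> j + l \<noteq> 2 * n \<Longrightarrow> i \<noteq> l \<Longrightarrow> loop (root_vec n i l) k \<in> I"
  using ideal_root_vec_trans(1) [OF I _ _ _ order.refl k, of i j l] root_vec_in_borel [of i n j 0]
    ideal_root_vec_trans(2) [OF I _ _ _ k order.refl, of i j l] root_vec_in_borel [of j n l 0]
  by simp_all

lemma ideal_root_vec_reflect:
  assumes "aff.subspace I" "i \<le> 2 * n" "j \<le> 2 * n"
  shows "loop (root_vec n (2 * n - j) (2 * n - i)) k \<in> I \<longleftrightarrow> loop (root_vec n i j) k \<in> I"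
  unfolding root_vec_reflect [OF assms(2,3)] loop_minus
  using aff.subspace_neg [OF assms(1)] by (metis minus_minus)

text \<open>Opposite root vectors have a nonzero bracket \<open>?d\<close> in the Cartan part of
  degree k + l. This gives only one line of an n-dimensional root space; the all-or-nothing
  condition on combinatorial ideals supplies the rest.\<close>

lemma ideal_contains_imaginary:
  assumes I: "combinatorial_ideal n I" and n: "n \<ge> 1"
    and ij: "i \<le> 2 * n" "j \<le> 2 * n" "i + j \<noteq> 2 * n" "i \<noteq> j" and k: "0 \<le> k" "0 \<le> l" "0 < k + l"
    and r: "loop (root_vec n i j) k \<in> I" "loop (root_vec n j i) l \<in> borel n"
    and h: "h \<in> fin_cartan n"
  shows "loop h (k + l) \<in> I"
proof -
  note I' = combinatorial_idealD [OF I]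
  let ?d = "root_vec n j j - root_vec n i i"
  have "loop (fin_bracket n (root_vec n j i) (root_vec n i j)) (l + k) \<in> I"
    using lie_ideal_ofD(3) [OF I'(1) r(2,1)] by (simp only: aff_bracket_loop_nonneg k)
  then have d: "loop ?d (k + l) \<in> I"
    using fin_bracket_root_vec_opposite [OF ij(2,1)] ij(3) by (simp add: add.commute)
  have X: "root_vec n i i \<in> fin_cartan n" "root_vec n j j \<in> fin_cartan n"
    by (rule root_vec_diag; fact)+
  then have "?d \<in> fin_cartan n" by (simp add: fin_cartan_iff fin_alg_closed)
  then have d': "loop ?d (k + l) \<in> aff_root_space n (weight n 0 0 (k + l))"
    using k n by (auto simp: root_space_imaginary)
  have "?d \<noteq> 0"
  \<comment> \<open>The diagonal entry at \<open>i\<close> detects \<open>?d\<close>, unless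
    \<open>i\<close> is the middle index; then the entry at \<open>j\<close> does.\<close>
  proof (cases "i + i = 2 * n")
    case False
    have "?d i i = coord_sign n j i - coord_sign n i i"
      by (simp only: minus_apply root_vec_diag_entry ij)
    then have "?d i i \<noteq> 0"
      using coord_sign_self [OF False] coord_sign_eq_0 [OF ij(4,3)] by simp
    then show ?thesis by (metis zero_fun_apply)
  next
    case True
    then have j: "j + j \<noteq> 2 * n" using ij by linarith
    have "?d j j = coord_sign n j j - coord_sign n i j"
      by (simp only: minus_apply root_vec_diag_entry ij)
    then have "?d j j \<noteq> 0"
      using coord_sign_self [OF j] coord_sign_eq_0 [of j i n] ij by (simp add: add.commute)
    then show ?thesis by (metis zero_fun_apply)
  qed
  then have "loop ?d (k + l) \<noteq> 0"
    using loop_entry [of ?d "k + l" "k + l"] by (metis fst_zero zero_fun_apply)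
  then have "I \<inter> aff_root_space n (weight n 0 0 (k + l)) \<noteq> {0}" using d d' by blast
  moreover have "weight n 0 0 (k + l) \<in> aff_pos_roots n"
    using weight_in_aff_pos_roots [OF n, of 0 0 "k + l"] k n by simp
  ultimately have "aff_root_space n (weight n 0 0 (k + l)) \<subseteq> I"
    using I'(3) by blast
  then show ?thesis using h k n by (auto simp: root_space_imaginary)
qed

lemma fin_pos_rootE:
  assumes "\<gamma> \<in> fin_pos_roots n"
  obtains i j where "i < j" "j \<le> 2 * n" "i + j \<noteq> 2 * n" "extend_root n \<gamma> = weight n i j 0"
proof -
  let ?R = "root_space_of mat_scale (fin_bracket n) (fin_alg n) (fin_cartan n) \<gamma>"
  have R: "?R \<noteq> {0}" "?R \<subseteq> fin_npos n"
    using assms by (auto simp: fin_pos_roots_def pos_roots_of_def roots_of_def)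
  have "0 \<in> ?R" by (simp add: root_space_of_def fin_alg_closed)
  then obtain x where x: "x \<in> ?R" "x \<noteq> 0" using R by blast
  then obtain i j where nz: "x i j \<noteq> 0" by (auto simp: fun_eq_iff)
  have alg: "x \<in> fin_alg n" using x by (simp add: root_space_of_def)
  have \<gamma>: "\<gamma> h = h i i - h j j" if "h \<in> fin_cartan n" for h
  proof -
    have "fin_bracket n h x = mat_scale (\<gamma> h) x" using x that by (simp add: root_space_of_def)
    then have "fin_bracket n h x i j = mat_scale (\<gamma> h) x i j" by (rule arg_cong)
    then show ?thesis using nz unfolding fin_bracket_diag [OF that alg] mat_scale_def by simp
  qed
  have "extend_root n \<gamma> = weight n i j 0"
  proof
    fix h :: affine
    obtain f a b where h: "h = (f, a, b)" by (cases h) auto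
    show "extend_root n \<gamma> h = weight n i j 0 h"
      using \<gamma> by (auto simp: extend_root_def weight_def h aff_cartan_iff)
  qed
  moreover have "i < j" using x R nz by (auto simp: fin_npos_iff not_le [symmetric])
  ultimately show thesis using that fin_alg_entryD [OF alg nz] by blast
qed

text \<open>A root of D other than delta has a complement to delta whose root vector lies in the
  Borel subalgebra, so \<open>ideal_contains_imaginary\<close> applies in total degree 1.\<close>

lemma basic_ideal_contains_delta:
  assumes I: "basic_ideal n I" and n: "n \<ge> 1" and h: "h \<in> fin_cartan n"
  shows "loop h 1 \<in> I"
proof -
  have comb: "combinatorial_ideal n I" using I by (simp add: basic_ideal_def)
  obtain \<alpha> where \<alpha>: "aff_root_space n \<alpha> \<subseteq> I" "\<alpha> \<in> basic_roots n"
    using I by (auto simp: basic_ideal_def ideal_support_def)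
  consider "\<alpha> = delta n" | \<gamma> where "\<gamma> \<in> fin_pos_roots n" "\<alpha> = extend_root n \<gamma>"
    | \<gamma> where "\<gamma> \<in> fin_pos_roots n" "\<alpha> = delta n - extend_root n \<gamma>"
    using \<alpha>(2) by (auto simp: basic_roots_def)
  then show ?thesis
  proof cases
    case 1
    then show ?thesis using \<alpha>(1) h n by (auto simp: delta_eq root_space_imaginary)
  next
    case 2
    then obtain i j where ij: "i < j" "j \<le> 2 * n" "i + j \<noteq> 2 * n" "\<alpha> = weight n i j 0"
      by (auto elim: fin_pos_rootE)
    have "loop (root_vec n i j) 0 \<in> I"
      using loop_root_vec_in_root_space [OF n, of i j 0] ij \<alpha>(1) by auto
    from ideal_contains_imaginary [OF comb n _ _ _ _ _ _ _ this root_vec_in_borel [of j n i 1] h]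
    show ?thesis using ij by simp
  next
    case 3
    then obtain i j where ij: "i < j" "j \<le> 2 * n" "i + j \<noteq> 2 * n" "extend_root n \<gamma> = weight n i j 0"
      by (auto elim: fin_pos_rootE)
    have "\<alpha> = weight n j i 1"
      unfolding 3 ij delta_eq [OF n] by (rule ext) (simp add: weight_def)
    then have "loop (root_vec n j i) 1 \<in> I"
      using loop_root_vec_in_root_space [OF n, of j i 1] ij \<alpha>(1) by (auto simp: add.commute)
    from ideal_contains_imaginary [OF comb n _ _ _ _ _ _ _ this root_vec_in_borel [of i n j 0] h]
    show ?thesis using ij by (simp add: add.commute)
  qed
qed

text \<open>The Cartan element \<open>root_vec n i i\<close> acts on \<open>root_vec n i j\<close>
  by 1. Taken in degree 1, where it is in the ideal, it lifts a Borel root vector from degree k - 1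
  to k. For the middle index it is zero, and \<open>root_vec n j j\<close> takes over.\<close>

lemma basic_ideal_contains_real:
  assumes I: "basic_ideal n I" and n: "n \<ge> 1"
    and ij: "i \<le> 2 * n" "j \<le> 2 * n" "i + j \<noteq> 2 * n" "i \<noteq> j" and k: "1 < k \<or> k = 1 \<and> i < j"
  shows "loop (root_vec n i j) k \<in> I"
proof -
  have lie: "lie_ideal_of aff_scale (aff_bracket n) (borel n) I"
    using I by (simp add: basic_ideal_def combinatorial_ideal_def)
  have b: "loop (root_vec n i j) (k - 1) \<in> borel n"
    using k by (intro root_vec_in_borel ij) auto
  have k0: "0 \<le> k - 1" using k by auto
  show ?thesis
  proof (cases "i + i = 2 * n")
    case False
    have "loop (root_vec n i i) 1 \<in> I"
      by (intro basic_ideal_contains_delta [OF I n] root_vec_diag ij)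
    from ideal_root_vec_trans(2) [OF lie ij(1,1,2) _ k0 False ij(3,4) this b]
    show ?thesis by simp
  next
    case True
    then have j: "j + j \<noteq> 2 * n" using ij by linarith
    have "loop (root_vec n j j) 1 \<in> I"
      by (intro basic_ideal_contains_delta [OF I n] root_vec_diag ij)
    from ideal_root_vec_trans(1) [OF lie ij(1,2,2) k0 _ ij(3) j ij(4) b this]
    show ?thesis by simp
  qed
qed

lemma basic_ideal_contains_imaginary:
  assumes I: "basic_ideal n I" and n: "n \<ge> 1" and k: "1 \<le> k" and h: "h \<in> fin_cartan n"
  shows "loop h k \<in> I"
proof (cases "k = 1")
  case True
  then show ?thesis using basic_ideal_contains_delta [OF I n h] by simp
next
  case False
  have comb: "combinatorial_ideal n I" using I by (simp add: basic_ideal_def)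
  \<comment> \<open>One real root vector of degree 1 is enough; its opposite in degree k - 1 >= 1
    lies in the Borel subalgebra.\<close>
  have "loop (root_vec n 0 1) 1 \<in> I"
    by (rule basic_ideal_contains_real [OF I n]) (use n in auto)
  from ideal_contains_imaginary [OF comb n _ _ _ _ _ _ _ this root_vec_in_borel [of 1 n 0 "k - 1"] h]
  show ?thesis using n k False by simp
qed

lemma ideal_entry:
  assumes I: "combinatorial_ideal n I" and x: "(f, a, b) \<in> I" and nz: "f k i j \<noteq> 0" and ne: "i \<noteq> j"
  shows "loop (root_vec n i j) k \<in> I"
proof -
  note I' = combinatorial_idealD [OF I] and L = lie_ideal_ofD [OF combinatorial_idealD(1) [OF I]]
  have f: "f k \<in> fin_alg n" for k using x I'(2) by (auto simp: aff_npos_iff)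
  have "component n (weight n i j k) (f, a, b) \<in> I"
    using aff_cartan_subset_borel [of n] by (intro component_in_ideal L(1) I'(2) x L(3)) auto
  then have "aff_scale (f k i j) (loop (root_vec n i j) k) \<in> I"
    by (simp only: component_real [OF f ne fin_alg_entryD [OF f nz]])
  then have "aff_scale (inverse (f k i j)) (aff_scale (f k i j) (loop (root_vec n i j) k)) \<in> I"
    by (rule aff.subspace_scale [OF L(1)])
  then show ?thesis using nz by simp
qed

text \<open>For the root gamma of a cell (i, j), position (i, j) in degree 0 carries gamma and
  position (j, i) in degree 1 carries delta - gamma. Reflected positions are controlled by the
  symmetry of \<open>fin_alg\<close>, and all other positive roots are left free.\<close>

definition ideal_of :: "nat \<Rightarrow> (nat \<times> nat) set \<Rightarrow> (nat \<times> nat) set \<Rightarrow> affine set" where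
  "ideal_of n A C = {x \<in> aff_npos n. \<forall>i j. i < j \<and> i + j < 2 * n \<longrightarrow>
     (fst x 0 i j \<noteq> 0 \<longrightarrow> (i, j) \<in> A) \<and> (fst x 1 j i \<noteq> 0 \<longrightarrow> (i, j) \<notin> C)}"

definition lower_cells :: "nat \<Rightarrow> affine set \<Rightarrow> (nat \<times> nat) set" where
  "lower_cells n I = {(i, j) \<in> cells n. loop (root_vec n i j) 0 \<in> I}"

definition missing_cells :: "nat \<Rightarrow> affine set \<Rightarrow> (nat \<times> nat) set" where
  "missing_cells n I = {(i, j) \<in> cells n. loop (root_vec n j i) 1 \<notin> I}"

lemma basic_ideal_eq_ideal_of:
  assumes I: "basic_ideal n I" and n: "n \<ge> 1"
  shows "I = ideal_of n (lower_cells n I) (missing_cells n I)"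
proof
  have comb: "combinatorial_ideal n I" using I by (simp add: basic_ideal_def)
  note I' = combinatorial_idealD [OF comb] and L = lie_ideal_ofD [OF combinatorial_idealD(1) [OF comb]]
  show "I \<subseteq> ideal_of n (lower_cells n I) (missing_cells n I)"
  proof
    fix x assume x: "x \<in> I"
    obtain f a b where x': "x = (f, a, b)" by (cases x) auto
    show "x \<in> ideal_of n (lower_cells n I) (missing_cells n I)"
      using x I'(2) ideal_entry [OF comb x [unfolded x']]
      by (auto simp: ideal_of_def lower_cells_def missing_cells_def cells_def x')
  qed
  show "ideal_of n (lower_cells n I) (missing_cells n I) \<subseteq> I"
  proof
    fix x assume x: "x \<in> ideal_of n (lower_cells n I) (missing_cells n I)"
    obtain f a b where x': "x = (f, a, b)" by (cases x) auto
    have f: "a = 0" "b = 0" "finite {k. f k \<noteq> 0}" "\<And>k. f k \<in> fin_alg n" "\<And>k. k < 0 \<Longrightarrow> f k = 0"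
      "\<And>i j. j \<le> i \<Longrightarrow> f 0 i j = 0"
      using x unfolding ideal_of_def x' by (auto simp: aff_npos_iff)
    have low: "loop (root_vec n i j) 0 \<in> I" if "i < j" "i + j < 2 * n" "f 0 i j \<noteq> 0" for i j
      using x that unfolding ideal_of_def x' by (auto simp: lower_cells_def)
    have high: "loop (root_vec n j i) 1 \<in> I" if "i < j" "i + j < 2 * n" "f 1 j i \<noteq> 0" for i j
      using x that unfolding ideal_of_def x' by (auto simp: missing_cells_def cells_def)
    have "loop (root_vec n i j) k \<in> I" if nz: "f k i j \<noteq> 0" for i j k
    proof -
      note ij = fin_alg_entryD [OF f(4) nz]
      have refl: "f k (2 * n - j) (2 * n - i) \<noteq> 0" using fin_alg_reflect [OF f(4) ij(1,2)] nz by simp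
      have "0 \<le> k" using f(5) nz by (metis not_le zero_fun_apply)
      \<comment> \<open>In this order: roots of Phi+, roots delta - gamma, imaginary roots, and the
        real roots outside D. Only the first two cases depend on the two sets of cells.\<close>
      then consider "k = 0" | "k = 1" "j < i" | "1 \<le> k" "i = j" | "1 < k \<or> k = 1 \<and> i < j" "i \<noteq> j"
        by linarith
      then show ?thesis
      proof cases
        case 1
        then have lt: "i < j" using f(6) nz by (metis not_le)
        show ?thesis
        proof (cases "i + j < 2 * n")
          case True
          then show ?thesis using low lt nz 1 by simp
        next
          case False
          then have "2 * n - j < 2 * n - i" "(2 * n - j) + (2 * n - i) < 2 * n" using ij lt by linarith+
          then have "loop (root_vec n (2 * n - j) (2 * n - i)) 0 \<in> I" using low refl 1 by blast
          then show ?thesis unfolding 1 by (simp only: ideal_root_vec_reflect [OF L(1) ij(1,2)])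
        qed
      next
        case 2
        show ?thesis
        proof (cases "i + j < 2 * n")
          case True
          then show ?thesis using high [of j i] nz 2 by (simp add: add.commute)
        next
          case False
          then have "2 * n - i < 2 * n - j" "(2 * n - i) + (2 * n - j) < 2 * n" using ij 2 by linarith+
          then have "loop (root_vec n (2 * n - j) (2 * n - i)) 1 \<in> I" using high refl 2 by blast
          then show ?thesis unfolding 2 by (simp only: ideal_root_vec_reflect [OF L(1) ij(1,2)])
        qed
      next
        case 3
        then show ?thesis
          using basic_ideal_contains_imaginary [OF I n 3(1) root_vec_diag [OF ij(1)]] by simp
      next
        case 4
        then show ?thesis using basic_ideal_contains_real [OF I n ij 4(2,1)] by simp
      qed
    qed
    then show "x \<in> I"
      unfolding x' f(1,2) by (rule in_subspace_by_root_vecs [OF L(1) f(3,4)])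
  qed
qed

text \<open>The matrix position \<open>(j, l)\<close> with \<open>j + l = 2n\<close> carries no root, but a move from column \<open>j\<close> to
  column \<open>l\<close> can be split at column \<open>l - 1\<close>.\<close>

lemma antidiagonal_gap:
  fixes j l n :: nat
  assumes "j \<le> l" "j \<noteq> l" "j + l = 2 * n"
  shows "j < l - 1" "l - 1 < l" "j + (l - 1) \<noteq> 2 * n" "l - 1 + l \<noteq> 2 * n"
proof -
  obtain d where d: "l = j + d" using assms(1) le_Suc_ex by blast
  have "d \<noteq> 0" "d \<noteq> 1" using assms d by presburger+
  then have "d \<ge> 2" by simp
  then show "j < l - 1" "l - 1 < l" "j + (l - 1) \<noteq> 2 * n" using assms d by auto
  have "l - 1 + l = 2 * (l - 1) + 1" using \<open>d \<ge> 2\<close> d by auto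
  then show "l - 1 + l \<noteq> 2 * n" by presburger
qed

text \<open>The row is raised first, then the column. A column move from j to l with j + l = 2n
  would need the zero vector \<open>root_vec n j l\<close>, so it is split by
  \<open>antidiagonal_gap\<close>.\<close>

lemma basic_ideal_lower_cells:
  assumes I: "basic_ideal n I"
  shows "lower_cells n I \<in> upper_sets n"
proof -
  have lie: "lie_ideal_of aff_scale (aff_bracket n) (borel n) I"
    using I by (simp add: basic_ideal_def combinatorial_ideal_def)
  note raise = ideal_raise [OF lie order.refl]
  have "loop (root_vec n k l) 0 \<in> I"
    if c: "i < j" "i + j < 2 * n" and r: "loop (root_vec n i j) 0 \<in> I" and kl: "k \<le> i" "j \<le> l" "k + l < 2 * n" for i j k l
  proof -
    have kj: "loop (root_vec n k j) 0 \<in> I"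
    proof (cases "k = i")
      case False
      show ?thesis by (rule raise(1) [OF r]) (use False c kl in linarith)+
    qed (use r in simp)
    have step: "loop (root_vec n k q) 0 \<in> I"
      if "loop (root_vec n k p) 0 \<in> I" "p < q" "j \<le> p" "q \<le> l" "p + q \<noteq> 2 * n" for p q
      by (rule raise(2) [OF that(1,2)]) (use that c kl in linarith)+
    show ?thesis
    proof (cases "j = l")
      case False
      show ?thesis
      proof (cases "j + l = 2 * n")
        case True
        note gap = antidiagonal_gap [OF kl(2) False True]
        show ?thesis
          by (rule step [OF step [OF kj gap(1) order.refl _ gap(3)] gap(2) _ order.refl gap(4)]) (use gap in linarith)+
      next
        case ne: False
        show ?thesis by (rule step [OF kj _ order.refl order.refl ne]) (use False kl in linarith)
      qed
    qed (use kj in simp)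
  qed
  note main = this
  have "(k, l) \<in> lower_cells n I"
    if ij: "(i, j) \<in> lower_cells n I" and kl: "k \<le> i" "j \<le> l" "k + l < 2 * n" for i j k l
  proof -
    have c: "i < j" "i + j < 2 * n" "loop (root_vec n i j) 0 \<in> I"
      using ij unfolding lower_cells_def cells_def by blast+
    then have "loop (root_vec n k l) 0 \<in> I" using main [OF c kl] by blast
    moreover have "k < l" using c kl by linarith
    ultimately show ?thesis using kl unfolding lower_cells_def cells_def by blast
  qed
  moreover have "lower_cells n I \<subseteq> cells n" by (auto simp: lower_cells_def)
  ultimately show ?thesis unfolding upper_sets_def by blast
qed

text \<open>Contraposition: gamma <= gamma' means delta - gamma' <= delta - gamma, so a root vector
  present for the larger cell can be raised to the one for the smaller cell.\<close>

lemma basic_ideal_missing_cells: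
  assumes I: "basic_ideal n I"
  shows "missing_cells n I \<in> upper_sets n"
proof -
  have lie: "lie_ideal_of aff_scale (aff_bracket n) (borel n) I"
    using I by (simp add: basic_ideal_def combinatorial_ideal_def)
  note raise = ideal_raise [OF lie zero_le_one]
  have "loop (root_vec n j i) 1 \<in> I"
    if c: "i < j" "i + j < 2 * n" and r: "loop (root_vec n l k) 1 \<in> I" and kl: "k \<le> i" "j \<le> l" "k + l < 2 * n" for i j k l
  proof -
    have step: "loop (root_vec n p k) 1 \<in> I"
      if "loop (root_vec n q k) 1 \<in> I" "p < q" "j \<le> p" "q \<le> l" "p + q \<noteq> 2 * n" for p q
      by (rule raise(1) [OF that(1,2)]) (use that c kl in linarith)+
    have jk: "loop (root_vec n j k) 1 \<in> I"
    proof (cases "j = l")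
      case False
      show ?thesis
      proof (cases "j + l = 2 * n")
        case True
        note gap = antidiagonal_gap [OF kl(2) False True]
        show ?thesis
          by (rule step [OF step [OF r gap(2) _ order.refl gap(4)] gap(1) order.refl _ gap(3)]) (use gap in linarith)+
      next
        case ne: False
        show ?thesis by (rule step [OF r _ order.refl order.refl ne]) (use False kl in linarith)
      qed
    qed (use r in simp)
    show ?thesis
    proof (cases "k = i")
      case False
      show ?thesis by (rule raise(2) [OF jk]) (use False c kl in linarith)+
    qed (use jk in simp)
  qed
  note main = this
  have "(k, l) \<in> missing_cells n I"
    if ij: "(i, j) \<in> missing_cells n I" and kl: "k \<le> i" "j \<le> l" "k + l < 2 * n" for i j k l
  proof -
    have c: "i < j" "i + j < 2 * n" "loop (root_vec n j i) 1 \<notin> I"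
      using ij unfolding missing_cells_def cells_def by blast+
    then have "loop (root_vec n l k) 1 \<notin> I" using main [OF c(1,2) _ kl] by blast
    moreover have "k < l" using c kl by linarith
    ultimately show ?thesis using kl unfolding missing_cells_def cells_def by blast
  qed
  moreover have "missing_cells n I \<subseteq> cells n" by (auto simp: missing_cells_def)
  ultimately show ?thesis unfolding upper_sets_def by blast
qed

text \<open>\<open>root_vec n (2 * n - 1) 0\<close> in degree 1 belongs to the affine simple root
  delta - theta. Its bracket with a root vector from \<open>A\<close> has the root delta - gamma for
  the opposing cell gamma of \<open>C\<close>; reflections make the indices fit.\<close>

lemma basic_ideal_compatible:
  assumes I: "basic_ideal n I"
  shows "compatible n (lower_cells n I) (missing_cells n I)"
proof -
  have lie: "lie_ideal_of aff_scale (aff_bracket n) (borel n) I"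
    using I by (simp add: basic_ideal_def combinatorial_ideal_def)
  note trans = ideal_root_vec_trans [OF lie] and L = lie_ideal_ofD [OF lie]
  have False if "(0, j) \<in> lower_cells n I" "(1, 2 * n - j) \<in> missing_cells n I" for j
  proof -
    have j: "0 < j" "j < 2 * n" "1 < 2 * n - j" and r: "loop (root_vec n 0 j) 0 \<in> I" "loop (root_vec n (2 * n - j) 1) 1 \<notin> I"
      using that by (auto simp: lower_cells_def missing_cells_def cells_def)
    have b: "loop (root_vec n (2 * n - 1) 0) 1 \<in> borel n" by (rule root_vec_in_borel) auto
    have "loop (root_vec n (2 * n - 1) j) (1 + 0) \<in> I"
      by (rule trans(1) [OF _ _ _ _ _ _ _ _ b r(1)]) (use j in linarith)+
    moreover have eq: "2 * n - (2 * n - 1) = 1" using j by linarith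
    have "loop (root_vec n (2 * n - j) 1) 1 \<in> I \<longleftrightarrow> loop (root_vec n (2 * n - 1) j) 1 \<in> I"
      using ideal_root_vec_reflect [OF L(1), of "2 * n - 1" n j 1] j(2) unfolding eq by linarith
    ultimately show False using r(2) by simp
  qed
  moreover have False if "(0, j) \<in> missing_cells n I" "(1, 2 * n - j) \<in> lower_cells n I" for j
  proof -
    have j: "1 < j" "j < 2 * n" "1 < 2 * n - j" and r: "loop (root_vec n 1 (2 * n - j)) 0 \<in> I" "loop (root_vec n j 0) 1 \<notin> I"
      using that by (auto simp: lower_cells_def missing_cells_def cells_def)
    have eq: "2 * n - (2 * n - j) = j" using j by linarith
    have r': "loop (root_vec n j (2 * n - 1)) 0 \<in> I"
      using ideal_root_vec_reflect [OF L(1), of 1 n "2 * n - j" 0] r(1) j unfolding eq by linarith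
    have b: "loop (root_vec n (2 * n - 1) 0) 1 \<in> borel n" by (rule root_vec_in_borel) auto
    have "loop (root_vec n j 0) (0 + 1) \<in> I"
      by (rule trans(2) [OF _ _ _ _ _ _ _ _ r' b]) (use j in linarith)+
    then show False using r(2) by simp
  qed
  ultimately show ?thesis unfolding compatible_def by blast
qed

section \<open>From pairs of upper sets to basic ideals\<close>

text \<open>Positions \<open>(i, j)\<close> and \<open>(2n-j, 2n-i)\<close> carry the same root; only the one above the antidiagonal is
  a cell.\<close>

definition sym_mem :: "nat \<Rightarrow> (nat \<times> nat) set \<Rightarrow> nat \<Rightarrow> nat \<Rightarrow> bool" where
  "sym_mem n A i j \<longleftrightarrow> (if i + j < 2 * n then (i, j) \<in> A else (2 * n - j, 2 * n - i) \<in> A)"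

lemma sym_mem_low: "i + j < 2 * n \<Longrightarrow> sym_mem n A i j \<longleftrightarrow> (i, j) \<in> A"
  by (simp add: sym_mem_def)

lemma sym_mem_high: "2 * n < i + j \<Longrightarrow> sym_mem n A i j \<longleftrightarrow> (2 * n - j, 2 * n - i) \<in> A"
  by (simp add: sym_mem_def)

lemma sym_mem_reflect:
  assumes "i \<le> 2 * n" "j \<le> 2 * n" "i + j \<noteq> 2 * n"
  shows "sym_mem n A (2 * n - j) (2 * n - i) \<longleftrightarrow> sym_mem n A i j"
proof (cases "i + j < 2 * n")
  case True
  then have "2 * n < (2 * n - j) + (2 * n - i)" "2 * n - (2 * n - i) = i" "2 * n - (2 * n - j) = j"
    using assms by linarith+
  then show ?thesis using True by (simp only: sym_mem_low sym_mem_high)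
next
  case False
  then have "(2 * n - j) + (2 * n - i) < 2 * n" "2 * n < i + j" using assms by linarith+
  then show ?thesis by (simp only: sym_mem_low sym_mem_high)
qed

text \<open>The upper set condition extends to both halves of the triangle above the diagonal: a
  move across the antidiagonal becomes, after reflection, a move inside the cells.\<close>

lemma sym_mem_mono:
  assumes A: "A \<in> upper_sets n" and m: "sym_mem n A i j" and lt: "i < j" and ne: "i + j \<noteq> 2 * n" "i' + j' \<noteq> 2 * n"
    and le: "i' \<le> i" "j \<le> j'" "j' \<le> 2 * n"
  shows "sym_mem n A i' j'"
proof -
  obtain a b where ab: "(a, b) \<in> A" "a = i \<and> b = j \<or> a = 2 * n - j \<and> b = 2 * n - i" "a + b < 2 * n"
  proof (cases "i + j < 2 * n")
    case True
    then show thesis using that [of i j] m by (simp only: sym_mem_low) blast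
  next
    case False
    then have "2 * n < i + j" "(2 * n - j) + (2 * n - i) < 2 * n" using ne lt le by linarith+
    then show thesis using that [of "2 * n - j" "2 * n - i"] m by (simp only: sym_mem_high) blast
  qed
  note up = upper_setsD(3) [OF A ab(1)]
  show ?thesis
  proof (cases "i' + j' < 2 * n")
    case True
    have "i' \<le> a" "b \<le> j'" using ab(2,3) True le lt ne by linarith+
    then show ?thesis unfolding sym_mem_low [OF True] using up True by blast
  next
    case False
    then have gt: "2 * n < i' + j'" using ne by linarith
    have "2 * n - j' \<le> a" "b \<le> 2 * n - i'" "(2 * n - j') + (2 * n - i') < 2 * n"
      using ab(2,3) gt le lt ne by linarith+
    then show ?thesis unfolding sym_mem_high [OF gt] using up by blast
  qed
qed

lemma compatible_sym: "compatible n A C \<Longrightarrow> compatible n C A"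
  by (auto simp: compatible_def)

text \<open>Raising both steps turns the chain i, j, k into 0, j, 2n - 1, and its second step
  reflects to (1, 2n - j). This is a pair that \<open>compatible\<close> forbids.\<close>

lemma compatible_chain_aux:
  assumes A: "A \<in> upper_sets n" and C: "C \<in> upper_sets n" and comp: "compatible n A C"
    and m: "sym_mem n A i j" "sym_mem n C j k" and lt: "i < j" "j < k" "k < 2 * n"
    and ne: "i + j \<noteq> 2 * n" "j + k \<noteq> 2 * n"
  shows False
proof -
  have "sym_mem n A 0 j" by (rule sym_mem_mono [OF A m(1)]) (use lt ne in linarith)+
  moreover have "0 + j < 2 * n" using lt by linarith
  ultimately have A0: "(0, j) \<in> A" by (simp only: sym_mem_low)
  show False
  proof (cases "j = 1")
    case False
    have j: "2 * n < j + (2 * n - 1)" using False lt by linarith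
    have "sym_mem n C j (2 * n - 1)" by (rule sym_mem_mono [OF C m(2)]) (use False lt ne in linarith)+
    then have "(2 * n - (2 * n - 1), 2 * n - j) \<in> C" unfolding sym_mem_high [OF j] .
    moreover have "2 * n - (2 * n - 1) = 1" using lt by linarith
    ultimately show False using A0 comp unfolding compatible_def by auto
  next
    case True
    \<comment> \<open>For j = 1 the target (1, 2n - 1) is antidiagonal; the forbidden pair (0, 2),
      (1, 2n - 2) is used in its place.\<close>
    have j: "1 + (2 * n - 2) < 2 * n" using True lt by linarith
    have "sym_mem n C 1 (2 * n - 2)" by (rule sym_mem_mono [OF C m(2)]) (use True lt ne in linarith)+
    then have "(1, 2 * n - 2) \<in> C" unfolding sym_mem_low [OF j] .
    moreover have "(0, 2) \<in> A" by (rule upper_setsD(3) [OF A A0]) (use True lt in linarith)+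
    ultimately show False using comp unfolding compatible_def by blast
  qed
qed

text \<open>The roots of the two steps add up to e_i - e_k, a root unless i + k = 2n. The case k =
  2n with i > 0 is reduced to \<open>compatible_chain_aux\<close> by reflecting the chain, which
  exchanges \<open>A\<close> and \<open>C\<close>.\<close>

lemma compatible_chain:
  assumes A: "A \<in> upper_sets n" and C: "C \<in> upper_sets n" and comp: "compatible n A C"
    and m: "sym_mem n A i j" "sym_mem n C j k" and lt: "i < j" "j < k" "k \<le> 2 * n"
    and ne: "i + j \<noteq> 2 * n" "j + k \<noteq> 2 * n"
  shows "i + k = 2 * n"
proof (rule ccontr)
  assume ik: "i + k \<noteq> 2 * n"
  show False
  proof (cases "k < 2 * n")
    case True
    then show False by (rule compatible_chain_aux [OF A C comp m lt(1,2) _ ne])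
  next
    case False
    then have i: "0 < i" using ik lt by linarith
    have mA: "sym_mem n A (2 * n - j) (2 * n - i)" and mC: "sym_mem n C (2 * n - k) (2 * n - j)"
      using m sym_mem_reflect [of i n j A] sym_mem_reflect [of j n k C] lt ne by auto
    show False
      by (rule compatible_chain_aux [OF C A compatible_sym [OF comp] mC mA]) (use i lt ne in linarith)+
  qed
qed

text \<open>Conditions on all positions instead of cells spare the bracket computation a case
  distinction along the antidiagonal.\<close>

lemma ideal_of_iff:
  "(f, a, b) \<in> ideal_of n A C \<longleftrightarrow> (f, a, b) \<in> aff_npos n \<and>
     (\<forall>i j. f 0 i j \<noteq> 0 \<longrightarrow> sym_mem n A i j) \<and> (\<forall>i j. i < j \<longrightarrow> f 1 j i \<noteq> 0 \<longrightarrow> \<not> sym_mem n C i j)"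
  (is "?L \<longleftrightarrow> ?R")
proof
  assume L: ?L
  have f: "f k \<in> fin_alg n" and f0: "j \<le> i \<Longrightarrow> f 0 i j = 0" for k i j
    using L unfolding ideal_of_def by (auto simp: aff_npos_iff)
  have low: "(i, j) \<in> A" if "i < j" "i + j < 2 * n" "f 0 i j \<noteq> 0" for i j
    using L that unfolding ideal_of_def by simp
  have high: "(i, j) \<notin> C" if "i < j" "i + j < 2 * n" "f 1 j i \<noteq> 0" for i j
    using L that unfolding ideal_of_def by simp
  have "sym_mem n A i j" if nz: "f 0 i j \<noteq> 0" for i j
  proof -
    note ij = fin_alg_entryD [OF f nz]
    have lt: "i < j" using nz f0 by (metis not_le)
    show ?thesis
    proof (cases "i + j < 2 * n")
      case True
      then show ?thesis using low lt nz by (simp only: sym_mem_low)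
    next
      case False
      then have "2 * n < i + j" "2 * n - j < 2 * n - i" "(2 * n - j) + (2 * n - i) < 2 * n" using ij lt by linarith+
      moreover have "f 0 (2 * n - j) (2 * n - i) \<noteq> 0" using fin_alg_reflect [OF f ij(1,2)] nz by simp
      ultimately show ?thesis using low by (simp only: sym_mem_high)
    qed
  qed
  moreover have "\<not> sym_mem n C i j" if nz: "f 1 j i \<noteq> 0" and lt: "i < j" for i j
  proof -
    note ij = fin_alg_entryD [OF f nz]
    show ?thesis
    proof (cases "i + j < 2 * n")
      case True
      then show ?thesis using high lt nz by (simp only: sym_mem_low)
    next
      case False
      then have "2 * n < i + j" "2 * n - j < 2 * n - i" "(2 * n - j) + (2 * n - i) < 2 * n" using ij lt by linarith+
      moreover have "f 1 (2 * n - i) (2 * n - j) \<noteq> 0" using fin_alg_reflect [OF f ij(1,2)] nz by simp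
      ultimately show ?thesis using high by (simp only: sym_mem_high)
    qed
  qed
  moreover have "(f, a, b) \<in> aff_npos n" using L by (simp add: ideal_of_def)
  ultimately show ?R by blast
next
  assume ?R
  then show ?L unfolding ideal_of_def mem_Collect_eq fst_conv using sym_mem_low by blast
qed

section \<open>The constructed subspace is a basic ideal\<close>

lemma aff_npos_subspace: "aff.subspace (aff_npos n)"
  unfolding aff_npos_def by (rule aff.subspace_span)

lemma ideal_of_subspace: "aff.subspace (ideal_of n A C)"
proof (rule aff.subspaceI)
  show "0 \<in> ideal_of n A C"
    using aff.subspace_0 [OF aff_npos_subspace] by (simp add: ideal_of_def zero_prod_def)
  have mem: "x \<in> aff_npos n" "i < j \<Longrightarrow> i + j < 2 * n \<Longrightarrow> fst x 0 i j \<noteq> 0 \<Longrightarrow> (i, j) \<in> A"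
    "i < j \<Longrightarrow> i + j < 2 * n \<Longrightarrow> fst x 1 j i \<noteq> 0 \<Longrightarrow> (i, j) \<notin> C" if "x \<in> ideal_of n A C" for x i j
    using that by (simp_all add: ideal_of_def)
  show "x + y \<in> ideal_of n A C" if x: "x \<in> ideal_of n A C" and y: "y \<in> ideal_of n A C" for x y
  proof -
    have nz: "fst x k i j \<noteq> 0 \<or> fst y k i j \<noteq> 0" if "fst (x + y) k i j \<noteq> 0" for k i j
      using that by (cases "fst x k i j = 0") simp_all
    show ?thesis
      unfolding ideal_of_def
    proof (intro CollectI conjI allI impI; (elim conjE)?)
      show "x + y \<in> aff_npos n"
        by (rule aff.subspace_add [OF aff_npos_subspace mem(1) [OF x] mem(1) [OF y]])
      fix i j assume ij: "i < j" "i + j < 2 * n"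
      show "(i, j) \<in> A" if "fst (x + y) 0 i j \<noteq> 0"
        using nz [OF that] mem(2) [OF x ij] mem(2) [OF y ij] by blast
      show "(i, j) \<notin> C" if "fst (x + y) 1 j i \<noteq> 0"
        using nz [OF that] mem(3) [OF x ij] mem(3) [OF y ij] by blast
    qed
  qed
  show "aff_scale c x \<in> ideal_of n A C" if x: "x \<in> ideal_of n A C" for c x
  proof -
    have nz: "fst x k i j \<noteq> 0" if "fst (aff_scale c x) k i j \<noteq> 0" for k i j
      using that by (cases x) (auto simp: aff_scale_def mat_scale_def)
    show ?thesis
      unfolding ideal_of_def
    proof (intro CollectI conjI allI impI; (elim conjE)?)
      show "aff_scale c x \<in> aff_npos n"
        by (rule aff.subspace_scale [OF aff_npos_subspace mem(1) [OF x]])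
      fix i j assume ij: "i < j" "i + j < 2 * n"
      show "(i, j) \<in> A" if "fst (aff_scale c x) 0 i j \<noteq> 0"
        using mem(2) [OF x ij nz [OF that]] .
      show "(i, j) \<notin> C" if "fst (aff_scale c x) 1 j i \<noteq> 0"
        using mem(3) [OF x ij nz [OF that]] .
    qed
  qed
qed

text \<open>No central term arises: degrees k and -k are both nonnegative only for k = 0, where the
  cocycle has the factor 0. The last conclusion traces a nonzero entry either to \<open>g\<close>
  itself, through the \<open>d\<close>-part, or to one matrix bracket.\<close>

lemma aff_bracket_in_npos:
  assumes x: "(f, a, b) \<in> borel n" and y: "(g, 0, 0) \<in> aff_npos n"
  obtains F where "aff_bracket n (f, a, b) (g, 0, 0) = (F, 0, 0)" "(F, 0, 0) \<in> aff_npos n"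
    "\<And>m i j. F m i j \<noteq> 0 \<Longrightarrow> g m i j \<noteq> 0 \<or> (\<exists>k. 0 \<le> k \<and> k \<le> m \<and> fin_bracket n (f k) (g (m - k)) i j \<noteq> 0)"
proof -
  have f: "finite {k. f k \<noteq> 0}" "\<And>k. f k \<in> fin_alg n" "\<And>k. k < 0 \<Longrightarrow> f k = 0" "\<And>i j. j < i \<Longrightarrow> f 0 i j = 0"
    using x unfolding borel_iff by auto
  have g: "finite {k. g k \<noteq> 0}" "\<And>k. g k \<in> fin_alg n" "\<And>k. k < 0 \<Longrightarrow> g k = 0" "\<And>i j. j \<le> i \<Longrightarrow> g 0 i j = 0"
    using y unfolding aff_npos_iff by auto
  define F where "F m = (\<Sum>k | f k \<noteq> 0. fin_bracket n (f k) (g (m - k))) + mat_scale (b * of_int m) (g m)" for m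
  have "of_int k * killing n (f k) (g (- k)) = 0" for k
  proof -
    consider "k < 0" | "k = 0" | "- k < 0" by linarith
    then show ?thesis by cases (use f(3) g(3) in simp_all)
  qed
  then have "(\<Sum>k | f k \<noteq> 0. of_int k * killing n (f k) (g (- k))) = 0"
    by (intro sum.neutral ballI)
  moreover have "mat_scale 0 A = 0" for A by (simp add: mat_scale_def fun_eq_iff)
  ultimately have eq: "aff_bracket n (f, a, b) (g, 0, 0) = (F, 0, 0)"
    by (simp add: aff_bracket_def F_def [abs_def])
  have entry: "g m i j \<noteq> 0 \<or> (\<exists>k. 0 \<le> k \<and> k \<le> m \<and> fin_bracket n (f k) (g (m - k)) i j \<noteq> 0)" if "F m i j \<noteq> 0" for m i j
  proof (rule ccontr)
    assume neg: "\<not> ?thesis"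
    have "fin_bracket n (f k) (g (m - k)) i j = 0" for k
    proof (cases "0 \<le> k \<and> k \<le> m")
      case False
      then have "f k = 0 \<or> g (m - k) = 0" using f(3) g(3) by auto
      then show ?thesis by auto
    qed (use neg in blast)
    then show False using that neg unfolding F_def by (simp add: cmat_sum_apply mat_scale_def)
  qed
  have "(F, 0, 0) \<in> aff_npos n"
    unfolding aff_npos_iff
  proof (intro conjI allI impI)
    have "F m \<in> fin_alg n" for m
      unfolding F_def
      by (intro fin_alg_closed mat.subspace_sum [OF fin_alg_subspace] fin_bracket_in_fin_alg f g)
    then show "F m \<in> fin_alg n" for m .
    have "{m. F m \<noteq> 0} \<subseteq> {m. g m \<noteq> 0} \<union> (\<lambda>(k, l). k + l) ` ({k. f k \<noteq> 0} \<times> {l. g l \<noteq> 0})"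
    proof
      fix m assume "m \<in> {m. F m \<noteq> 0}"
      then obtain i j where "F m i j \<noteq> 0" by (auto simp: fun_eq_iff)
      then consider "g m i j \<noteq> 0" | k where "fin_bracket n (f k) (g (m - k)) i j \<noteq> 0" using entry by blast
      then show "m \<in> {m. g m \<noteq> 0} \<union> (\<lambda>(k, l). k + l) ` ({k. f k \<noteq> 0} \<times> {l. g l \<noteq> 0})"
      proof cases
        case 1
        then have "g m \<noteq> 0" by (metis zero_fun_apply)
        then show ?thesis by blast
      next
        case 2
        then have "f k \<noteq> 0" "g (m - k) \<noteq> 0" by (metis fin_bracket_zero zero_fun_apply)+
        moreover have "m = k + (m - k)" by simp
        ultimately show ?thesis by (intro UnI2 image_eqI [of _ _ "(k, m - k)"]) auto
      qed
    qed
    then show "finite {m. F m \<noteq> 0}"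
      by (rule finite_subset) (intro finite_UnI finite_imageI finite_cartesian_product f g)
    show "F m = 0" if "m < 0" for m
    proof (intro ext, rule ccontr)
      fix i j assume "F m i j \<noteq> 0 i j"
      then have "F m i j \<noteq> 0" by simp
      then have "g m i j \<noteq> 0 \<or> (\<exists>k\<ge>0. k \<le> m)" using entry by blast
      then show False using that g(3) [OF that] by auto
    qed
    show "F 0 i j = 0" if ji: "j \<le> i" for i j
    proof (rule ccontr)
      assume "F 0 i j \<noteq> 0"
      then obtain k where "0 \<le> k" "k \<le> 0" "fin_bracket n (f k) (g (0 - k)) i j \<noteq> 0"
        using entry g(4) [OF ji] by blast
      then have "fin_bracket n (f 0) (g 0) i j \<noteq> 0" by simp
      then show False
      proof (cases rule: fin_bracket_nonzero)
        case (1 l)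
        then have "i \<le> l" "l < j" using f(4) g(4) by (metis not_le)+
        then show False using ji by linarith
      next
        case (2 l)
        then have "i < l" "l \<le> j" using f(4) g(4) by (metis not_le)+
        then show False using ji by linarith
      qed
    qed
  qed simp_all
  then show thesis using that eq entry by blast
qed

text \<open>Only degrees 0 and 1 carry conditions. Brackets with \<open>f 0\<close> respect them by
  monotonicity of \<open>A\<close> and \<open>C\<close>. A violation by \<open>f 1\<close> and
  \<open>g 0\<close> gives a chain as in \<open>compatible_chain\<close>, which places a nonzero
  entry of \<open>f 1\<close> on the antidiagonal, where all entries vanish.\<close>

lemma ideal_of_bracket:
  assumes A: "A \<in> upper_sets n" and C: "C \<in> upper_sets n" and comp: "compatible n A C"
    and x: "x \<in> borel n" and y: "y \<in> ideal_of n A C"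
  shows "aff_bracket n x y \<in> ideal_of n A C"
proof -
  obtain f a b where x': "x = (f, a, b)" by (cases x) auto
  obtain g where y': "y = (g, 0, 0)" using y by (auto simp: ideal_of_def aff_npos_eq)
  have npos: "(g, 0, 0) \<in> aff_npos n" and g0: "\<And>i j. g 0 i j \<noteq> 0 \<Longrightarrow> sym_mem n A i j"
    and g1: "\<And>i j. i < j \<Longrightarrow> g 1 j i \<noteq> 0 \<Longrightarrow> \<not> sym_mem n C i j"
    using y unfolding y' ideal_of_iff by auto
  have f: "\<And>k. f k \<in> fin_alg n" "\<And>i j. f 0 i j \<noteq> 0 \<Longrightarrow> i \<le> j"
    using x unfolding x' borel_iff by (auto simp: not_less [symmetric])
  have g: "\<And>k. g k \<in> fin_alg n" "\<And>i j. g 0 i j \<noteq> 0 \<Longrightarrow> i < j"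
    using npos unfolding aff_npos_iff by (auto simp: not_le [symmetric])
  obtain F where F: "aff_bracket n (f, a, b) (g, 0, 0) = (F, 0, 0)" "(F, 0, 0) \<in> aff_npos n"
    and entry: "\<And>m i j. F m i j \<noteq> 0 \<Longrightarrow> g m i j \<noteq> 0 \<or> (\<exists>k. 0 \<le> k \<and> k \<le> m \<and> fin_bracket n (f k) (g (m - k)) i j \<noteq> 0)"
    using aff_bracket_in_npos [OF x [unfolded x'] npos] by blast
  have F': "F m \<in> fin_alg n" for m using F(2) by (simp add: aff_npos_iff)
  have "sym_mem n A i j" if nz: "F 0 i j \<noteq> 0" for i j
  proof -
    note ij = fin_alg_entryD [OF F' nz]
    consider "g 0 i j \<noteq> 0" | "fin_bracket n (f 0) (g 0) i j \<noteq> 0"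
      using entry [OF nz] by (metis diff_zero order_antisym)
    then show ?thesis
    proof cases
      case 1
      then show ?thesis by (rule g0)
    next
      case 2
      then show ?thesis
      proof (cases rule: fin_bracket_nonzero)
        case (1 l)
        note gl = fin_alg_entryD [OF g(1) 1(2)]
        show ?thesis
          by (rule sym_mem_mono [OF A g0 [OF 1(2)] g(2) [OF 1(2)] gl(3) ij(3) f(2) [OF 1(1)] order.refl ij(2)])
      next
        case (2 l)
        note gl = fin_alg_entryD [OF g(1) 2(1)]
        show ?thesis
          by (rule sym_mem_mono [OF A g0 [OF 2(1)] g(2) [OF 2(1)] gl(3) ij(3) order.refl f(2) [OF 2(2)] ij(2)])
      qed
    qed
  qed
  moreover have "\<not> sym_mem n C i j" if lt: "i < j" and nz: "F 1 j i \<noteq> 0" for i j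
  proof
    assume m: "sym_mem n C i j"
    note ij = fin_alg_entryD [OF F' nz]
    have ij': "i + j \<noteq> 2 * n" using ij by linarith
    have "k = 0 \<or> k = 1" if "0 \<le> k" "k \<le> 1" for k :: int using that by linarith
    then consider "g 1 j i \<noteq> 0" | "fin_bracket n (f 0) (g 1) j i \<noteq> 0" | "fin_bracket n (f 1) (g 0) j i \<noteq> 0"
      using entry [OF nz] by (metis diff_zero diff_self)
    then show False
    proof cases
      case 1
      then show False using g1 lt m by blast
    next
      case 2
      then show False
      proof (cases rule: fin_bracket_nonzero)
        case (1 l)
        note gl = fin_alg_entryD [OF g(1) 1(2)]
        have jl: "j \<le> l" using f(2) 1(1) by blast
        have "sym_mem n C i l"
          by (rule sym_mem_mono [OF C m lt ij' _ order.refl jl gl(1)]) (use gl in linarith)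
        then show False using g1 [OF _ 1(2)] jl lt by auto
      next
        case (2 l)
        note gl = fin_alg_entryD [OF g(1) 2(1)]
        have li: "l \<le> i" using f(2) 2(2) by blast
        have "sym_mem n C l j"
          by (rule sym_mem_mono [OF C m lt ij' _ li order.refl ij(1)]) (use gl in linarith)
        then show False using g1 [OF _ 2(1)] li lt by auto
      qed
    next
      case 3
      then show False
      proof (cases rule: fin_bracket_nonzero)
        case (1 l)
        note gl = fin_alg_entryD [OF g(1) 1(2)] and fl = fin_alg_entryD [OF f(1) 1(1)]
        have "l + j = 2 * n"
          by (rule compatible_chain [OF A C comp g0 [OF 1(2)] m g(2) [OF 1(2)] lt ij(1) gl(3) ij'])
        then show False using fl by linarith
      next
        case (2 l)
        note gl = fin_alg_entryD [OF g(1) 2(1)] and fl = fin_alg_entryD [OF f(1) 2(2)]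
        have "i + l = 2 * n"
          by (rule compatible_chain [OF C A compatible_sym [OF comp] m g0 [OF 2(1)] lt g(2) [OF 2(1)] gl(2) ij' gl(3)])
        then show False using fl by linarith
      qed
    qed
  qed
  ultimately show ?thesis
    unfolding x' y' F(1) ideal_of_iff using F(2) by blast
qed

lemma ideal_of_contains_high:
  assumes "A \<in> fin_alg n" "2 \<le> k"
  shows "loop A k \<in> ideal_of n U V"
proof -
  have "loop A k \<in> aff_npos n"
    unfolding aff_npos_def by (rule aff.span_base) (use assms in force)
  then show ?thesis using assms(2) by (simp add: ideal_of_def loop_entry)
qed

text \<open>Everything of degree at least 2 is in the ideal, so \<open>c\<close>, \<open>d\<close>
  and the Borel root vectors of degrees 0 and 1 span the quotient.\<close>

lemma ideal_of_finite_codim: "finite_codim_in aff_scale (borel n) (ideal_of n A C)"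
proof -
  define P where "P = {(i, j). i \<le> j \<and> j \<le> 2 * n}"
  define F0 where "F0 = (\<lambda>(i, j). loop (root_vec n i j) 0) ` P"
  define F1 where "F1 = (\<lambda>(i, j). loop (root_vec n i j) 1) ` ({..2 * n} \<times> {..2 * n})"
  let ?F = "{aff_c, aff_d} \<union> F0 \<union> F1"
  let ?W = "aff.span (ideal_of n A C \<union> ?F)"
  have "P \<subseteq> {..2 * n} \<times> {..2 * n}" by (auto simp: P_def)
  then have "finite P" by (rule finite_subset) simp
  then have fin: "finite ?F" by (simp add: F0_def F1_def)
  have sub: "?F \<subseteq> borel n"
  proof -
    have "aff_c \<in> borel n" "aff_d \<in> borel n"
      by (simp_all add: aff_c_def aff_d_def borel_iff fin_alg_closed)
    moreover have "F0 \<subseteq> borel n"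
      unfolding F0_def by (auto simp: P_def intro!: root_vec_in_borel)
    moreover have "F1 \<subseteq> borel n"
      unfolding F1_def by (auto intro!: root_vec_in_borel)
    ultimately show ?thesis by simp
  qed
  have span: "x \<in> ?W" if x: "x \<in> borel n" for x
  proof -
    obtain f a b where x': "x = (f, a, b)" by (cases x) auto
    have f: "finite {k. f k \<noteq> 0}" "\<And>k. f k \<in> fin_alg n" "\<And>k. k < 0 \<Longrightarrow> f k = 0" "\<And>i j. j < i \<Longrightarrow> f 0 i j = 0"
      using x unfolding x' borel_iff by auto
    have "(f, 0, 0) \<in> ?W"
    proof (rule in_subspace_by_root_vecs [OF aff.subspace_span f(1,2)], rule aff.span_base)
      fix i j k assume nz: "f k i j \<noteq> 0"
      note ij = fin_alg_entryD [OF f(2) nz]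
      have "\<not> k < 0"
      proof
        assume "k < 0"
        then have "f k = 0" by (rule f(3))
        with nz show False by simp
      qed
      then consider "k = 0" | "k = 1" | "2 \<le> k" by linarith
      then show "loop (root_vec n i j) k \<in> ideal_of n A C \<union> ?F"
      proof cases
        case 1
        then have "\<not> j < i" using f(4) [of j i] nz by blast
        then have "(i, j) \<in> P" using ij(2) by (simp add: P_def)
        then have "loop (root_vec n i j) k \<in> F0"
          unfolding F0_def 1 by (intro image_eqI [of _ _ "(i, j)"]) simp_all
        then show ?thesis by simp
      next
        case 2
        have "loop (root_vec n i j) k \<in> F1"
          unfolding F1_def 2 using ij by (intro image_eqI [of _ _ "(i, j)"]) simp_all
        then show ?thesis by simp
      next
        case 3
        then show ?thesis using ideal_of_contains_high [OF root_vec_in_fin_alg [OF ij(1,2)] 3] by simp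
      qed
    qed
    moreover have "aff_c \<in> ?W" "aff_d \<in> ?W" by (rule aff.span_base; simp)+
    moreover have "x = (f, 0, 0) + aff_scale a aff_c + aff_scale b aff_d"
      by (simp add: x' aff_c_def aff_d_def aff_scale_def plus_prod_def plus_fun_def)
    ultimately show ?thesis by (metis aff.span_add aff.span_scale)
  qed
  show ?thesis
    unfolding finite_codim_in_def by (intro exI [of _ ?F] conjI fin sub subsetI span)
qed

text \<open>The defining conditions only ask which off-diagonal positions are occupied, and within
  one root space these are a single position and its reflection. So one nonzero element that
  satisfies them forces all others to do so.\<close>

lemma ideal_of_root_spaces:
  assumes \<alpha>: "\<alpha> \<in> aff_pos_roots n"
  shows "ideal_of n A C \<inter> aff_root_space n \<alpha> \<in> {{0}, aff_root_space n \<alpha>}"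
proof (cases "ideal_of n A C \<inter> aff_root_space n \<alpha> \<subseteq> {0}")
  case True
  have "0 \<in> ideal_of n A C" by (rule aff.subspace_0 [OF ideal_of_subspace])
  moreover have "\<alpha> \<in> aff_roots n" using \<alpha> by (simp add: aff_pos_roots_iff)
  then have "0 \<in> aff_root_space n \<alpha>"
    by (elim aff_rootsE) (simp add: aff_root_space_iff zero_prod_def aff_alg_iff fin_alg_closed)
  ultimately show ?thesis using True by blast
next
  case False
  then obtain x where x: "x \<in> ideal_of n A C" "x \<in> aff_root_space n \<alpha>" "x \<noteq> 0" by blast
  have dual: "\<alpha> \<in> dual_of aff_scale (aff_cartan n)" "\<alpha> \<noteq> 0" and npos: "aff_root_space n \<alpha> \<subseteq> aff_npos n"
    using \<alpha> by (auto simp: aff_pos_roots_iff elim: aff_rootsE)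
  obtain f where x': "x = (f, 0, 0)" using x(1) by (auto simp: ideal_of_def aff_npos_eq)
  have f: "\<And>k. f k \<in> fin_alg n" and f0: "\<And>i j. f 0 i j \<noteq> 0 \<Longrightarrow> i < j"
    using x(1) unfolding x' ideal_of_iff aff_npos_iff by (auto simp: not_le [symmetric])
  have fA: "\<And>i j. f 0 i j \<noteq> 0 \<Longrightarrow> sym_mem n A i j"
    and fC: "\<And>i j. i < j \<Longrightarrow> f 1 j i \<noteq> 0 \<Longrightarrow> \<not> sym_mem n C i j"
    using x(1) unfolding x' ideal_of_iff by auto
  have "f \<noteq> 0" using x(3) unfolding x' by (auto simp: zero_prod_def)
  then obtain k i j where nz: "f k i j \<noteq> 0" by (auto simp: fun_eq_iff)
  note ij = fin_alg_entryD [OF f nz]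
  have w: "weight n i j k = \<alpha>" using x(2) nz unfolding x' aff_root_space_iff [OF dual] by simp
  have "y \<in> ideal_of n A C" if y: "y \<in> aff_root_space n \<alpha>" for y
  proof -
    obtain g where y': "y = (g, 0, 0)" using y npos by (auto simp: aff_npos_eq)
    have gn: "(g, 0, 0) \<in> aff_npos n" using y npos y' by blast
    then have g: "\<And>k. g k \<in> fin_alg n" and g0: "\<And>i j. g 0 i j \<noteq> 0 \<Longrightarrow> i < j"
      unfolding aff_npos_iff by (auto simp: not_le [symmetric])
    have same: "k' = k \<and> (i' = i \<and> j' = j \<or> i' = 2 * n - j \<and> j' = 2 * n - i)"
      if "g k' i' j' \<noteq> 0" "i' \<noteq> j'" for k' i' j'
    proof -
      have w': "weight n i j k = weight n i' j' k'"
        using y that(1) w unfolding y' aff_root_space_iff [OF dual] by simp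
      show ?thesis
        using weight_inject [OF w' ij(1,2) fin_alg_entryD(1,2) [OF g that(1)] ij(3)] that(2) by blast
    qed
    have "sym_mem n A i' j'" if "g 0 i' j' \<noteq> 0" for i' j'
    proof -
      have "i' \<noteq> j'" using g0 [OF that] by simp
      from same [OF that this] have k: "k = 0" and pos: "i' = i \<and> j' = j \<or> i' = 2 * n - j \<and> j' = 2 * n - i" by auto
      have "sym_mem n A i j" using fA nz unfolding k by blast
      then show ?thesis using pos sym_mem_reflect [OF ij] by blast
    qed
    moreover have "\<not> sym_mem n C i' j'" if "i' < j'" "g 1 j' i' \<noteq> 0" for i' j'
    proof -
      from same [OF that(2)] that(1) have k: "k = 1" and pos: "j' = i \<and> i' = j \<or> j' = 2 * n - j \<and> i' = 2 * n - i" by auto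
      have "j < i" using pos that(1) by linarith
      then have "\<not> sym_mem n C j i" using fC nz unfolding k by blast
      moreover have "j + i \<noteq> 2 * n" using ij(3) by linarith
      ultimately show ?thesis using pos sym_mem_reflect [OF ij(2,1)] by blast
    qed
    ultimately show ?thesis unfolding y' ideal_of_iff using gn by blast
  qed
  then show ?thesis by blast
qed

lemma ideal_of_basic:
  assumes n: "n \<ge> 1" and AC: "A \<in> upper_sets n" "C \<in> upper_sets n" "compatible n A C"
  shows "basic_ideal n (ideal_of n A C)"
proof -
  have "ideal_of n A C \<subseteq> aff_npos n" by (auto simp: ideal_of_def)
  moreover from this have "ideal_of n A C \<subseteq> borel n" using aff_npos_subset(1) by blast
  ultimately have "combinatorial_ideal n (ideal_of n A C)"
    using ideal_of_subspace ideal_of_bracket [OF AC] ideal_of_finite_codim ideal_of_root_spaces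
    unfolding combinatorial_ideal_def lie_ideal_of_def by blast
  moreover have "delta n \<in> ideal_support n (ideal_of n A C) \<inter> basic_roots n"
  proof -
    have "delta n \<in> aff_pos_roots n"
      unfolding delta_eq [OF n] using weight_in_aff_pos_roots [OF n, of 0 0 1] n by simp
    moreover have "aff_root_space n (delta n) \<subseteq> ideal_of n A C"
    proof
      fix x assume "x \<in> aff_root_space n (delta n)"
      then obtain h where h: "x = loop h 1" "h \<in> fin_cartan n"
        using n by (auto simp: delta_eq root_space_imaginary)
      have "loop h 1 \<in> aff_npos n"
        unfolding aff_npos_def by (rule aff.span_base) (use h in \<open>force simp: fin_cartan_iff\<close>)
      then show "x \<in> ideal_of n A C" using h by (auto simp: ideal_of_def loop_entry fin_cartan_iff)
    qed
    ultimately show ?thesis by (simp add: ideal_support_def basic_roots_def)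
  qed
  ultimately show ?thesis unfolding basic_ideal_def by blast
qed

section \<open>The bijection between basic ideals and compatible pairs\<close>

lemma loop_in_ideal_of:
  assumes "(i, j) \<in> cells n"
  shows "loop (root_vec n i j) 0 \<in> ideal_of n A C \<longleftrightarrow> (i, j) \<in> A"
    and "loop (root_vec n j i) 1 \<in> ideal_of n A C \<longleftrightarrow> (i, j) \<notin> C"
proof -
  have ij: "i < j" "i + j < 2 * n" using assms by (auto simp: cells_def)
  have alg: "root_vec n i j \<in> fin_alg n" "root_vec n j i \<in> fin_alg n"
    by (rule root_vec_in_fin_alg; use ij in linarith)+
  have nz: "root_vec n i j i j \<noteq> 0" "root_vec n j i j i \<noteq> 0" using ij by simp_all
  have only: "p = i \<and> q = j" if "root_vec n i j p q \<noteq> 0" "p + q < 2 * n" for p q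
    using root_vec_nonzeroD [OF that(1)] that(2) ij by linarith
  have only': "p = j \<and> q = i" if "root_vec n j i p q \<noteq> 0" "q + p < 2 * n" for p q
    using root_vec_nonzeroD [OF that(1)] that(2) ij by linarith
  have "root_vec n i j p q = 0" if "q \<le> p" for p q
    using root_vec_nonzeroD [of n i j p q] that ij by linarith
  then have "root_vec n i j \<in> fin_npos n" using alg by (simp add: fin_npos_iff)
  then have np0: "loop (root_vec n i j) 0 \<in> aff_npos n"
    unfolding aff_npos_def by (auto intro!: aff.span_base)
  have np1: "loop (root_vec n j i) 1 \<in> aff_npos n"
    unfolding aff_npos_def by (rule aff.span_base) (use alg in force)
  show "loop (root_vec n i j) 0 \<in> ideal_of n A C \<longleftrightarrow> (i, j) \<in> A"
    using np0 nz(1) only ij unfolding ideal_of_def by (auto simp: loop_entry)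
  show "loop (root_vec n j i) 1 \<in> ideal_of n A C \<longleftrightarrow> (i, j) \<notin> C"
    using np1 nz(2) only' ij unfolding ideal_of_def by (auto simp: loop_entry)
qed

lemma cells_of_ideal_of:
  assumes "A \<in> upper_sets n" "C \<in> upper_sets n"
  shows "lower_cells n (ideal_of n A C) = A" "missing_cells n (ideal_of n A C) = C"
proof -
  have "A \<subseteq> cells n" "C \<subseteq> cells n" using assms by (auto simp: upper_sets_def)
  then show "lower_cells n (ideal_of n A C) = A" "missing_cells n (ideal_of n A C) = C"
    by (auto simp: lower_cells_def missing_cells_def loop_in_ideal_of)
qed

lemma num_basic_ideals_eq:
  assumes "n \<ge> 1"
  shows "num_basic_ideals n = card {(A, C). A \<in> upper_sets n \<and> C \<in> upper_sets n \<and> compatible n A C}"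
proof -
  have "bij_betw (\<lambda>I. (lower_cells n I, missing_cells n I)) {I. basic_ideal n I}
      {(A, C). A \<in> upper_sets n \<and> C \<in> upper_sets n \<and> compatible n A C}"
  proof (rule bij_betw_byWitness [of _ "\<lambda>(A, C). ideal_of n A C"])
    show "\<forall>I\<in>{I. basic_ideal n I}. (case (lower_cells n I, missing_cells n I) of (A, C) \<Rightarrow> ideal_of n A C) = I"
      unfolding prod.case using basic_ideal_eq_ideal_of [OF _ assms] by blast
  qed (use assms in \<open>auto simp: cells_of_ideal_of basic_ideal_lower_cells
        basic_ideal_missing_cells basic_ideal_compatible ideal_of_basic\<close>)
  then show ?thesis unfolding num_basic_ideals_def by (rule bij_betw_same_card)
qed

theorem mainTheorem2:
  fixes n :: nat
  assumes "n \<ge> 4"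
  shows "real (num_basic_ideals n) - 8 * real (num_basic_ideals (n - 1))
           + 16 * real (num_basic_ideals (n - 2))
         = 24 / (real n - 1) * real ((2 * n - 6) choose (n - 2))"
proof (rule recurrence_of_closed_form [OF _ assms])
  fix m
  show "real (num_basic_ideals (Suc m)) = 4 ^ m * (3 * real m + 8) - (6 * real m + 4) * real (2 * m choose m)"
    using num_basic_ideals_eq [of "Suc m"] card_compatible_pairs [of m] by simp
qed

end
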